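(* (a) Let $\alpha\in\mathcal A$ and let $\underline\varepsilon=(\varepsilon^{(i)})_{i\in\mathbb Z}$ be a sequence of i.i.d. random excursions with distribution $\nu_\alpha$. Let $\hat\mu_\alpha$ be the distribution of $\eta=\eta[\underline\varepsilon]$, the random ball configuration with record $0$ at the origin and excursions $(\varepsilon^{(i)})_{i\in\mathbb Z}$. Let $\zeta:=D\eta$ be the soliton decomposition of $\eta$. Then the random variables $\zeta_k(j)$, $j\in\mathbb Z$, $k\ge1$, are independent and $\zeta_k(j)$ is Geometric$(1-q_k(\alpha))$. (b) Conversely, let $q\in\mathcal Q$ and let $\zeta=((\zeta_k(j))_{j\in\mathbb Z})_{k\ge1}$ be an array of independent random variables with $\zeta_k(j)$ distributed as Geometric$(1-q_k)$ for all $j\in\mathbb Z$, $k\ge1$. Then $\zeta\in\mathcal Z$ with probability $1$ and, denoting $\eta:=D^{-1}\zeta$, the excursions $\varepsilon^{(i)}[\eta]$, $i\in\mathbb Z$, are i.i.d. with law $\nu_{\alpha(q)}$, so that $\eta$ has law $\hat\mu_{\alpha(q)}$, a record-translation invariant measure.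
   Context: Conventions: $\mathbb N=\{1,2,\dots\}$, $0^0=1$. $Y$ is Geometric$(p)$, $p\in(0,1]$, if $P(Y=j)=p(1-p)^j$ for $j\ge0$. Excursions. An excursion is a finite integer sequence $\varepsilon=(\varepsilon(0),\dots,\varepsilon(2n))$, $n=n(\varepsilon)\ge0$, with $\varepsilon(0)=\varepsilon(2n)=0$, $\varepsilon(z)\ge0$ for $0\le z\le 2n$ and $|\varepsilon(z)-\varepsilon(z-1)|=1$ ($n=0$: empty excursion). $\mathcal E$ is the set of all excursions. The ball configuration of $\varepsilon$ is $W^{-1}\varepsilon\in\{0,1\}^{\mathbb Z}$ with $W^{-1}\varepsilon(z)=(\varepsilon(z)-\varepsilon(z-1)+1)/2$ for $1\le z\le 2n$ and $0$ for all other $z$. Solitons (Takahashi-Satsuma algorithm). A run of a configuration is a maximal (possibly infinite) interval of consecutive boxes on which the configuration is constant. Starting from the ball configuration of $\varepsilon$, as long as there are finite runs: let $k$ be the smallest size of a run, take the leftmost run of size $k$, and declare the $k$ boxes of this run together with the first $k$ boxes of the next run to be a $k$-soliton; then delete (ignore) these $2k$ boxes, recompute the runs, and repeat. A $k$-soliton $\gamma$ consists of $k$ occupied boxes $h_0(\gamma)<\dots<h_{k-1}(\gamma)$ and $k$ empty boxes $t_0(\gamma)<\dots<t_{k-1}(\gamma)$; its support is the set of these $2k$ boxes. $n_k(\varepsilon)$ is the number of $k$-solitons of $\varepsilon$. Box $z$ is a $k$-slot of $\varepsilon$ if $z=0$ or $z\in\{h_i(\gamma),t_i(\gamma)\}$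 for some $i\ge k$ and some $m$-soliton $\gamma$ of $\varepsilon$ with $m>k$. Measures on excursions and parameters. For $\alpha=(\alpha_k)_{k\ge1}$ with $\alpha_k\in[0,1)$ let $Z_\alpha:=\sum_{\varepsilon\in\mathcal E}\prod_{k\ge1}\alpha_k^{n_k(\varepsilon)}$, $\mathcal A:=\{\alpha:Z_\alpha<\infty\}$, and for $\alpha\in\mathcal A$ let $\nu_\alpha(\varepsilon):=Z_\alpha^{-1}\prod_{k\ge1}\alpha_k^{n_k(\varepsilon)}$. For $q=(q_k)_{k\ge1}$ with $q_k\in[0,1)$ let $\mathcal Q:=\{q:\sum_kq_k<\infty\}$. The map $q(\alpha)$ is given by $q_1=\alpha_1$, $q_k=\alpha_k/\prod_{j=1}^{k-1}(1-q_j)^{2(k-j)}$ for $k\ge 2$, and $\alpha(q)$ by $\alpha_k=q_k\prod_{\ell=1}^{k-1}(1-q_\ell)^{2(k-\ell)}$; these are mutually inverse bijections between $\mathcal A$ and $\mathcal Q$. Configurations, records, concatenation. For $\eta\in\{0,1\}^{\mathbb Z}$ let $W\eta=\xi$ be the walk with $\xi(0)=0$, $\xi(z)-\xi(z-1)=2\eta(z)-1$. $z$ is a record of $\eta$ if $\xi(z)<\xi(z')$ for all $z'<z$; record $i$ is at $r(\eta,i):=\min\{z:\xi(z)=-i\}$. Let $\hat\Omega$ be the set of $\eta$ with a record at $0$ and such that $r(\eta,i)\in\mathbb Z$ exists for every $i\in\mathbb Z$ (then $r(\eta,0)=0$). For $\eta\in\hat\Omega$, excursion $i$ is $\varepsilon^{(i)}[\eta]$,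 with $n=(r(\eta,i+1)-r(\eta,i)-1)/2$ and $\varepsilon^{(i)}(z)=\xi(r(\eta,i)+z)-\xi(r(\eta,i))$, $0\le z\le 2n$. The map $\eta\mapsto(\varepsilon^{(i)}[\eta])_{i}$ is a bijection $\hat\Omega\to\mathcal E^{\mathbb Z}$; its inverse $\underline\varepsilon\mapsto\eta[\underline\varepsilon]$ is given by $r(\eta,0)=0$, $r(\eta,i+1)-r(\eta,i)=2n(\varepsilon^{(i)})+1$, $\eta(r(\eta,i)+z)=W^{-1}\varepsilon^{(i)}(z)$ for $0\le z\le 2n(\varepsilon^{(i)})$. Soliton decomposition. For $\eta=\eta[\underline\varepsilon]\in\hat\Omega$, the $k$-solitons and $k$-slots of $\eta$ are those of the excursions $\varepsilon^{(i)}$ translated by $r(\eta,i)$, $i\in\mathbb Z$ (so every record is a $k$-slot for all $k$). Enumerate the $k$-slots increasingly by $j\in\mathbb Z$, $\mathtt s_k(\eta,j)$, with $\mathtt s_k(\eta,0)=r(\eta,0)=0$. A $k$-soliton is appended to $k$-slot $j$ if its support is contained in the open interval $(\mathtt s_k(\eta,j),\mathtt s_k(\eta,j+1))$. Let $\zeta_k(j)$ be the number of $k$-solitons of $\eta$ appended to $k$-slot $j$, and $D\eta:=\zeta=((\zeta_k(j))_{j\in\mathbb Z})_{k\ge1}$. Let $\mathcal Z$ be the set of arrays $\zeta\in((\mathbb Z_{\ge0})^{\mathbb Z})^{\mathbb N}$ such that $\sup\{k:\zeta_k(j)>0\}<\infty$ for all $j\in\mathbb Z$. $D$ is a bijection from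 $\hat\Omega$ onto $\mathcal Z$; $D^{-1}\zeta$ denotes the unique $\eta\in\hat\Omega$ with $D\eta=\zeta$. Record-translation invariance. With $(\tau^y\eta)(z)=\eta(z+y)$, a probability $\hat\mu$ on $\hat\Omega$ is record-translation invariant if $\int f(\tau^{r(\eta,i)}\eta)\,\hat\mu(d\eta)=\int f(\eta)\,\hat\mu(d\eta)$ for all $i\in\mathbb Z$ and all bounded measurable $f$. *)

theory Defs
  imports "HOL-Probability.Probability"
begin

text \<open>Sequences \<open>(x\<^sub>k)\<close> with \<open>k \<ge> 1\<close> are functions on \<^typ>\<open>nat\<close> whose value at \<open>0\<close> is never used.
  A configuration in \<open>{0,1}\<close> to the power of the integers is a function \<^typ>\<open>int \<Rightarrow> bool\<close>, where
  \<^term>\<open>True\<close> (that is, \<open>1\<close>) is an occupied box.\<close>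

text \<open>The excursion \<open>(e(0), \<dots>, e(2n))\<close> is a list of length \<open>2n + 1\<close>.\<close>

definition excursions :: "int list set" where
  "excursions = {e. odd (length e) \<and> e ! 0 = 0 \<and> e ! (length e - 1) = 0 \<and>
     (\<forall>z<length e. 0 \<le> e ! z) \<and>
     (\<forall>z. 1 \<le> z \<and> z < length e \<longrightarrow> \<bar>e ! z - e ! (z - 1)\<bar> = 1)}"

definition half_length :: "int list \<Rightarrow> nat" where
  "half_length e = (length e - 1) div 2"

definition ball_config :: "int list \<Rightarrow> int \<Rightarrow> bool" where
  "ball_config e z \<longleftrightarrow> 1 \<le> z \<and> z \<le> 2 * int (half_length e) \<and>
     (e ! nat z - e ! nat (z - 1) + 1) div 2 = 1"

text \<open>The argument \<open>R\<close> is the set of boxes that have not been deleted yet; ``consecutive'' always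
  means consecutive within \<open>R\<close>.\<close>

definition constant_interval :: "(int \<Rightarrow> bool) \<Rightarrow> int set \<Rightarrow> int set \<Rightarrow> bool" where
  "constant_interval \<eta> R A \<longleftrightarrow> A \<noteq> {} \<and> A \<subseteq> R \<and>
     (\<forall>x\<in>A. \<forall>y\<in>A. \<forall>z\<in>R. x < z \<and> z < y \<longrightarrow> z \<in> A) \<and>
     (\<forall>x\<in>A. \<forall>y\<in>A. \<eta> x = \<eta> y)"

definition run :: "(int \<Rightarrow> bool) \<Rightarrow> int set \<Rightarrow> int set \<Rightarrow> bool" where
  "run \<eta> R A \<longleftrightarrow> constant_interval \<eta> R A \<and>
     (\<forall>B. constant_interval \<eta> R B \<and> A \<subseteq> B \<longrightarrow> B = A)"

text \<open>Since \<^const>\<open>card\<close> is \<open>0\<close> on infinite sets, finiteness is required explicitly wherever the size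
  of a run is used; an infinite run is never a smallest one.\<close>

definition leftmost_smallest_run :: "(int \<Rightarrow> bool) \<Rightarrow> int set \<Rightarrow> int set \<Rightarrow> bool" where
  "leftmost_smallest_run \<eta> R A \<longleftrightarrow> run \<eta> R A \<and> finite A \<and>
     (\<forall>B. run \<eta> R B \<and> finite B \<longrightarrow> card A \<le> card B) \<and>
     (\<forall>B. run \<eta> R B \<and> finite B \<and> card B = card A \<longrightarrow> Min A \<le> Min B)"

definition next_run :: "(int \<Rightarrow> bool) \<Rightarrow> int set \<Rightarrow> int set \<Rightarrow> int set \<Rightarrow> bool" where
  "next_run \<eta> R A B \<longleftrightarrow> run \<eta> R B \<and> (\<forall>a\<in>A. \<forall>b\<in>B. a < b) \<and>
     (\<forall>z\<in>R. (\<forall>a\<in>A. a < z) \<longrightarrow> (\<exists>b\<in>B. b \<le> z))"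

definition first_boxes :: "int set \<Rightarrow> nat \<Rightarrow> int set \<Rightarrow> bool" where
  "first_boxes B k C \<longleftrightarrow> C \<subseteq> B \<and> finite C \<and> card C = k \<and> (\<forall>x\<in>C. \<forall>y\<in>B. y < x \<longrightarrow> y \<in> C)"

definition next_soliton :: "(int \<Rightarrow> bool) \<Rightarrow> int set \<Rightarrow> nat \<Rightarrow> int set \<Rightarrow> bool" where
  "next_soliton \<eta> R k \<gamma> \<longleftrightarrow> (\<exists>A B C. leftmost_smallest_run \<eta> R A \<and> card A = k \<and>
     next_run \<eta> R A B \<and> first_boxes B k C \<and> \<gamma> = A \<union> C)"

inductive remaining_boxes :: "(int \<Rightarrow> bool) \<Rightarrow> int set \<Rightarrow> bool" for \<eta> where
  start: "remaining_boxes \<eta> UNIV"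
| delete: "remaining_boxes \<eta> R \<Longrightarrow> next_soliton \<eta> R k \<gamma> \<Longrightarrow> remaining_boxes \<eta> (R - \<gamma>)"

text \<open>A soliton is identified with its support.\<close>

definition excursion_solitons :: "nat \<Rightarrow> int list \<Rightarrow> int set set" where
  "excursion_solitons k e =
     {\<gamma>. \<exists>R. remaining_boxes (ball_config e) R \<and> next_soliton (ball_config e) R k \<gamma>}"

definition soliton_head :: "(int \<Rightarrow> bool) \<Rightarrow> int set \<Rightarrow> nat \<Rightarrow> int" where
  "soliton_head \<eta> \<gamma> i = sorted_list_of_set {z\<in>\<gamma>. \<eta> z} ! i"

definition soliton_tail :: "(int \<Rightarrow> bool) \<Rightarrow> int set \<Rightarrow> nat \<Rightarrow> int" where
  "soliton_tail \<eta> \<gamma> i = sorted_list_of_set {z\<in>\<gamma>. \<not> \<eta> z} ! i"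

definition soliton_number :: "nat \<Rightarrow> int list \<Rightarrow> nat" where
  "soliton_number k e = card (excursion_solitons k e)"

definition excursion_slots :: "nat \<Rightarrow> int list \<Rightarrow> int set" where
  "excursion_slots k e = {z. z = 0 \<or>
     (\<exists>m \<gamma> i. k < m \<and> \<gamma> \<in> excursion_solitons m e \<and> k \<le> i \<and> i < m \<and>
        z \<in> {soliton_head (ball_config e) \<gamma> i, soliton_tail (ball_config e) \<gamma> i})}"

definition excursion_weight :: "(nat \<Rightarrow> real) \<Rightarrow> int list \<Rightarrow> real" where
  "excursion_weight \<alpha> e = (\<Prod>k. \<alpha> (Suc k) ^ soliton_number (Suc k) e)"

definition partition_function :: "(nat \<Rightarrow> real) \<Rightarrow> ennreal" where
  "partition_function \<alpha> = (\<integral>\<^sup>+ e. ennreal (excursion_weight \<alpha> e) \<partial>count_space excursions)"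

definition param_A :: "(nat \<Rightarrow> real) set" where
  "param_A = {\<alpha>. (\<forall>k\<ge>1. 0 \<le> \<alpha> k \<and> \<alpha> k < 1) \<and> partition_function \<alpha> < \<infinity>}"

definition nu :: "(nat \<Rightarrow> real) \<Rightarrow> int list measure" where
  "nu \<alpha> = density (count_space excursions)
     (\<lambda>e. ennreal (excursion_weight \<alpha> e) / partition_function \<alpha>)"

definition param_Q :: "(nat \<Rightarrow> real) set" where
  "param_Q = {q. (\<forall>k\<ge>1. 0 \<le> q k \<and> q k < 1) \<and> summable (\<lambda>k. q (Suc k))}"

fun q_of :: "(nat \<Rightarrow> real) \<Rightarrow> nat \<Rightarrow> real" where
  "q_of \<alpha> k = \<alpha> k / (\<Prod>j\<in>{1..<k}. (1 - q_of \<alpha> j) ^ (2 * (k - j)))"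

declare q_of.simps [simp del]

definition alpha_of :: "(nat \<Rightarrow> real) \<Rightarrow> nat \<Rightarrow> real" where
  "alpha_of q k = q k * (\<Prod>l\<in>{1..<k}. (1 - q l) ^ (2 * (k - l)))"

text \<open>At most one of the two index sets is nonempty, and the definition amounts to the two
  properties in the lemmas \<open>walk_0\<close> and \<open>walk_step\<close>.\<close>

definition walk :: "(int \<Rightarrow> bool) \<Rightarrow> int \<Rightarrow> int" where
  "walk \<eta> z = (\<Sum>y\<in>{1..z}. 2 * of_bool (\<eta> y) - 1) - (\<Sum>y\<in>{z+1..0}. 2 * of_bool (\<eta> y) - 1)"

lemma walk_0: "walk \<eta> 0 = 0"
  by (simp add: walk_def)

lemma walk_step: "walk \<eta> z - walk \<eta> (z - 1) = 2 * of_bool (\<eta> z) - 1"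
proof (cases "1 \<le> z")
  case True
  then have "{1..z} = insert z {1..z-1}" by auto
  with True show ?thesis by (simp add: walk_def)
next
  case False
  then have "{z..0} = insert z {z+1..0}" by auto
  with False show ?thesis by (simp add: walk_def)
qed

definition is_record :: "(int \<Rightarrow> bool) \<Rightarrow> int \<Rightarrow> bool" where
  "is_record \<eta> z \<longleftrightarrow> (\<forall>z'<z. walk \<eta> z < walk \<eta> z')"

definition record_pos :: "(int \<Rightarrow> bool) \<Rightarrow> int \<Rightarrow> int" where
  "record_pos \<eta> i = (LEAST z. walk \<eta> z = - i)"

definition Omega_hat :: "(int \<Rightarrow> bool) set" where
  "Omega_hat = {\<eta>. is_record \<eta> 0 \<and>
     (\<forall>i. \<exists>z. walk \<eta> z = - i \<and> (\<forall>z'. walk \<eta> z' = - i \<longrightarrow> z \<le> z'))}"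

definition excursion_at :: "(int \<Rightarrow> bool) \<Rightarrow> int \<Rightarrow> int list" where
  "excursion_at \<eta> i =
     (let n = nat ((record_pos \<eta> (i + 1) - record_pos \<eta> i - 1) div 2)
      in map (\<lambda>z. walk \<eta> (record_pos \<eta> i + int z) - walk \<eta> (record_pos \<eta> i)) [0..<2 * n + 1])"

text \<open>The position \<open>r(i)\<close> determined by \<open>r(0) = 0\<close> and \<open>r(i+1) - r(i) = 2 n(\<epsilon>\<^sub>i) + 1\<close>, for all
  integers \<open>i\<close>.\<close>

definition concat_pos :: "(int \<Rightarrow> int list) \<Rightarrow> int \<Rightarrow> int" where
  "concat_pos \<epsilon> i = (\<Sum>j\<in>{0..<i}. 2 * int (half_length (\<epsilon> j)) + 1) -
     (\<Sum>j\<in>{i..<0}. 2 * int (half_length (\<epsilon> j)) + 1)"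

definition concat_excursions :: "(int \<Rightarrow> int list) \<Rightarrow> int \<Rightarrow> bool" where
  "concat_excursions \<epsilon> x \<longleftrightarrow> (\<exists>i z. 0 \<le> z \<and> z \<le> 2 * int (half_length (\<epsilon> i)) \<and>
     x = concat_pos \<epsilon> i + z \<and> ball_config (\<epsilon> i) z)"

definition solitons :: "nat \<Rightarrow> (int \<Rightarrow> bool) \<Rightarrow> int set set" where
  "solitons k \<eta> =
     (\<Union>i. (\<lambda>\<gamma>. (\<lambda>z. record_pos \<eta> i + z) ` \<gamma>) ` excursion_solitons k (excursion_at \<eta> i))"

definition slots :: "nat \<Rightarrow> (int \<Rightarrow> bool) \<Rightarrow> int set" where
  "slots k \<eta> = (\<Union>i. (\<lambda>z. record_pos \<eta> i + z) ` excursion_slots k (excursion_at \<eta> i))"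

text \<open>A strictly increasing enumeration by the integers is unique once its value at \<open>0\<close> is fixed.\<close>

definition slot :: "nat \<Rightarrow> (int \<Rightarrow> bool) \<Rightarrow> int \<Rightarrow> int" where
  "slot k \<eta> = (THE s. strict_mono s \<and> range s = slots k \<eta> \<and> s 0 = 0)"

definition soliton_decomposition :: "(int \<Rightarrow> bool) \<Rightarrow> nat \<Rightarrow> int \<Rightarrow> nat" where
  "soliton_decomposition \<eta> k j =
     card {\<gamma> \<in> solitons k \<eta>. \<gamma> \<subseteq> {slot k \<eta> j<..<slot k \<eta> (j + 1)}}"

definition soliton_arrays :: "(nat \<Rightarrow> int \<Rightarrow> nat) set" where
  "soliton_arrays = {\<zeta>. \<forall>j. bdd_above {k. 1 \<le> k \<and> 0 < \<zeta> k j}}"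

definition inverse_decomposition :: "(nat \<Rightarrow> int \<Rightarrow> nat) \<Rightarrow> int \<Rightarrow> bool" where
  "inverse_decomposition \<zeta> =
     (THE \<eta>. \<eta> \<in> Omega_hat \<and> (\<forall>k\<ge>1. \<forall>j. soliton_decomposition \<eta> k j = \<zeta> k j))"

definition config_space :: "(int \<Rightarrow> bool) measure" where
  "config_space = restrict_space (PiM UNIV (\<lambda>_. count_space UNIV)) Omega_hat"

definition mu_hat :: "(nat \<Rightarrow> real) \<Rightarrow> (int \<Rightarrow> bool) measure" where
  "mu_hat \<alpha> = distr (PiM UNIV (\<lambda>_. nu \<alpha>)) config_space concat_excursions"

definition translate :: "int \<Rightarrow> (int \<Rightarrow> bool) \<Rightarrow> int \<Rightarrow> bool" where
  "translate y \<eta> = (\<lambda>z. \<eta> (z + y))"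

definition record_translation_invariant :: "(int \<Rightarrow> bool) measure \<Rightarrow> bool" where
  "record_translation_invariant \<mu> \<longleftrightarrow> prob_space \<mu> \<and> space \<mu> = Omega_hat \<and> sets \<mu> = sets config_space \<and>
     (\<forall>i. \<forall>f :: (int \<Rightarrow> bool) \<Rightarrow> real. f \<in> borel_measurable config_space \<and>
        (\<exists>C. \<forall>\<eta>\<in>Omega_hat. \<bar>f \<eta>\<bar> \<le> C) \<longrightarrow>
        (\<integral>\<eta>. f (translate (record_pos \<eta> i) \<eta>) \<partial>\<mu>) = (\<integral>\<eta>. f \<eta> \<partial>\<mu>))"

definition has_law :: "'a measure \<Rightarrow> ('a \<Rightarrow> 'b) \<Rightarrow> 'b measure \<Rightarrow> bool" where
  "has_law M X L \<longleftrightarrow> X \<in> M \<rightarrow>\<^sub>M L \<and> distr M L X = L"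

definition iid :: "'a measure \<Rightarrow> ('i \<Rightarrow> 'a \<Rightarrow> 'b) \<Rightarrow> 'b measure \<Rightarrow> bool" where
  "iid M X L \<longleftrightarrow> prob_space M \<and> prob_space.indep_vars M (\<lambda>_. L) X UNIV \<and> (\<forall>i. has_law M (X i) L)"

text \<open>\<^const>\<open>geometric_pmf\<close> is only meaningful for parameters in \<open>(0,1]\<close>.\<close>

definition independent_geometric_array ::
  "'a measure \<Rightarrow> (nat \<Rightarrow> int \<Rightarrow> 'a \<Rightarrow> nat) \<Rightarrow> (nat \<Rightarrow> real) \<Rightarrow> bool" where
  "independent_geometric_array M \<zeta> p \<longleftrightarrow> prob_space M \<and>
     prob_space.indep_vars M (\<lambda>_. count_space UNIV) (\<lambda>(k, j). \<zeta> k j) ({1..} \<times> UNIV) \<and>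
     (\<forall>k\<ge>1. \<forall>j. p k \<in> {0<..1} \<and> has_law M (\<zeta> k j) (measure_pmf (geometric_pmf (p k))))"

end

theory Submission
  imports Defs
begin

text \<open>Deleting the smallest solitons of an excursion turns a word all of whose runs have length at
  least \<open>k\<close> into a word with runs of length at least \<open>k + 1\<close>. Reading the word from left to right,
  the box reached at any time ends a run of value \<open>v\<close> that is longer than \<open>k\<close>, hence is a \<open>k\<close>-slot,
  and what follows is either a further \<open>v\<close> (the next slot), or \<open>k + 1\<close> boxes of the other value (whose
  last one is the next slot), or exactly \<open>k\<close> boxes of the other value and \<open>k\<close> boxes \<open>v\<close>, which is the
  \<open>k\<close>-soliton deleted next, appended to the current slot. Hence the shorter word and the numbers of
  solitons at its slots are arbitrary and determine the longer word, and an excursion is the same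
  thing as a choice of these numbers, level by level from the top.

  The number of \<open>k\<close>-slots is \<open>1\<close> plus the sum over \<open>m > k\<close> of \<open>2 (m - k) n\<^sub>m\<close>, so the geometric
  weights of all soliton counts in an excursion multiply to a constant times its weight under
  \<open>\<alpha>(q)\<close>. An event that prescribes finitely many consecutive excursions prescribes finitely many
  geometric variables on each level, and its probability factorizes accordingly; as the total mass
  is \<open>1\<close>, the constant is the inverse of the partition function. This gives (b). Part (a) follows by
  transporting the law through the decomposition, once \<open>q(\<alpha>)\<close> is known to be summable with terms
  below \<open>1\<close>; the latter is read off the partition functions of truncated parameters, which bound
  that of \<open>\<alpha>\<close> from below.\<close>

subsection \<open>Runs and the deletion of solitons\<close>

text \<open>The algorithm sees the whole line, whereas a word is read from left to right. What joins
  the two is an invariant: every box already passed lies in a constant stretch longer than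
  \<open>k\<close>, every later box in one of length at least \<open>k\<close>. Then the next block
  that the reading meets is the leftmost smallest run of the whole line, the infinite empty ends
  counting as arbitrarily long.

  A second obstacle is the two-sided enumeration of slots. Only slot \<open>0\<close> has a known
  position, so excursion \<open>i\<close> can be located only when all excursions between
  \<open>0\<close> and \<open>i\<close> are known; hence the windows \<open>{a..<b}\<close> with
  \<open>a \<le> 0\<close> and \<open>0 \<le> b\<close>. To the left of \<open>0\<close> even the
  first slot of an excursion depends on how many slots it has, so prescribed counts are functions
  \<open>G k s j\<close> of the level, the number \<open>s\<close> of slots and the slot.

  The constant \<open>C\<close> is the limit of the products of \<open>1 - q k\<close>, the
  probability of the empty excursion. Beforehand only \<open>0 \<le> C\<close> is known; that
  \<open>C\<close> is positive and that the partition function is finite both come from the total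
  mass, and no sum over excursions is ever evaluated.\<close>

lemma constant_intervalI:
  assumes "A \<noteq> {}" "A \<subseteq> R"
    and "\<And>x y z. x \<in> A \<Longrightarrow> y \<in> A \<Longrightarrow> z \<in> R \<Longrightarrow> x < z \<Longrightarrow> z < y \<Longrightarrow> z \<in> A"
    and "\<And>x y. x \<in> A \<Longrightarrow> y \<in> A \<Longrightarrow> \<eta> x = \<eta> y"
  shows "constant_interval \<eta> R A"
  unfolding constant_interval_def
  by (intro conjI ballI impI; (elim conjE)?; rule assms; assumption)

lemma constant_interval_nonempty: "constant_interval \<eta> R A \<Longrightarrow> A \<noteq> {}"
  unfolding constant_interval_def by (elim conjE)

lemma constant_interval_subset: "constant_interval \<eta> R A \<Longrightarrow> A \<subseteq> R"
  unfolding constant_interval_def by (elim conjE)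

lemma constant_interval_const:
  "constant_interval \<eta> R A \<Longrightarrow> x \<in> A \<Longrightarrow> y \<in> A \<Longrightarrow> \<eta> x = \<eta> y"
  unfolding constant_interval_def by blast

lemma run_constant_interval: "run \<eta> R A \<Longrightarrow> constant_interval \<eta> R A"
  unfolding run_def by (elim conjE)

lemma constant_interval_between:
  assumes "constant_interval \<eta> R A" "x \<in> A" "y \<in> A" "z \<in> R" "x \<le> z" "z \<le> y"
  shows "z \<in> A"
  using assms unfolding constant_interval_def order.order_iff_strict by blast

lemma constant_interval_Un:
  assumes "constant_interval \<eta> R A" "constant_interval \<eta> R B" "A \<inter> B \<noteq> {}"
  shows "constant_interval \<eta> R (A \<union> B)"
proof -
  obtain c where c: "c \<in> A" "c \<in> B" using assms(3) by blast
  have "z \<in> A \<union> B" if *: "x \<in> A \<union> B" "y \<in> A \<union> B" "z \<in> R" "x < z" "z < y" for x y z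
  proof -
    consider "x \<in> A" "z \<le> c" | "x \<in> B" "z \<le> c" | "y \<in> A" "c \<le> z" | "y \<in> B" "c \<le> z"
      using *(1,2) linear[of z c] by blast
    then show ?thesis
      using that constant_interval_between[OF assms(1), of x c z] constant_interval_between[OF assms(1), of c y z]
        constant_interval_between[OF assms(2), of x c z] constant_interval_between[OF assms(2), of c y z] c
      by cases auto
  qed
  moreover have "\<eta> x = \<eta> c" if "x \<in> A \<union> B" for x
    using that constant_interval_const[OF assms(1), of x c] constant_interval_const[OF assms(2), of x c] c by blast
  moreover have "A \<union> B \<noteq> {}" "A \<union> B \<subseteq> R"
    using assms(1,2)[THEN constant_interval_subset] c by auto
  ultimately show ?thesis
    by (intro constant_intervalI) (blast, blast, blast, metis)
qed

lemma run_absorbs: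
  assumes "run \<eta> R A" "constant_interval \<eta> R B" "A \<inter> B \<noteq> {}"
  shows "B \<subseteq> A"
  using constant_interval_Un[of \<eta> R A B] assms unfolding run_def by blast

lemma run_unique:
  assumes "run \<eta> R A" "run \<eta> R B" "A \<inter> B \<noteq> {}"
  shows "A = B"
  using run_absorbs[OF assms(1)] run_absorbs[OF assms(2)] assms unfolding run_def by blast

text \<open>The run through \<open>z\<close> is the union of all constant intervals containing
  \<open>z\<close>; any two of them overlap at \<open>z\<close>, so that their union is again
  one.\<close>

lemma run_exists:
  assumes "z \<in> R"
  obtains A where "run \<eta> R A" "z \<in> A"
proof -
  let ?A = "\<Union>{B. constant_interval \<eta> R B \<and> z \<in> B}"
  have z: "constant_interval \<eta> R {z}"
    using assms unfolding constant_interval_def by auto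
  then have zA: "z \<in> ?A" by blast
  have "constant_interval \<eta> R ?A"
  proof (rule constant_intervalI)
    show "?A \<noteq> {}" using z by blast
    show "?A \<subseteq> R" by (auto dest: constant_interval_subset)
  next
    fix x y w assume "x \<in> ?A" "y \<in> ?A" and w: "w \<in> R" "x < w" "w < y"
    then obtain B C where B: "constant_interval \<eta> R B" "z \<in> B" "x \<in> B"
      and C: "constant_interval \<eta> R C" "z \<in> C" "y \<in> C" by blast
    have "constant_interval \<eta> R (B \<union> C)"
      using constant_interval_Un[OF B(1) C(1)] B C by blast
    moreover from this have "w \<in> B \<union> C"
      by (rule constant_interval_between[of _ _ _ x y]) (use w B C in auto)
    ultimately show "w \<in> ?A" using B by blast
  next
    fix x y assume "x \<in> ?A" "y \<in> ?A"
    then obtain B C where B: "constant_interval \<eta> R B" "z \<in> B" "x \<in> B"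
      and C: "constant_interval \<eta> R C" "z \<in> C" "y \<in> C" by blast
    show "\<eta> x = \<eta> y"
      using constant_interval_const[OF B(1,3,2)] constant_interval_const[OF C(1,3,2)] by simp
  qed
  then have "run \<eta> R ?A"
    unfolding run_def using zA by (metis (no_types, lifting) Union_upper mem_Collect_eq subset_antisym subsetD)
  then show thesis using that zA by blast
qed

text \<open>Runs of equal size with equal minimum meet and hence coincide. Of two candidates for the
  next run, each has a box at or to the left of any box of the other, so they meet as well. Initial
  segments of \<open>B\<close> with equal cardinality are nested.\<close>

lemma next_soliton_unique:
  assumes "next_soliton \<eta> R k \<gamma>" "next_soliton \<eta> R k' \<gamma>'"
  shows "k = k' \<and> \<gamma> = \<gamma>'"
proof -
  obtain A B C where A: "leftmost_smallest_run \<eta> R A" "card A = k" "next_run \<eta> R A B"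
      "first_boxes B k C" "\<gamma> = A \<union> C"
    using assms(1) unfolding next_soliton_def by blast
  obtain A' B' C' where A': "leftmost_smallest_run \<eta> R A'" "card A' = k'" "next_run \<eta> R A' B'"
      "first_boxes B' k' C'" "\<gamma>' = A' \<union> C'"
    using assms(2) unfolding next_soliton_def by blast
  have fin: "finite A" "finite A'" "A \<noteq> {}" "A' \<noteq> {}"
    using A(1) A'(1) unfolding leftmost_smallest_run_def
    by (auto dest!: run_constant_interval constant_interval_nonempty)
  have k: "k = k'"
    using A(1,2) A'(1,2) unfolding leftmost_smallest_run_def by (blast intro: le_antisym)
  have "Min A = Min A'"
    using A(1,2) A'(1,2) k unfolding leftmost_smallest_run_def by (blast intro: order_antisym)
  then have "A \<inter> A' \<noteq> {}" using fin Min_in by (metis disjoint_iff)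
  then have AA: "A = A'"
    using run_unique A(1) A'(1) unfolding leftmost_smallest_run_def by blast
  have r: "run \<eta> R B" "run \<eta> R B'" using A(3) A'(3) unfolding next_run_def by auto
  have "B = B'"
  proof -
    have b: "B \<noteq> {}" "B \<subseteq> R" "B' \<subseteq> R"
      using r[THEN run_constant_interval] constant_interval_nonempty constant_interval_subset by blast+
    then obtain b where b': "b \<in> B" by blast
    have *: "\<exists>y\<in>B'. y \<le> x" if "x \<in> B" for x
      using that b A(3) A'(3) AA unfolding next_run_def by (meson subsetD)
    have **: "\<exists>y\<in>B. y \<le> x" if "x \<in> B'" for x
      using that b A(3) A'(3) AA unfolding next_run_def by (meson subsetD)
    obtain y where y: "y \<in> B'" "y \<le> b" using *[OF b'] by blast
    obtain x where x: "x \<in> B" "x \<le> y" using **[OF y(1)] by blast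
    have "y \<in> B"
      using constant_interval_between[of \<eta> R B x b y] x y b b' r unfolding run_def by blast
    then show ?thesis using run_unique[OF r] y by blast
  qed
  have "C = C'"
  proof -
    have fC: "finite C" "finite C'" "card C = card C'" "C \<subseteq> B" "C' \<subseteq> B"
      using A(4) A'(4) k \<open>B = B'\<close> unfolding first_boxes_def by auto
    have "C \<subseteq> C' \<or> C' \<subseteq> C"
    proof (rule ccontr)
      assume "\<not> ?thesis"
      then obtain x y where "x \<in> C" "x \<notin> C'" "y \<in> C'" "y \<notin> C" by blast
      then show False using A(4) A'(4) fC \<open>B = B'\<close> unfolding first_boxes_def
        by (metis linorder_neqE subsetD)
    qed
    then show ?thesis using fC by (metis card_subset_eq)
  qed
  then show ?thesis using k AA A A' by simp
qed

section \<open>Complete executions of the algorithm\<close>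

inductive deletion_trace :: "(int \<Rightarrow> bool) \<Rightarrow> int set \<Rightarrow> (nat \<times> int set) list \<Rightarrow> bool" for \<eta> where
  stop: "(\<And>k \<gamma>. \<not> next_soliton \<eta> R k \<gamma>) \<Longrightarrow> deletion_trace \<eta> R []"
| step: "next_soliton \<eta> R k \<gamma> \<Longrightarrow> deletion_trace \<eta> (R - \<gamma>) S \<Longrightarrow> deletion_trace \<eta> R ((k, \<gamma>) # S)"

text \<open>Since each step is forced, every reachable set of boxes is passed by the single complete
  execution \<open>S\<close>. This turns the existential definition of solitons into membership in a
  list.\<close>

lemma deletion_trace_solitons:
  assumes "deletion_trace \<eta> UNIV S"
  shows "{\<gamma>. \<exists>R. remaining_boxes \<eta> R \<and> next_soliton \<eta> R k \<gamma>} = {\<gamma>. (k, \<gamma>) \<in> set S}"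
proof -
  have 1: "\<exists>R'. remaining_boxes \<eta> R' \<and> next_soliton \<eta> R' k \<gamma>"
    if "deletion_trace \<eta> R S" "remaining_boxes \<eta> R" "(k, \<gamma>) \<in> set S" for R k \<gamma>
    using that by (induction arbitrary: k \<gamma>) (auto intro: remaining_boxes.intros)
  \<comment> \<open>Every reachable set occurs in the execution, with a suffix of \<open>S\<close>
    still to be carried out.\<close>
  have 2: "\<exists>S1 S2. S = S1 @ S2 \<and> deletion_trace \<eta> R S2" if "remaining_boxes \<eta> R" for R
    using that
  proof induction
    case start
    then show ?case using assms by (intro exI[of _ "[]"] exI[of _ S]) simp
  next
    case (delete R k \<gamma>)
    then obtain S1 S2 where S: "S = S1 @ S2" "deletion_trace \<eta> R S2" by blast
    from S(2) show ?case
    proof cases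
      case stop
      then show ?thesis using delete by blast
    next
      case (step k' \<gamma>' S')
      then have "k' = k" "\<gamma>' = \<gamma>" using next_soliton_unique delete by blast+
      then show ?thesis using S step by (intro exI[of _ "S1 @ [(k, \<gamma>)]"] exI[of _ S']) simp
    qed
  qed
  have "(k, \<gamma>) \<in> set S" if R: "remaining_boxes \<eta> R" "next_soliton \<eta> R k \<gamma>" for R \<gamma>
  proof -
    obtain S1 S2 where S: "S = S1 @ S2" "deletion_trace \<eta> R S2" using 2[OF R(1)] by blast
    from S(2) show ?thesis
    proof cases
      case stop then show ?thesis using R by blast
    next
      case (step k' \<gamma>' S')
      then have "k' = k" "\<gamma>' = \<gamma>" using next_soliton_unique R by blast+
      then show ?thesis using S step by simp
    qed
  qed
  then show ?thesis using 1[OF assms remaining_boxes.start] by blast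
qed

text \<open>This bounds the size of the run through \<open>y\<close> from below without speaking of
  runs and, unlike maximality, it survives appending further boxes.\<close>

definition covered :: "('a \<Rightarrow> bool) \<Rightarrow> nat \<Rightarrow> 'a list \<Rightarrow> 'a \<Rightarrow> bool" where
  "covered \<eta> k L y \<longleftrightarrow> (\<exists>xs ys zs. L = xs @ ys @ zs \<and> y \<in> set ys \<and> k \<le> length ys \<and>
     (\<forall>a\<in>set ys. \<forall>b\<in>set ys. \<eta> a = \<eta> b))"

lemma covered_append: "covered \<eta> k L y \<Longrightarrow> covered \<eta> k (L @ M) y"
  unfolding covered_def by (metis append_assoc)

text \<open>The undeleted boxes when everything deleted so far lies in \<open>{lo..hi}\<close> and
  \<open>L\<close> lists what is left there.\<close>

definition boxes :: "int \<Rightarrow> int \<Rightarrow> int list \<Rightarrow> int set" where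
  "boxes lo hi L = {..<lo} \<union> set L \<union> {hi<..}"

lemma constant_interval_sublist:
  assumes "sorted_wrt (<) (xs @ ys @ zs)" "set (xs @ ys @ zs) \<subseteq> {lo..hi}" "ys \<noteq> []"
    and "\<forall>a\<in>set ys. \<forall>b\<in>set ys. \<eta> a = \<eta> b"
  shows "constant_interval \<eta> (boxes lo hi (xs @ ys @ zs)) (set ys)"
proof -
  have "z \<in> set ys" if z: "x \<in> set ys" "y \<in> set ys" "z \<in> boxes lo hi (xs @ ys @ zs)" "x < z" "z < y"
    for x y z
  proof -
    have "x \<in> {lo..hi}" "y \<in> {lo..hi}" using assms(2) z by auto
    then have "z \<in> set xs \<union> set ys \<union> set zs" using z unfolding boxes_def by auto
    moreover have "a < x" if "a \<in> set xs" for a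
      using that z assms(1) by (simp add: sorted_wrt_append)
    moreover have "y < a" if "a \<in> set zs" for a
      using that z assms(1) by (simp add: sorted_wrt_append)
    ultimately show ?thesis using z(4,5) by force
  qed
  moreover have "\<eta> a = \<eta> b" if "a \<in> set ys" "b \<in> set ys" for a b
    using that assms(4) by blast
  moreover have "set ys \<noteq> {}" "set ys \<subseteq> boxes lo hi (xs @ ys @ zs)"
    using assms(3) by (auto simp: boxes_def)
  ultimately show ?thesis by (intro constant_intervalI) blast+
qed

lemma constant_interval_covered:
  assumes "sorted_wrt (<) L" "set L \<subseteq> {lo..hi}" "covered \<eta> k L y" 
  obtains I where "constant_interval \<eta> (boxes lo hi L) I" "y \<in> I" "finite I" "k \<le> card I"
proof -
  obtain xs ys zs where *: "L = xs @ ys @ zs" "y \<in> set ys" "k \<le> length ys"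
     "\<forall>a\<in>set ys. \<forall>b\<in>set ys. \<eta> a = \<eta> b"
    using assms(3) unfolding covered_def by blast
  have "distinct ys" using assms(1) *(1) by (simp add: sorted_wrt_append strict_sorted_iff)
  have "ys \<noteq> []" using *(2) by auto
  then have "constant_interval \<eta> (boxes lo hi L) (set ys)"
    unfolding *(1) using assms(1,2) *(1,4) by (intro constant_interval_sublist) blast+
  then show ?thesis
    using that *(2,3) distinct_card[OF \<open>distinct ys\<close>] by (metis List.finite_set)
qed

text \<open>A box outside \<open>{lo..hi}\<close> lies in constant intervals of every finite size,
  so a finite run through it would be at least as large as any given \<open>k\<close>. This covers
  the infinite ends when the sizes of finite runs are compared.\<close>

lemma constant_interval_outside:
  assumes out: "\<forall>z. z < lo \<or> hi < z \<longrightarrow> \<not> \<eta> z" and z: "z < lo \<or> hi < z" "lo \<le> hi"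
  obtains I where "constant_interval \<eta> (boxes lo hi L) I" "z \<in> I" "finite I" "k \<le> card I"
proof (cases "z < lo")
  case True
  show ?thesis
    by (rule that[of "{z - int k..z}"]) (use True out in \<open>auto simp: constant_interval_def boxes_def\<close>)
next
  case False
  then have "hi < z" using z by simp
  then show ?thesis
    by (intro that[of "{z..z + int k}"]) (use out in \<open>auto simp: constant_interval_def boxes_def\<close>)
qed

text \<open>\<open>as\<close> is a run because its neighbours \<open>last pre\<close> and
  \<open>hd bs\<close> carry the other value. Runs reaching to its left are longer than
  \<open>k\<close>, and those to its right have size at least \<open>k\<close>, so it is the
  leftmost smallest one. The list \<open>bs\<close> may be a proper initial part of the next run, as
  \<open>ps\<close> may go on with the same value.\<close>

lemma next_soliton_block:
  assumes sorted: "sorted_wrt (<) (pre @ as @ bs @ ps)"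
    and range: "set (pre @ as @ bs @ ps) \<subseteq> {lo..hi}"
    and out: "\<forall>z. z < lo \<or> hi < z \<longrightarrow> \<not> \<eta> z"
    and len: "length as = k" "length bs = k" "1 \<le> k"
    and as: "\<forall>a\<in>set as. \<eta> a = (\<not> v)" and bs: "\<forall>b\<in>set bs. \<eta> b = v"
    and pre: "pre \<noteq> []" "\<eta> (last pre) = v" "\<forall>y\<in>set pre. covered \<eta> (Suc k) pre y"
    and cov: "\<forall>y\<in>set (as @ bs @ ps). covered \<eta> k (pre @ as @ bs @ ps) y"
  shows "next_soliton \<eta> (boxes lo hi (pre @ as @ bs @ ps)) k (set as \<union> set bs)"
proof -
  let ?L = "pre @ as @ bs @ ps"
  let ?R = "boxes lo hi ?L"
  have ne: "as \<noteq> []" "bs \<noteq> []" using len by auto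
  have lohi: "lo \<le> hi" using range pre(1) by (cases pre) auto
  have dist: "distinct ?L" using sorted strict_sorted_iff by blast
  have cI: "constant_interval \<eta> ?R (set as)"
    using constant_interval_sublist[of pre as "bs @ ps" lo hi \<eta>] sorted range ne as by auto
  have cB: "constant_interval \<eta> ?R (set bs)"
    using constant_interval_sublist[of "pre @ as" bs ps lo hi \<eta>] sorted range ne bs by auto
  have lt: "x < y" if "x \<in> set pre" "y \<in> set (as @ bs @ ps)" for x y
    using sorted that by (simp add: sorted_wrt_append)
  have lt2: "x < y" if "x \<in> set as" "y \<in> set (bs @ ps)" for x y
    using sorted that by (simp add: sorted_wrt_append)
  have lt3: "x < y" if "x \<in> set bs" "y \<in> set ps" for x y
    using sorted that by (simp add: sorted_wrt_append)
  have hdb: "hd bs \<le> x" if "x \<in> set (bs @ ps)" for x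
    using ne that sorted by (cases bs) (auto simp: sorted_wrt_append intro: less_imp_le)
  have lastp: "x \<le> last pre" if "x \<in> set pre" for x
  proof -
    have "sorted_wrt (<) (butlast pre @ [last pre])" using sorted pre(1) by (simp add: sorted_wrt_append)
    moreover have "x \<in> set (butlast pre @ [last pre])" using pre(1) that by simp
    ultimately show ?thesis unfolding sorted_wrt_append by auto
  qed
  have ends: "last pre \<in> set pre" "hd bs \<in> set bs" using pre(1) ne by simp_all
  then have ends': "last pre \<in> {lo..hi}" "hd bs \<in> {lo..hi}" using range by auto
  have mem: "last pre \<in> ?R" "hd bs \<in> ?R" "set as \<subseteq> ?R" "\<eta> (hd bs) = v"
    using pre ne bs unfolding boxes_def by auto
  \<comment> \<open>Between \<open>last pre\<close> and \<open>hd bs\<close> nothing remains except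
    \<open>as\<close>.\<close>
  have R: "z \<le> last pre \<or> z \<in> set as \<or> hd bs \<le> z" if "z \<in> ?R" for z
  proof -
    show ?thesis using that hdb lastp ends' unfolding boxes_def by auto
  qed
  have lp: "last pre < a" if "a \<in> set as" for a using lt that pre by auto
  have hb: "a < hd bs" if "a \<in> set as" for a using lt2 that ne by auto
  have runA: "run \<eta> ?R (set as)"
    unfolding run_def
  proof (intro conjI cI allI impI)
    fix B assume B: "constant_interval \<eta> ?R B \<and> set as \<subseteq> B"
    obtain a where a: "a \<in> set as" using ne by (meson list.set_sel(1))
    show "B = set as"
    proof (rule ccontr)
      assume "B \<noteq> set as"
      then obtain z where z: "z \<in> B" "z \<notin> set as" using B by blast
      then have "z \<in> ?R" using B unfolding constant_interval_def by blast
      then consider "z \<le> last pre" | "hd bs \<le> z" using R z by blast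
      then have "last pre \<in> B \<or> hd bs \<in> B"
      proof cases
        case 1
        then show ?thesis
          using B z a lp[OF a] mem constant_interval_between[of \<eta> ?R B z a "last pre"] by auto
      next
        case 2
        then show ?thesis
          using B z a hb[OF a] mem constant_interval_between[of \<eta> ?R B a z "hd bs"] by auto
      qed
      then have "\<eta> a = v" using B a mem pre unfolding constant_interval_def by blast
      then show False using as a by auto
    qed
  qed
  \<comment> \<open>The second conjunct, with \<open>Suc k\<close>, is what excludes a run of size
    \<open>k\<close> further to the left.\<close>
  have ge: "k \<le> card B \<and> (\<forall>z\<in>B. z \<le> last pre \<longrightarrow> Suc k \<le> card B)" if B: "run \<eta> ?R B" "finite B" for B
  proof -
    have sub: "m \<le> card B" if "z \<in> B" "constant_interval \<eta> ?R I" "z \<in> I" "m \<le> card I" for z I m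
    proof -
      have "I \<subseteq> B" using run_absorbs[OF B(1), of I] that by blast
      then show ?thesis using card_mono[OF B(2)] that by (meson le_trans)
    qed
    have BR: "B \<subseteq> ?R" "B \<noteq> {}"
      using run_constant_interval[OF B(1)] constant_interval_nonempty constant_interval_subset by blast+
    have 1: "Suc k \<le> card B" if "z \<in> B" "z \<le> last pre" for z
    proof (cases "z < lo")
      case True
      then show ?thesis
        using constant_interval_outside[OF out _ lohi, of z ?L "Suc k"] sub[OF that(1)] by blast
    next
      case False
      have "last pre \<le> hi" using ends' by simp
      then have "z \<in> set ?L" using that BR False unfolding boxes_def by auto
      then have "z \<in> set pre" using that lt[of "last pre" z] ends by auto
      then have "covered \<eta> (Suc k) ?L z" using pre(3) covered_append by fast
      then show ?thesis using constant_interval_covered[OF sorted range] sub[OF that(1)] by blast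
    qed
    have 2: "k \<le> card B" if "z \<in> B" "\<not> z \<le> last pre" for z
    proof (cases "hi < z")
      case True
      then show ?thesis
        using constant_interval_outside[OF out _ lohi, of z ?L "k"] sub[OF that(1)] by blast
    next
      case False
      have "lo \<le> last pre" using ends' by simp
      then have "z \<in> set ?L" using that BR False unfolding boxes_def by auto
      then have "z \<in> set (as @ bs @ ps)" using that lastp[of z] by auto
      then show ?thesis using cov constant_interval_covered[OF sorted range] sub[OF that(1)] by blast
    qed
    obtain z where "z \<in> B" using BR by blast
    then show ?thesis using 1 2 Suc_leD by blast
  qed
  have cardA: "card (set as) = k" "card (set bs) = k"
    using dist len distinct_card[of as] distinct_card[of bs] by auto
  have "Min (set as) \<le> Min B" if B: "run \<eta> ?R B" "finite B" "card B = k" for B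
  proof -
    have BR: "B \<subseteq> ?R" "B \<noteq> {}"
      using run_constant_interval[OF B(1)] constant_interval_nonempty constant_interval_subset by blast+
    then have "Min B \<in> B" using B by auto
    then have "Min B \<in> ?R" "\<not> Min B \<le> last pre" using ge[OF B(1,2)] B(3) BR by auto
    then have "Min B \<in> set as \<or> hd bs \<le> Min B" using R by blast
    then show ?thesis
      using hb ne by (metis List.finite_set Min_in Min_le less_imp_le order_trans set_empty2)
  qed
  then have lA: "leftmost_smallest_run \<eta> ?R (set as)"
    unfolding leftmost_smallest_run_def using runA ge cardA by auto
  obtain B where B: "run \<eta> ?R B" "hd bs \<in> B" using run_exists mem(2) by blast
  have Bc: "constant_interval \<eta> ?R B" using B unfolding run_def by blast
  have asB: "set as \<inter> B = {}"
    using as B(2) mem(4) Bc unfolding constant_interval_def by blast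
  have AB: "a < b" if "a \<in> set as" "b \<in> B" for a b
  proof (rule ccontr)
    assume "\<not> a < b"
    moreover have "a \<noteq> b" using asB that by blast
    ultimately have "b < a" by simp
    then have "a \<in> B" using Bc B(2) hb[OF that(1)] that mem(3) unfolding constant_interval_def by blast
    then show False using asB that by blast
  qed
  have "next_run \<eta> ?R (set as) B"
    unfolding next_run_def
  proof (intro conjI ballI impI B(1) AB)
    fix z assume z: "z \<in> ?R" "\<forall>a\<in>set as. a < z"
    obtain a where a: "a \<in> set as" using ne by (meson list.set_sel(1))
    then have "hd bs \<le> z" using R[OF z(1)] z lp[OF a] by force
    then show "\<exists>b\<in>B. b \<le> z" using B by blast
  qed
  moreover have "first_boxes B k (set bs)"
    unfolding first_boxes_def
  proof (intro conjI ballI impI cardA)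
    have "hd bs \<in> set bs" using ne by simp
    then show sub: "set bs \<subseteq> B" using run_absorbs[OF B(1) cB] B by blast
    fix x y assume x: "x \<in> set bs" "y \<in> B" "y < x"
    obtain a where a: "a \<in> set as" using ne by (meson list.set_sel(1))
    have "y \<in> ?R" using Bc x unfolding constant_interval_def by blast
    then have "hd bs \<le> y" using R[of y] AB[OF a x(2)] lp[OF a] asB x by force
    then show "y \<in> set bs"
      using constant_interval_between[OF cB, of "hd bs" x y] x \<open>y \<in> ?R\<close> \<open>hd bs \<in> set bs\<close> by simp
  qed simp
  ultimately show ?thesis using lA cardA unfolding next_soliton_def by blast
qed

text \<open>The remaining boxes form a single infinite run, which is never a smallest one; this is
  how the algorithm ends.\<close>

lemma no_soliton_constant:
  assumes "\<forall>z\<in>R. \<eta> z = c" "infinite R"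
  shows "\<not> next_soliton \<eta> R k \<gamma>"
proof
  assume "next_soliton \<eta> R k \<gamma>"
  then obtain A where A: "run \<eta> R A" "finite A"
    unfolding next_soliton_def leftmost_smallest_run_def by blast
  have "constant_interval \<eta> R R" using assms unfolding constant_interval_def by auto
  then have "A = R" using A unfolding run_def constant_interval_def by blast
  then show False using A assms by simp
qed

subsection \<open>Removing the smallest solitons of a word\<close>

text \<open>The word is preceded by a run of value \<open>v\<close> that is long enough already; all further runs must be.
  In \<open>level k v w c xs\<close> the first entry of \<open>xs\<close> belongs to the slot that ends this preceding run.\<close>

inductive runs_ge :: "nat \<Rightarrow> bool \<Rightarrow> bool list \<Rightarrow> bool" for k where
  Nil: "runs_ge k v []"
| same: "runs_ge k v w \<Longrightarrow> runs_ge k v (v # w)"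
| flip: "runs_ge k (\<not> v) w \<Longrightarrow> runs_ge k v (replicate k (\<not> v) @ w)"

inductive level :: "nat \<Rightarrow> bool \<Rightarrow> bool list \<Rightarrow> bool list \<Rightarrow> nat list \<Rightarrow> bool" for k where
  Nil: "level k v [] [] [0]"
| same: "level k v w c xs \<Longrightarrow> level k v (v # w) (v # c) (0 # xs)"
| flip: "level k (\<not> v) w c xs \<Longrightarrow>
    level k v (replicate (Suc k) (\<not> v) @ w) (replicate (Suc k) (\<not> v) @ c) (0 # xs)"
| soliton: "level k v w c (x # xs) \<Longrightarrow>
    level k v (replicate k (\<not> v) @ replicate k v @ w) c (Suc x # xs)"

lemma level_nonempty: "level k v w c xs \<Longrightarrow> xs \<noteq> []"
  by (erule level.cases) auto

lemma runs_ge_1: "runs_ge 1 v w"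
proof (induction w arbitrary: v)
  case (Cons b w)
  show ?case
  proof (cases "b = v")
    case False
    then have "b # w = replicate 1 (\<not> v) @ w" by auto
    then show ?thesis using runs_ge.flip[of 1 v w] Cons[of "\<not> v"] by simp
  qed (use runs_ge.same Cons in auto)
qed (rule runs_ge.Nil)

lemma level_runs_ge: "level k v w c xs \<Longrightarrow> runs_ge k v w"
proof (induction rule: level.induct)
  case (flip v w c xs)
  \<comment> \<open>A run of \<open>k + 1\<close> boxes is one of \<open>k\<close> boxes prolonged
    by a \<open>same\<close> step.\<close>
  then have "runs_ge k (\<not> v) ((\<not> v) # w)" by (intro runs_ge.same)
  then have "runs_ge k v (replicate k (\<not> v) @ (\<not> v) # w)" by (rule runs_ge.flip)
  then show ?case by (simp add: replicate_app_Cons_same)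
next
  case (soliton v w c x xs)
  then have "runs_ge k (\<not> v) (replicate k v @ w)" using runs_ge.flip[of k "\<not> v" w] by simp
  then show ?case by (rule runs_ge.flip)
qed (auto intro: runs_ge.intros)

lemma level_runs_ge_Suc: "level k v w c xs \<Longrightarrow> runs_ge (Suc k) v c"
  by (induction rule: level.induct) (auto intro: runs_ge.intros simp del: replicate_Suc)

section \<open>Nonnegative paths under insertion and deletion of solitons\<close>

fun dyck :: "int \<Rightarrow> bool list \<Rightarrow> bool" where
  "dyck h [] \<longleftrightarrow> h = 0"
| "dyck h (b # w) \<longleftrightarrow> 0 \<le> h \<and> dyck (h + (if b then 1 else -1)) w"

lemma dyck_nonneg: "dyck h w \<Longrightarrow> 0 \<le> h"
  by (cases w) auto

text \<open>Along a constant stretch the height is monotone, so only its two ends have to be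
  checked, and the far end is nonnegative because the path continues from there.\<close>

lemma dyck_replicate:
  "dyck h (replicate n b @ w) \<longleftrightarrow> 0 \<le> h \<and> dyck (h + (if b then int n else - int n)) w"
proof (induction n arbitrary: h)
  case 0
  then show ?case using dyck_nonneg[of h w] by auto
next
  case (Suc n)
  have "dyck h (replicate (Suc n) b @ w) \<longleftrightarrow>
     0 \<le> h \<and> dyck (h + (if b then 1 else -1)) (replicate n b @ w)" by simp
  also have "\<dots> \<longleftrightarrow> 0 \<le> h \<and> 0 \<le> h + (if b then 1 else -1) \<and> dyck (h + (if b then int (Suc n) else - int (Suc n))) w"
    unfolding Suc.IH by (simp add: algebra_simps)
  also have "\<dots> \<longleftrightarrow> 0 \<le> h \<and> dyck (h + (if b then int (Suc n) else - int (Suc n))) w"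
    using dyck_nonneg[of "h + (if b then int (Suc n) else - int (Suc n))" w] by (auto split: if_splits)
  finally show ?case .
qed

text \<open>An inserted soliton is a bump of height \<open>k\<close>, directed downward if
  \<open>v\<close> is occupied. The hypothesis that the height then exceeds \<open>k\<close> is
  preserved by the reading: a flip to \<open>True\<close> climbs \<open>k + 1\<close> from a
  nonnegative height, and further occupied boxes only climb.\<close>

lemma level_dyck_up:
  "level k v w c xs \<Longrightarrow> dyck h c \<Longrightarrow> (v \<Longrightarrow> int k < h) \<Longrightarrow> dyck h w"
proof (induction arbitrary: h rule: level.induct)
  case (same v w c xs)
  then have "0 \<le> h" "dyck (h + (if v then 1 else -1)) c" by auto
  moreover have "dyck (h + (if v then 1 else -1)) w"
    by (rule same.IH) (use same calculation in auto)
  ultimately show ?case by simp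
next
  case (flip v w c xs)
  then have "0 \<le> h" "dyck (h + (if \<not> v then int (Suc k) else - int (Suc k))) c"
    by (simp_all only: dyck_replicate)
  moreover have "dyck (h + (if \<not> v then int (Suc k) else - int (Suc k))) w"
    by (rule flip.IH) (use flip calculation in auto)
  ultimately show ?case unfolding dyck_replicate by blast
next
  case (soliton v w c x xs)
  then have "dyck h w" by simp
  then show ?case using soliton.prems dyck_nonneg[of h w] unfolding dyck_replicate by (cases v) auto
qed auto

text \<open>A soliton has as many balls as empty boxes, so deleting it leaves the heights at the
  other boxes unchanged.\<close>

lemma level_dyck_down:
  "level k v w c xs \<Longrightarrow> dyck h w \<Longrightarrow> dyck h c"
proof (induction arbitrary: h rule: level.induct)
  case (flip v w c xs)
  then show ?case unfolding dyck_replicate by blast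
next
  case (soliton v w c x xs)
  then have "dyck h w" unfolding dyck_replicate by (cases v) auto
  then show ?case by (rule soliton.IH)
qed auto

text \<open>At height \<open>h > k\<close> when the last run is occupied, a final run of length exactly \<open>k\<close> cannot
  return to height \<open>0\<close>; so the next run always exists.\<close>

lemma level_exists:
  "runs_ge k v w \<Longrightarrow> dyck h w \<Longrightarrow> (v \<Longrightarrow> int k < h) \<Longrightarrow> 1 \<le> k \<Longrightarrow> \<exists>c xs. level k v w c xs"
proof (induction "length w" arbitrary: h v w rule: less_induct)
  case less
  from less.prems(1) show ?case
  proof cases
    case Nil
    then show ?thesis using level.Nil by blast
  next
    case (same w')
    then obtain c xs where "level k v w' c xs"
      using less.hyps[of w' v "h + (if v then 1 else -1)"] less.prems by (auto split: if_splits)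
    then show ?thesis using same level.same by blast
  next
    case (flip w')
    let ?h = "h + (if \<not> v then int k else - int k)"
    have h: "0 \<le> h" "dyck ?h w'" using less.prems(2) unfolding flip(1) dyck_replicate by auto
    from flip(2) show ?thesis
    proof cases
      \<comment> \<open>For \<open>v = False\<close> the run climbs to \<open>h + k\<close>, which
        is positive since \<open>1 \<le> k\<close>; so in neither case can the path end
        here.\<close>
      case Nil
      then show ?thesis using h less.prems by (auto split: if_splits)
    next
      case (same w2)
      have "dyck (h + (if \<not> v then int (Suc k) else - int (Suc k))) w2"
        using h unfolding same by (auto simp: algebra_simps split: if_splits)
      then obtain c xs where "level k (\<not> v) w2 c xs"
        using less.hyps[of w2 "\<not> v" "h + (if \<not> v then int (Suc k) else - int (Suc k))"] h less.prems(4) same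
        unfolding flip(1) by (auto split: if_splits)
      then have "level k v (replicate (Suc k) (\<not> v) @ w2) (replicate (Suc k) (\<not> v) @ c) (0 # xs)"
        by (rule level.flip)
      then show ?thesis unfolding flip same by (auto simp: replicate_app_Cons_same)
    next
      \<comment> \<open>The two stretches of length \<open>k\<close> form a soliton of net height
        zero, so \<open>w2\<close> is read with the same \<open>v\<close> at the same height
        \<open>h\<close>.\<close>
      case (flip w2)
      have "dyck h w2" using h(2) unfolding flip dyck_replicate by (auto split: if_splits)
      then obtain c xs where l: "level k v w2 c xs"
        using less.hyps[of w2 v h] less.prems flip \<open>w = _\<close> by auto
      then obtain x xs' where "xs = x # xs'" using level_nonempty[OF l] by (cases xs) auto
      then have "level k v (replicate k (\<not> v) @ replicate k v @ w2) c (Suc x # xs')"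
        using l by (intro level.soliton) simp
      then show ?thesis using flip \<open>w = _\<close> by auto
    qed
  qed
qed

text \<open>The number \<open>n\<close> of slots depends on \<open>c\<close> alone, and every list
  of \<open>n\<close> counts can be realized because solitons can be added one at a time to the slot
  in front.\<close>

lemma level_insert:
  "runs_ge (Suc k) v c \<Longrightarrow> \<exists>n. \<forall>xs. length xs = n \<longrightarrow> (\<exists>w. level k v w c xs)"
proof (induction rule: runs_ge.induct)
  have sol: "\<exists>w. level k v w c (x # xs)" if "\<exists>w. level k v w c (0 # xs)" for x c xs v
    using that by (induction x) (auto intro: level.soliton)
  {
    case (Nil v)
    show ?case
    proof (intro exI[of _ 1] allI impI)
      fix xs :: "nat list" assume "length xs = 1"
      then obtain x where "xs = [x]" by (auto simp: length_Suc_conv)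
      then show "\<exists>w. level k v w [] xs" using sol level.Nil by blast
    qed
  next
    case (same v w)
    then obtain n where n: "\<forall>xs. length xs = n \<longrightarrow> (\<exists>w'. level k v w' w xs)" by blast
    show ?case
    proof (intro exI[of _ "Suc n"] allI impI)
      fix xs :: "nat list" assume "length xs = Suc n"
      then obtain x ys where "xs = x # ys" "length ys = n" by (auto simp: length_Suc_conv)
      then show "\<exists>w'. level k v w' (v # w) xs" using sol n level.same by blast
    qed
  next
    case (flip v w)
    then obtain n where n: "\<forall>xs. length xs = n \<longrightarrow> (\<exists>w'. level k (\<not> v) w' w xs)" by blast
    show ?case
    proof (intro exI[of _ "Suc n"] allI impI)
      fix xs :: "nat list" assume "length xs = Suc n"
      then obtain x ys where "xs = x # ys" "length ys = n" by (auto simp: length_Suc_conv)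
      then show "\<exists>w'. level k v w' (replicate (Suc k) (\<not> v) @ w) xs" using sol n level.flip by blast
    qed
  }
qed

section \<open>Injectivity of one level in both directions, and its counting identities\<close>

lemma level_inj_up:
  "level k v w c xs \<Longrightarrow> level k v w' c xs \<Longrightarrow> w = w'"
proof (induction arbitrary: w' rule: level.induct)
  case (Nil v)
  then show ?case by (auto elim: level.cases)
next
  case (same v w c xs)
  from same.prems show ?case by cases (auto intro: same.IH)
next
  case (flip v w c xs)
  from flip.prems show ?case by cases (auto intro: flip.IH)
next
  case (soliton v w c x xs)
  from soliton.prems show ?case by cases (auto intro: soliton.IH)
qed

text \<open>The head of \<open>w\<close> decides between \<open>same\<close> and the other rules;
  after \<open>k\<close> boxes \<open>\<not> v\<close> the next box decides between
  \<open>flip\<close> and \<open>soliton\<close>. For \<open>k = 0\<close> a soliton would be empty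
  and could be inserted freely.\<close>

lemma level_inj_down:
  "level k v w c xs \<Longrightarrow> level k v w c' xs' \<Longrightarrow> 1 \<le> k \<Longrightarrow> c = c' \<and> xs = xs'"
proof (induction arbitrary: c' xs' rule: level.induct)
  case (Nil v)
  from Nil(1) show ?case by cases (use Nil in auto)
next
  case (same v w c xs)
  obtain k' where k: "k = Suc k'" using same.prems(2) not0_implies_Suc by force
  from same.prems(1) show ?case by cases (use k same.IH same.prems in auto)
next
  case (flip v w c xs)
  obtain k' where k: "k = Suc k'" using flip.prems(2) not0_implies_Suc by force
  have no: "replicate (Suc k) (\<not> v) @ w \<noteq> replicate k (\<not> v) @ replicate k v @ w'" for w'
    by (simp only: append_Cons replicate_Suc replicate_app_Cons_same[symmetric] append_eq_append_conv same_append_eq)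
      (simp add: k)
  from flip.prems(1) show ?case
  proof cases
    case (soliton w' x xs'')
    then show ?thesis using no by blast
  qed (use flip.IH flip.prems in auto)
next
  case (soliton v w c x xs)
  obtain k' where k: "k = Suc k'" using soliton.prems(2) not0_implies_Suc by force
  have no: "replicate (Suc k) (\<not> v) @ w' \<noteq> replicate k (\<not> v) @ replicate k v @ w" for w'
    by (simp only: append_Cons replicate_Suc replicate_app_Cons_same[symmetric] append_eq_append_conv same_append_eq)
      (simp add: k)
  from soliton.prems(1) show ?case
  proof cases
    case (flip w' c' xs'')
    then show ?thesis using no by metis
  qed (use k soliton.IH soliton.prems in auto)
qed

fun flips :: "bool \<Rightarrow> bool list \<Rightarrow> nat" where
  "flips v [] = 0"
| "flips v (b # w) = (if b = v then 0 else 1) + flips b w"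

lemma flips_same [simp]: "flips v (replicate n v @ w) = flips v w"
  by (induction n) auto

lemma flips_replicate: "1 \<le> n \<Longrightarrow> flips v (replicate n (\<not> v) @ w) = Suc (flips (\<not> v) w)"
  by (cases n) auto

text \<open>The slots are the starting box and those boxes of \<open>c\<close> that have position at
  least \<open>k\<close> in their run, counted from \<open>0\<close>. So all boxes of
  \<open>c\<close> count except the first \<open>k\<close> of each new run, and there are
  \<open>flips v c\<close> new runs.\<close>

lemma level_length_slots: "level k v w c xs \<Longrightarrow> length xs + k * flips v c = Suc (length c)"
proof (induction rule: level.induct)
  case (flip v w c xs)
  then show ?case using flips_replicate[of "Suc k" v c] by simp
qed auto

lemma level_length: "level k v w c xs \<Longrightarrow> length w = length c + 2 * k * sum_list xs"
  by (induction rule: level.induct) auto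

text \<open>A soliton changes the value to \<open>\<not> v\<close> and back to \<open>v\<close>,
  which adds two changes. An empty one would add none, hence \<open>1 \<le> k\<close>.\<close>

lemma level_flips: "level k v w c xs \<Longrightarrow> 1 \<le> k \<Longrightarrow> flips v w = flips v c + 2 * sum_list xs"
proof (induction rule: level.induct)
  case (flip v w c xs)
  then show ?case using flips_replicate[of "Suc k" v w] flips_replicate[of "Suc k" v c] by simp
next
  case (soliton v w c x xs)
  then show ?case using flips_replicate[of k v "replicate k v @ w"] flips_replicate[of k "\<not> v" w] by simp
qed auto

lemma runs_ge_length:
  assumes "runs_ge k v w" "length w < k" shows "w = replicate (length w) v"
  using assms by (induction rule: runs_ge.induct) auto

text \<open>So short a word contains no ball and would descend below \<open>0\<close> at once. This
  ends the recursion over levels: the required run length grows and the word does not.\<close>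

lemma runs_ge_dyck_Nil:
  assumes "runs_ge k False w" "length w < k" "dyck 0 w" shows "w = []"
proof -
  have "w = replicate (length w) False @ []" using runs_ge_length[OF assms(1,2)] by simp
  then have "dyck 0 (replicate (length w) False @ [])" using assms(3) by metis
  then show ?thesis unfolding dyck_replicate by simp
qed

text \<open>The same decomposition for lists of boxes. The last argument lists the \<open>k\<close>-slots, starting with
  \<open>z\<close>, each with the two halves of the \<open>k\<close>-solitons appended to it.\<close>

inductive box_level :: "(int \<Rightarrow> bool) \<Rightarrow> nat \<Rightarrow> bool \<Rightarrow> int \<Rightarrow> int list \<Rightarrow> int list \<Rightarrow>
    (int \<times> (int list \<times> int list) list) list \<Rightarrow> bool" for \<eta> k where
  Nil: "box_level \<eta> k v z [] [] [(z, [])]"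
| same: "\<eta> p = v \<Longrightarrow> box_level \<eta> k v p ps cs gs \<Longrightarrow> box_level \<eta> k v z (p # ps) (p # cs) ((z, []) # gs)"
| flip: "length as = k \<Longrightarrow> \<forall>a\<in>set as. \<eta> a = (\<not> v) \<Longrightarrow> \<eta> p = (\<not> v) \<Longrightarrow> box_level \<eta> k (\<not> v) p ps cs gs \<Longrightarrow>
    box_level \<eta> k v z (as @ p # ps) (as @ p # cs) ((z, []) # gs)"
| soliton: "length as = k \<Longrightarrow> length bs = k \<Longrightarrow> \<forall>a\<in>set as. \<eta> a = (\<not> v) \<Longrightarrow> \<forall>b\<in>set bs. \<eta> b = v \<Longrightarrow>
    box_level \<eta> k v z ps cs ((z, g) # gs) \<Longrightarrow>
    box_level \<eta> k v z (as @ bs @ ps) cs ((z, (as, bs) # g) # gs)"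

lemma box_level_hd: "box_level \<eta> k v z ps cs gs \<Longrightarrow> \<exists>g gs'. gs = (z, g) # gs'"
  by (erule box_level.cases) auto

lemma map_eq_replicateD: "map f xs = replicate n b \<Longrightarrow> length xs = n \<and> (\<forall>x\<in>set xs. f x = b)"
  by (metis in_set_replicate length_map length_replicate list.set_map image_eqI)

lemma map_eq_appendE:
  assumes "map f xs = ys @ zs"
  obtains us vs where "xs = us @ vs" "map f us = ys" "map f vs = zs"
  using assms by (auto simp: map_eq_append_conv)

lemma box_level_exists:
  "level k v w c xs \<Longrightarrow> w = map \<eta> ps \<Longrightarrow>
    \<exists>cs gs. box_level \<eta> k v z ps cs gs \<and> c = map \<eta> cs \<and> xs = map (length \<circ> snd) gs"
proof (induction arbitrary: ps z rule: level.induct)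
  case (Nil v)
  then show ?case by (auto intro!: exI[of _ "[]"] exI[of _ "[(z, [])]"] box_level.Nil)
next
  case (same v w c xs)
  then obtain p ps' where ps: "ps = p # ps'" "\<eta> p = v" "w = map \<eta> ps'" by (cases ps) auto
  obtain cs gs where "box_level \<eta> k v p ps' cs gs" "c = map \<eta> cs" "xs = map (length \<circ> snd) gs"
    using same.IH[OF ps(3), of p] by blast
  then show ?case using ps
    by (intro exI[of _ "p # cs"] exI[of _ "(z, []) # gs"]) (auto intro: box_level.same)
next
  case (flip v w c xs)
  then have "map \<eta> ps = replicate k (\<not> v) @ (\<not> v) # w" by (simp add: replicate_app_Cons_same)
  then obtain as qs where as: "ps = as @ qs" "map \<eta> as = replicate k (\<not> v)" "map \<eta> qs = (\<not> v) # w"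
    by (rule map_eq_appendE)
  then obtain p ps' where ps: "ps = as @ p # ps'" "map \<eta> as = replicate k (\<not> v)" "\<eta> p = (\<not> v)" "w = map \<eta> ps'"
    by (cases qs) auto
  obtain cs gs where *: "box_level \<eta> k (\<not> v) p ps' cs gs" "c = map \<eta> cs" "xs = map (length \<circ> snd) gs"
    using flip.IH[OF ps(4), of p] by blast
  have "box_level \<eta> k v z ps (as @ p # cs) ((z, []) # gs)"
    unfolding ps(1) by (rule box_level.flip) (use map_eq_replicateD[OF ps(2)] ps(3) *(1) in blast)+
  moreover have "replicate (Suc k) (\<not> v) @ c = map \<eta> (as @ p # cs)"
    using ps(2,3) *(2) by (simp add: replicate_app_Cons_same)
  moreover have "0 # xs = map (length \<circ> snd) ((z, []) # gs)" using *(3) by simp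
  ultimately show ?case by (intro exI conjI)
next
  case (soliton v w c x xs)
  from soliton.prems[symmetric] obtain as qs where as: "ps = as @ qs" "map \<eta> as = replicate k (\<not> v)"
      "map \<eta> qs = replicate k v @ w"
    by (rule map_eq_appendE)
  from as(3) obtain bs ps' where bs: "qs = bs @ ps'" "map \<eta> bs = replicate k v" "map \<eta> ps' = w"
    by (rule map_eq_appendE)
  have ps: "ps = as @ bs @ ps'" "map \<eta> as = replicate k (\<not> v)"
      "map \<eta> bs = replicate k v" "w = map \<eta> ps'"
    using as bs by simp_all
  obtain cs gs where *: "box_level \<eta> k v z ps' cs gs" "c = map \<eta> cs" "x # xs = map (length \<circ> snd) gs"
    using soliton.IH[OF ps(4), of z] by (elim exE conjE)
  then obtain g gs' where gs: "gs = (z, g) # gs'" using box_level_hd by blast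
  have "box_level \<eta> k v z ps cs ((z, (as, bs) # g) # gs')"
    unfolding ps(1) by (rule box_level.soliton)
      (use map_eq_replicateD[OF ps(2)] map_eq_replicateD[OF ps(3)] *(1) gs in blast)+
  moreover have "Suc x # xs = map (length \<circ> snd) ((z, (as, bs) # g) # gs')" using *(3) gs by simp
  ultimately show ?case using *(2) by (intro exI conjI)
qed

section \<open>Positions of solitons and slots in a list of boxes\<close>

lemma box_level_sublist: "box_level \<eta> k v z ps cs gs \<Longrightarrow> set cs \<subseteq> set ps"
  by (induction rule: box_level.induct) auto

lemma box_level_sorted:
  "box_level \<eta> k v z ps cs gs \<Longrightarrow> sorted_wrt (<) ps \<Longrightarrow> sorted_wrt (<) cs"
proof (induction rule: box_level.induct)
  case (same p v ps cs gs z)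
  then show ?case using box_level_sublist[OF same(2)] by auto
next
  case (flip as v p ps cs gs z)
  then show ?case using box_level_sublist[OF flip(4)] by (auto simp: sorted_wrt_append)
qed (auto simp: sorted_wrt_append)

definition support :: "int list \<times> int list \<Rightarrow> int set" where
  "support s = set (fst s) \<union> set (snd s)"

lemma box_level_slots:
  "box_level \<eta> k v z ps cs gs \<Longrightarrow> sorted_wrt (<) (z # ps) \<Longrightarrow>
    sorted_wrt (<) (map fst gs) \<and> fst ` set gs \<subseteq> insert z (set ps)"
proof (induction rule: box_level.induct)
  case (flip as v p ps cs gs z)
  then show ?case by (auto simp: sorted_wrt_append)
qed (auto simp: sorted_wrt_append)

text \<open>The reading collects the solitons of a slot before it moves on to the box that is the
  next slot, and positions increase along the list.\<close>

lemma box_level_bounds: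
  "box_level \<eta> k v z ps cs gs \<Longrightarrow> sorted_wrt (<) (z # ps) \<Longrightarrow> j < length gs \<Longrightarrow> s \<in> set (snd (gs ! j)) \<Longrightarrow>
    y \<in> support s \<Longrightarrow> y \<in> set ps \<and> fst (gs ! j) < y \<and> (Suc j < length gs \<longrightarrow> y < fst (gs ! Suc j))"
proof (induction arbitrary: j s y rule: box_level.induct)
  case (same p v ps cs gs z)
  then show ?case by (cases j) auto
next
  case (flip as v p ps cs gs z)
  then show ?case by (cases j) (auto simp: sorted_wrt_append)
next
  case (soliton as bs v z ps cs g gs)
  have srt: "sorted_wrt (<) (z # ps)" using soliton.prems by (auto simp: sorted_wrt_append)
  note IH = soliton.IH[OF srt]
  \<comment> \<open>The soliton in front lies to the left of \<open>ps\<close>, so it suffices that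
    the next slot is a box of \<open>ps\<close>.\<close>
  have next_slot: "fst (gs ! 0) \<in> set ps" if "gs \<noteq> []"
  proof -
    have *: "sorted_wrt (<) (map fst ((z, g) # gs))" "fst ` set ((z, g) # gs) \<subseteq> insert z (set ps)"
      using box_level_slots[OF soliton.hyps(5) srt] by blast+
    have "gs ! 0 \<in> set gs" using that by simp
    then show ?thesis using * by force
  qed
  show ?case
  proof (cases "j = 0 \<and> s = (as, bs)")
    case True
    then have "y \<in> set as \<union> set bs" using soliton.prems by (auto simp: support_def)
    then show ?thesis using True soliton.prems next_slot by (force simp: sorted_wrt_append)
  next
    case False
    then have "s \<in> set (snd (((z, g) # gs) ! j))" using soliton.prems by (cases j) auto
    then show ?thesis using IH[of j s y] soliton.prems by (cases j) auto
  qed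
qed simp

lemma box_level_support:
  "box_level \<eta> k v z ps cs gs \<Longrightarrow> s \<in> set (concat (map snd gs)) \<Longrightarrow> support s \<subseteq> set ps"
  by (induction rule: box_level.induct) (auto simp: support_def)

lemma box_level_form:
  "box_level \<eta> k v z ps cs gs \<Longrightarrow> sorted_wrt (<) ps \<Longrightarrow> (as, bs) \<in> set (concat (map snd gs)) \<Longrightarrow>
    length as = k \<and> length bs = k \<and> sorted_wrt (<) as \<and> sorted_wrt (<) bs \<and>
    (\<exists>b. (\<forall>x\<in>set as. \<eta> x = (\<not> b)) \<and> (\<forall>x\<in>set bs. \<eta> x = b))"
  by (induction rule: box_level.induct) (auto simp: sorted_wrt_append)

text \<open>Each soliton contains a box of its \<open>as\<close>, which lies outside the list
  \<open>ps\<close> that carries all solitons recorded after it. Distinctness matters because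
  solitons are counted as sets.\<close>

lemma box_level_distinct:
  "box_level \<eta> k v z ps cs gs \<Longrightarrow> 1 \<le> k \<Longrightarrow> sorted_wrt (<) ps \<Longrightarrow> distinct (map support (concat (map snd gs)))"
proof (induction rule: box_level.induct)
  case (soliton as bs v z ps cs g gs)
  have "support (as, bs) \<noteq> support s" if "s \<in> set (concat (map snd ((z, g) # gs)))" for s
  proof -
    have "support s \<subseteq> set ps" using box_level_support[OF soliton.hyps(5)] that by blast
    moreover obtain a where "a \<in> set as" using soliton by (cases as) auto
    moreover have "a \<notin> set ps" using soliton.prems \<open>a \<in> set as\<close> by (auto simp: sorted_wrt_append)
    ultimately show ?thesis by (auto simp: support_def)
  qed
  moreover have "distinct (map support (concat (map snd ((z, g) # gs))))"
    using soliton by (simp add: sorted_wrt_append)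
  ultimately show ?case by (auto simp: image_iff)
qed (auto simp: sorted_wrt_append)

text \<open>The boxes at position at least \<open>k\<close> in their run, counted from \<open>0\<close>, when \<open>r\<close> is the position of the
  preceding box and \<open>v\<close> its value.\<close>

fun late_boxes :: "(int \<Rightarrow> bool) \<Rightarrow> nat \<Rightarrow> nat \<Rightarrow> bool \<Rightarrow> int list \<Rightarrow> int set" where
  "late_boxes \<eta> k r v [] = {}"
| "late_boxes \<eta> k r v (p # ps) = (let r' = if \<eta> p = v then Suc r else 0
     in (if k \<le> r' then {p} else {}) \<union> late_boxes \<eta> k r' (\<eta> p) ps)"

text \<open>The first box of \<open>as\<close> has position \<open>Suc r\<close> in its run, whence
  the offset \<open>k - Suc r\<close>.\<close>

lemma late_boxes_same:
  "\<forall>a\<in>set as. \<eta> a = v \<Longrightarrow>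
    late_boxes \<eta> k r v (as @ ps) = set (drop (k - Suc r) as) \<union> late_boxes \<eta> k (r + length as) v ps"
proof (induction as arbitrary: r)
  case (Cons a as)
  then have "late_boxes \<eta> k r v ((a # as) @ ps) = 
    (if k \<le> Suc r then {a} else {}) \<union> (set (drop (k - Suc (Suc r)) as) \<union> late_boxes \<eta> k (Suc r + length as) v ps)"
    by (simp add: Let_def)
  moreover have "k - Suc r = Suc (k - Suc (Suc r))" if "\<not> k \<le> Suc r" using that by simp
  moreover have "k - Suc r = 0" "k - Suc (Suc r) = 0" if "k \<le> Suc r" using that by simp_all
  ultimately show ?case by (cases "k \<le> Suc r") auto
qed simp

text \<open>From position \<open>k\<close> on all boxes of a run are late. So \<open>k\<close> can
  stand for every larger position, and the set does not depend on how many boxes of the preceding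
  run were deleted.\<close>

lemma late_boxes_saturated:
  "k \<le> r \<Longrightarrow> late_boxes \<eta> k r v ps = late_boxes \<eta> k k v ps"
proof (induction ps arbitrary: r)
  case (Cons p ps)
  show ?case
  proof (cases "\<eta> p = v")
    case True
    then show ?thesis using Cons.IH[of "Suc r"] Cons.IH[of "Suc k"] Cons.prems by (simp add: Let_def)
  qed (simp add: Let_def)
qed simp

lemma late_boxes_flip:
  assumes "\<forall>a\<in>set as. \<eta> a = (\<not> v)" "k < length as" "1 \<le> k"
  shows "late_boxes \<eta> k r v (as @ ps) = set (drop k as) \<union> late_boxes \<eta> k k (\<not> v) ps"
proof -
  obtain a as' where as: "as = a # as'" using assms(2) by (cases as) auto
  obtain k' where k: "k = Suc k'" using assms(3) not0_implies_Suc by force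
  have "late_boxes \<eta> k r v (as @ ps) = late_boxes \<eta> k 0 (\<not> v) (as' @ ps)"
    using assms by (auto simp: as Let_def)
  also have "\<dots> = set (drop (k - Suc 0) as') \<union> late_boxes \<eta> k (0 + length as') (\<not> v) ps"
    by (rule late_boxes_same) (use assms as in auto)
  finally show ?thesis using late_boxes_saturated[of k "length as'" \<eta> "\<not> v" ps] assms(2) as k by simp
qed

lemma late_boxes_same':
  assumes "\<forall>a\<in>set as. \<eta> a = v" 
  shows "late_boxes \<eta> k k v (as @ ps) = set as \<union> late_boxes \<eta> k k v ps"
  using late_boxes_same[OF assms, of k k ps] late_boxes_saturated[of k "k + length as"] by simp

text \<open>Deleting an \<open>m\<close>-soliton with \<open>m > k\<close> removes from the late
  boxes just its own boxes of index at least \<open>k\<close>: each half is a stretch of more than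
  \<open>k\<close> boxes that begins with a change of value, and after the second half the reading
  is again late in a run of value \<open>v\<close>, as it was before the soliton.\<close>

lemma box_level_late:
  "box_level \<eta> m v z ps cs gs \<Longrightarrow> k < m \<Longrightarrow> 1 \<le> k \<Longrightarrow>
    late_boxes \<eta> k k v ps = late_boxes \<eta> k k v cs \<union>
      (\<Union>(as, bs)\<in>set (concat (map snd gs)). set (drop k as) \<union> set (drop k bs))"
proof (induction rule: box_level.induct)
  case (same p v ps cs gs z)
  then show ?case using late_boxes_same'[of "[p]" \<eta> v k ps] late_boxes_same'[of "[p]" \<eta> v k cs] by auto
next
  case (flip as v p ps cs gs z)
  then show ?case using late_boxes_flip[of "as @ [p]" \<eta> v k k ps] late_boxes_flip[of "as @ [p]" \<eta> v k k cs] by auto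
next
  case (soliton as bs v z ps cs g gs)
  have "late_boxes \<eta> k k v (as @ bs @ ps) = set (drop k as) \<union> (set (drop k bs) \<union> late_boxes \<eta> k k v ps)"
    using late_boxes_flip[of as \<eta> v k k "bs @ ps"] late_boxes_flip[of bs \<eta> "\<not> v" k k ps] soliton by simp
  then show ?case using soliton by auto
qed simp

text \<open>At level \<open>k\<close> itself the slots are read off the shorter word: a flip copies
  \<open>k + 1\<close> boxes, of which only the last is late, and the \<open>k\<close>-solitons
  contribute no slot.\<close>

lemma box_level_late_slots:
  "box_level \<eta> k v z ps cs gs \<Longrightarrow> 1 \<le> k \<Longrightarrow> fst ` set gs = insert z (late_boxes \<eta> k k v cs)"
proof (induction rule: box_level.induct)
  case (same p v ps cs gs z)
  then show ?case using late_boxes_same'[of "[p]" \<eta> v k cs] by auto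
next
  case (flip as v p ps cs gs z)
  then show ?case using late_boxes_flip[of "as @ [p]" \<eta> v k k cs] by auto
next
  case (soliton as bs v z ps cs g gs)
  then show ?case by simp
qed simp

section \<open>One level of the reading as a sequence of deletions\<close>

lemma runs_ge_covered:
  "runs_ge k v w \<Longrightarrow> w = map \<eta> ps \<Longrightarrow> \<forall>a\<in>set blk. \<eta> a = v \<Longrightarrow> k \<le> length blk \<Longrightarrow> y \<in> set ps \<Longrightarrow>
    covered \<eta> k (pre @ blk @ ps) y"
proof (induction arbitrary: ps pre blk rule: runs_ge.induct)
  case (same v w)
  then obtain p ps' where ps: "ps = p # ps'" "\<eta> p = v" "w = map \<eta> ps'" by (cases ps) auto
  show ?case
  proof (cases "y = p")
    case True
    then show ?thesis unfolding covered_def using ps same.prems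
      by (intro exI[of _ pre] exI[of _ "blk @ [p]"] exI[of _ ps']) auto
  next
    case False
    then have "covered \<eta> k (pre @ (blk @ [p]) @ ps') y"
      using same.prems ps by (intro same.IH) auto
    then show ?thesis using ps by simp
  qed
next
  case (flip v w)
  from flip.prems(1)[symmetric] obtain as ps' where
    ps: "ps = as @ ps'" "map \<eta> as = replicate k (\<not> v)" "map \<eta> ps' = w"
    by (rule map_eq_appendE)
  note as = map_eq_replicateD[OF ps(2)]
  show ?case
  proof (cases "y \<in> set as")
    case True
    then show ?thesis unfolding covered_def using ps flip.prems as
      by (intro exI[of _ "pre @ blk"] exI[of _ as] exI[of _ ps']) auto
  next
    case False
    then have "covered \<eta> k ((pre @ blk) @ as @ ps') y"
      using flip.prems ps as by (intro flip.IH) auto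
    then show ?thesis using ps by simp
  qed
qed simp

lemma box_level_runs_ge: "box_level \<eta> k v z ps cs gs \<Longrightarrow> runs_ge k v (map \<eta> ps)"
proof (induction rule: box_level.induct)
  case (flip as v p ps cs gs z)
  then have "runs_ge k v (replicate k (\<not> v) @ (\<not> v) # map \<eta> ps)"
    by (intro runs_ge.flip runs_ge.same)
  moreover have "map \<eta> as = replicate k (\<not> v)"
    using flip by (auto intro!: nth_equalityI)
  ultimately show ?case using flip by simp
next
  case (soliton as bs v z ps cs g gs)
  then have "runs_ge k (\<not> v) (replicate k v @ map \<eta> ps)" using runs_ge.flip[of k "\<not> v"] by simp
  then have "runs_ge k v (replicate k (\<not> v) @ replicate k v @ map \<eta> ps)" by (rule runs_ge.flip)
  moreover have "map \<eta> as = replicate k (\<not> v)" "map \<eta> bs = replicate k v"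
    using soliton by (auto intro!: nth_equalityI)
  ultimately show ?case by simp
qed (auto intro: runs_ge.intros)

lemma covered_block:
  assumes "\<forall>a\<in>set blk. \<eta> a = v" "k \<le> length blk" "y \<in> set blk"
  shows "covered \<eta> k (pre @ blk) y"
  unfolding covered_def using assms by (intro exI[of _ pre] exI[of _ blk] exI[of _ "[]"]) auto

text \<open>The prefix \<open>pre @ blk\<close> is what has been read, all of it in stretches longer
  than \<open>k\<close>, with \<open>blk\<close> the current one. Under this invariant the solitons
  of level \<open>k\<close> are deleted in the order in which \<open>box_level\<close> records them;
  \<open>T\<close> is the execution from the next level on.\<close>

lemma box_level_deletion_trace:
  "box_level \<eta> k v z ps cs gs \<Longrightarrow> 1 \<le> k \<Longrightarrow>
    \<forall>a\<in>set blk. \<eta> a = v \<Longrightarrow> k < length blk \<Longrightarrow>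
    \<forall>y\<in>set (pre @ blk). covered \<eta> (Suc k) (pre @ blk) y \<Longrightarrow>
    sorted_wrt (<) ((pre @ blk) @ ps) \<Longrightarrow> set ((pre @ blk) @ ps) \<subseteq> {lo..hi} \<Longrightarrow>
    \<forall>z. z < lo \<or> hi < z \<longrightarrow> \<not> \<eta> z \<Longrightarrow> deletion_trace \<eta> (boxes lo hi ((pre @ blk) @ cs)) T \<Longrightarrow>
    deletion_trace \<eta> (boxes lo hi ((pre @ blk) @ ps)) (map (\<lambda>s. (k, support s)) (concat (map snd gs)) @ T)"
proof (induction arbitrary: pre blk rule: box_level.induct)
  case (same p v ps cs gs z)
  have "deletion_trace \<eta> (boxes lo hi ((pre @ blk @ [p]) @ ps)) (map (\<lambda>s. (k, support s)) (concat (map snd gs)) @ T)"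
  proof (rule same.IH)
    have "covered \<eta> (Suc k) (pre @ blk @ [p]) y" if "y \<in> set (pre @ blk)" for y
      using same.prems(4) that covered_append[of \<eta> "Suc k" "pre @ blk" y "[p]"] by auto
    moreover have "covered \<eta> (Suc k) (pre @ blk @ [p]) p"
      using same.prems same.hyps by (intro covered_block[of _ _ v]) auto
    ultimately show "\<forall>y\<in>set (pre @ blk @ [p]). covered \<eta> (Suc k) (pre @ blk @ [p]) y" by auto
  qed (use same in auto)
  then show ?case by simp
next
  case (flip as v p ps cs gs z)
  have "deletion_trace \<eta> (boxes lo hi (((pre @ blk) @ as @ [p]) @ ps)) (map (\<lambda>s. (k, support s)) (concat (map snd gs)) @ T)"
  proof (rule flip.IH)
    have "covered \<eta> (Suc k) ((pre @ blk) @ as @ [p]) y" if "y \<in> set (pre @ blk)" for y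
      using flip.prems(4) that covered_append[of \<eta> "Suc k" "pre @ blk" y "as @ [p]"] by auto
    moreover have "covered \<eta> (Suc k) ((pre @ blk) @ as @ [p]) y" if "y \<in> set (as @ [p])" for y
      using flip.prems flip.hyps that by (intro covered_block[of _ _ "\<not> v"]) auto
    ultimately show "\<forall>y\<in>set ((pre @ blk) @ as @ [p]). covered \<eta> (Suc k) ((pre @ blk) @ as @ [p]) y" by auto
  qed (use flip in auto)
  then show ?case by simp
next
  case (soliton as bs v z ps cs g gs)
  let ?R = "boxes lo hi ((pre @ blk) @ as @ bs @ ps)"
  have rg: "runs_ge k v (map \<eta> (as @ bs @ ps))"
    by (rule box_level_runs_ge[of \<eta> k v z _ cs], rule box_level.soliton[OF soliton.hyps])
  have ne: "blk \<noteq> []" using soliton.prems by auto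
  have step: "next_soliton \<eta> ?R k (set as \<union> set bs)"
  proof (rule next_soliton_block[where v = v])
    show "\<forall>y\<in>set (as @ bs @ ps). covered \<eta> k ((pre @ blk) @ as @ bs @ ps) y"
      using runs_ge_covered[OF rg refl soliton.prems(2), of _ pre] soliton.prems(3) by auto
    show "\<eta> (last (pre @ blk)) = v" using soliton.prems(2) ne by simp
  qed (use soliton.prems soliton.hyps ne in auto)
  have "?R - (set as \<union> set bs) = boxes lo hi ((pre @ blk) @ ps)"
  proof -
    have "sorted_wrt (<) ((pre @ blk) @ as @ bs @ ps)" using soliton.prems by blast
    then have "distinct ((pre @ blk) @ as @ bs @ ps)" by (simp only: strict_sorted_iff)
    moreover have "set as \<union> set bs \<subseteq> {lo..hi}" using soliton.prems by auto
    ultimately show ?thesis unfolding boxes_def by auto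
  qed
  moreover have "deletion_trace \<eta> (boxes lo hi ((pre @ blk) @ ps)) 
      (map (\<lambda>s. (k, support s)) (concat (map snd ((z, g) # gs))) @ T)"
    by (rule soliton.IH) (use soliton.prems in \<open>auto simp: sorted_wrt_append\<close>)
  ultimately show ?case using deletion_trace.step[OF step] by (simp add: support_def)
qed simp

subsection \<open>Excursions as words\<close>

fun heights :: "int \<Rightarrow> bool list \<Rightarrow> int list" where
  "heights h [] = [h]"
| "heights h (b # w) = h # heights (h + (if b then 1 else -1)) w"

lemma length_heights [simp]: "length (heights h w) = Suc (length w)"
  by (induction w arbitrary: h) auto

lemma heights_0 [simp]: "heights h w ! 0 = h"
  by (cases w) auto

lemma heights_Suc:
  "i < length w \<Longrightarrow> heights h w ! Suc i = heights h w ! i + (if w ! i then 1 else -1)"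
proof (induction w arbitrary: h i)
  case (Cons b w)
  then show ?case by (cases i) auto
qed simp

lemma dyck_heights: "dyck h w \<longleftrightarrow> (\<forall>x\<in>set (heights h w). 0 \<le> x) \<and> last (heights h w) = 0"
proof (induction w arbitrary: h)
  case (Cons b w)
  have "heights (h + (if b then 1 else -1)) w \<noteq> []" by (metis length_heights list.size(3) nat.simps(3))
  then show ?case using Cons by auto
qed auto

lemma dyck_even: "dyck h w \<Longrightarrow> even (h + int (length w))"
  by (induction w arbitrary: h) (fastforce split: if_splits)+

definition word_of :: "int list \<Rightarrow> bool list" where
  "word_of e = map (ball_config e) [1..2 * int (half_length e)]"

lemma length_word_of [simp]: "length (word_of e) = 2 * half_length e"
  by (simp add: word_of_def)

lemma word_of_nth:
  "i < 2 * half_length e \<Longrightarrow> word_of e ! i = ball_config e (int i + 1)"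
  by (simp add: word_of_def add.commute)

lemma excursion_length: "e \<in> excursions \<Longrightarrow> length e = Suc (2 * half_length e)"
  by (auto simp: excursions_def half_length_def elim!: oddE)

lemma ball_config_Suc:
  assumes "e \<in> excursions" "i < 2 * half_length e"
  shows "e ! Suc i = e ! i + (if ball_config e (int i + 1) then 1 else -1)"
proof -
  have "\<bar>e ! Suc i - e ! i\<bar> = 1"
    using assms excursion_length[OF assms(1)] unfolding excursions_def by force
  moreover have "nat (int i + 1) = Suc i" "nat (int i + 1 - 1) = i" by auto
  ultimately show ?thesis using assms(2) unfolding ball_config_def by auto
qed

lemma heights_word_of:
  assumes "e \<in> excursions" shows "heights 0 (word_of e) = e"
proof (rule nth_equalityI)
  show len: "length (heights 0 (word_of e)) = length e" using excursion_length[OF assms] by simp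
  fix i assume "i < length (heights 0 (word_of e))"
  then show "heights 0 (word_of e) ! i = e ! i"
  proof (induction i)
    case 0
    then show ?case using assms by (simp add: excursions_def)
  next
    case (Suc i)
    then show ?case using heights_Suc[of i "word_of e" 0] ball_config_Suc[OF assms, of i] word_of_nth[of i e] by simp
  qed
qed

lemma dyck_word_of:
  assumes "e \<in> excursions" shows "dyck 0 (word_of e)"
proof -
  have "e \<noteq> []" using excursion_length[OF assms] by auto
  then show ?thesis
    unfolding dyck_heights heights_word_of[OF assms] using assms
    by (auto simp: excursions_def last_conv_nth in_set_conv_nth)
qed

lemma excursion_of_word:
  assumes "dyck 0 w" obtains e where "e \<in> excursions" "word_of e = w"
proof -
  let ?e = "heights 0 w"
  have len: "2 * half_length ?e = length w" using dyck_even[OF assms] by (simp add: half_length_def)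
  have ne: "?e \<noteq> []" by (metis length_heights list.size(3) nat.simps(3))
  have step: "?e ! Suc i = ?e ! i + (if w ! i then 1 else -1)" if "i < length w" for i
    using heights_Suc that by blast
  have "?e \<in> excursions"
    unfolding excursions_def
  proof (intro CollectI conjI allI impI)
    show "odd (length ?e)" using dyck_even[OF assms] by simp
    show "?e ! (length ?e - 1) = 0"
      using assms ne unfolding dyck_heights by (simp add: last_conv_nth)
    show "0 \<le> ?e ! z" if "z < length ?e" for z
      using assms that unfolding dyck_heights by auto
    show "\<bar>?e ! z - ?e ! (z - 1)\<bar> = 1" if "1 \<le> z \<and> z < length ?e" for z
      using step[of "z - 1"] that by auto
  qed auto
  moreover have "word_of ?e = w"
  proof (rule nth_equalityI)
    fix i assume "i < length (word_of ?e)"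
    then have i: "i < length w" using len by simp
    have "nat (int i + 1) = Suc i" "nat (int i + 1 - 1) = i" by auto
    then show "word_of ?e ! i = w ! i"
      using word_of_nth[of i ?e] step[OF i] i len by (auto simp: ball_config_def)
  qed (use len in simp)
  ultimately show ?thesis using that by blast
qed

text \<open>\<open>P k\<close> lists the boxes of the excursion left when all solitons smaller than
  \<open>k\<close> are deleted, and \<open>gs k\<close> its \<open>k\<close>-slots with their
  solitons. Reading starts at slot \<open>0\<close> with value \<open>False\<close>: box
  \<open>0\<close> is the record in front of the excursion and ends an infinite empty run.\<close>

definition soliton_levels :: "int list \<Rightarrow> (nat \<Rightarrow> int list) \<Rightarrow>
    (nat \<Rightarrow> (int \<times> (int list \<times> int list) list) list) \<Rightarrow> bool" where
  "soliton_levels e P gs \<longleftrightarrow> P 1 = [1..2 * int (half_length e)] \<and>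
     (\<forall>k\<ge>1. sorted_wrt (<) (P k) \<and> set (P k) \<subseteq> {1..2 * int (half_length e)} \<and>
        box_level (ball_config e) k False 0 (P k) (P (Suc k)) (gs k) \<and>
        level k False (map (ball_config e) (P k)) (map (ball_config e) (P (Suc k)))
          (map (length \<circ> snd) (gs k))) \<and>
     (\<forall>k>2 * half_length e. P k = [])"

lemma soliton_levelsD:
  assumes "soliton_levels e P gs"
  shows "P 1 = [1..2 * int (half_length e)]"
    "1 \<le> k \<Longrightarrow> sorted_wrt (<) (P k)"
    "1 \<le> k \<Longrightarrow> set (P k) \<subseteq> {1..2 * int (half_length e)}"
    "1 \<le> k \<Longrightarrow> box_level (ball_config e) k False 0 (P k) (P (Suc k)) (gs k)"
    "2 * half_length e < k \<Longrightarrow> P k = []"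
    "1 \<le> k \<Longrightarrow> level k False (map (ball_config e) (P k)) (map (ball_config e) (P (Suc k)))
      (map (length \<circ> snd) (gs k))"
  using assms unfolding soliton_levels_def by blast+

lemma excursion_levels:
  assumes e: "e \<in> excursions"
  obtains P gs where "soliton_levels e P gs"
proof -
  let ?\<eta> = "ball_config e" and ?N = "2 * half_length e"
  define good where "good k ps \<longleftrightarrow> sorted_wrt (<) ps \<and> set ps \<subseteq> {1..2 * int (half_length e)} \<and>
    length ps \<le> ?N \<and> runs_ge k False (map ?\<eta> ps) \<and> dyck 0 (map ?\<eta> ps)" for k ps
  define lev where "lev k ps cs gs \<longleftrightarrow> box_level ?\<eta> k False 0 ps cs gs \<and>
    level k False (map ?\<eta> ps) (map ?\<eta> cs) (map (length \<circ> snd) gs)" for k ps cs gs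
  have "\<exists>P. \<forall>n. (good (Suc n) (P n) \<and> (n = 0 \<longrightarrow> P n = [1..2 * int (half_length e)])) \<and>
      (\<exists>gs. lev (Suc n) (P n) (P (Suc n)) gs)"
  proof (rule dependent_nat_choice)
    have "good 1 [1..2 * int (half_length e)]"
      using dyck_word_of[OF e] runs_ge_1 by (auto simp: good_def word_of_def)
    then show "\<exists>x. good (Suc 0) x \<and> (0 = 0 \<longrightarrow> x = [1..2 * int (half_length e)])" by auto
  next
    fix ps n assume "good (Suc n) ps \<and> (n = 0 \<longrightarrow> ps = [1..2 * int (half_length e)])"
    then have ps: "good (Suc n) ps" by blast
    then obtain c xs where l: "level (Suc n) False (map ?\<eta> ps) c xs"
      using level_exists[of "Suc n" False "map ?\<eta> ps" 0] unfolding good_def by auto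
    obtain cs gs where *: "box_level ?\<eta> (Suc n) False 0 ps cs gs" "c = map ?\<eta> cs" "xs = map (length \<circ> snd) gs"
      using box_level_exists[OF l refl, of 0] by blast
    have "good (Suc (Suc n)) cs"
      using ps box_level_sorted[OF *(1)] box_level_sublist[OF *(1)] level_runs_ge_Suc[OF l] level_dyck_down[OF l, of 0]
        level_length[OF l] *(2) unfolding good_def by auto
    then show "\<exists>cs. (good (Suc (Suc n)) cs \<and> (Suc n = 0 \<longrightarrow> cs = [1..2 * int (half_length e)])) \<and>
      (\<exists>gs. lev (Suc n) ps cs gs)"
      using * l unfolding lev_def by blast
  qed
  then obtain P where P: "\<And>n. good (Suc n) (P n)" "P 0 = [1..2 * int (half_length e)]"
      "\<And>n. \<exists>gs. lev (Suc n) (P n) (P (Suc n)) gs" by auto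
  then obtain gs where gs: "\<And>n. lev (Suc n) (P n) (P (Suc n)) (gs n)" by metis
  have P': "good k (P (k - 1))" if "1 \<le> k" for k using P(1)[of "k - 1"] that by simp
  have gs': "lev k (P (k - 1)) (P (Suc k - 1)) (gs (k - 1))" if "1 \<le> k" for k using gs[of "k - 1"] that by simp
  \<comment> \<open>The chosen sequence is indexed from \<open>0\<close>, so
    \<open>P (k - 1)\<close> belongs to level \<open>k\<close>. Above
    \<open>2 * half_length e\<close> the runs would have to be longer than the word.\<close>
  have "P (k - 1) = []" if k: "2 * half_length e < k" for k
  proof -
    have "good k (P (k - 1))" using P' k by simp
    then show ?thesis
      using runs_ge_dyck_Nil[of k "map ?\<eta> (P (k - 1))"] k unfolding good_def by simp
  qed
  then have "soliton_levels e (\<lambda>k. P (k - 1)) (\<lambda>k. gs (k - 1))"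
    unfolding soliton_levels_def using P' gs' P(2) unfolding good_def lev_def by simp
  then show ?thesis by (rule that)
qed

lemma ball_config_outside: "z < 1 \<or> 2 * int (half_length e) < z \<Longrightarrow> \<not> ball_config e z"
  by (auto simp: ball_config_def)

lemma solitons_of_levels:
  assumes levels: "soliton_levels e P gs" and k: "1 \<le> k"
  shows "excursion_solitons k e = support ` set (concat (map snd (gs k)))"
proof -
  note P = soliton_levelsD[OF levels]
  let ?\<eta> = "ball_config e" and ?N = "Suc (2 * half_length e)" and ?h = "2 * int (half_length e)"
  define S where "S k = map (\<lambda>s. (k, support s)) (concat (map snd (gs k)))" for k
  \<comment> \<open>An execution is built from its end, so the induction is on the number
    \<open>m\<close> of levels counted from the top.\<close>
  have "deletion_trace ?\<eta> ({..0} \<union> set (P (?N - m)) \<union> {?h<..}) (concat (map S [?N - m..<?N]))" if "m < ?N" for m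
    using that
  proof (induction m)
    case 0
    have "deletion_trace ?\<eta> ({..0} \<union> set (P ?N) \<union> {?h<..}) []"
    proof (rule deletion_trace.stop, rule no_soliton_constant)
      show "\<forall>z\<in>{..0} \<union> set (P ?N) \<union> {?h<..}. ?\<eta> z = False"
        using P(5)[of ?N] ball_config_outside[of _ e] by auto
      show "infinite ({..0} \<union> set (P ?N) \<union> {?h<..})" using infinite_Iic[of "0::int"] by simp
    qed
    then show ?case by simp
  next
    case (Suc m)
    define k where "k = ?N - Suc m"
    have k: "1 \<le> k" "Suc k = ?N - m" "k < ?N" using Suc.prems by (auto simp: k_def)
    \<comment> \<open>These \<open>k + 1\<close> empty boxes, the last of them the record at
      \<open>0\<close>, are the long preceding run that the reading at level \<open>k\<close> asks
      for.\<close>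
    let ?b = "[- int k..0]"
    have eq: "boxes (- int k) ?h (([] @ ?b) @ ps) = {..0} \<union> set ps \<union> {?h<..}" for ps
      by (auto simp: boxes_def)
    have "deletion_trace ?\<eta> (boxes (- int k) ?h (([] @ ?b) @ P k)) (S k @ concat (map S [Suc k..<?N]))"
      unfolding S_def
    proof (rule box_level_deletion_trace[OF P(4)[OF k(1)] k(1)], unfold S_def[symmetric])
      show "\<forall>y\<in>set ([] @ ?b). covered ?\<eta> (Suc k) ([] @ ?b) y"
        by (intro ballI covered_block[where v = False]) (auto simp: ball_config_outside)
      show "sorted_wrt (<) (([] @ ?b) @ P k)"
        using P(2,3)[OF k(1)] by (force simp: sorted_wrt_append)
      show "set (([] @ ?b) @ P k) \<subseteq> {- int k..?h}" using P(3)[OF k(1)] by force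
      show "deletion_trace ?\<eta> (boxes (- int k) ?h (([] @ ?b) @ P (Suc k))) (concat (map S [Suc k..<?N]))"
        unfolding eq using Suc k by simp
    qed (auto simp: ball_config_outside)
    then show ?case unfolding eq k_def[symmetric] upt_conv_Cons[OF k(3)] list.map concat.simps .
  qed
  from this[of "?N - 1"] have "deletion_trace ?\<eta> ({..0} \<union> set (P 1) \<union> {?h<..}) (concat (map S [1..<?N]))" by simp
  moreover have "{..0} \<union> set (P 1) \<union> {?h<..} = UNIV" unfolding P(1) by auto
  ultimately have "deletion_trace ?\<eta> UNIV (concat (map S [1..<?N]))" by argo
  then have "excursion_solitons k e = {\<gamma>. (k, \<gamma>) \<in> set (concat (map S [1..<?N]))}"
    unfolding excursion_solitons_def by (rule deletion_trace_solitons)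
  also have "\<dots> = support ` set (concat (map snd (gs k)))"
  proof (cases "k < ?N")
    case True
    then show ?thesis using k by (auto simp: S_def simp del: upt_Suc intro!: bexI[of _ k])
  next
    case False
    then have "P k = []" using P(5) by simp
    then have "gs k = [(0, [])]" using P(4)[OF k] k by (auto elim: box_level.cases)
    then show ?thesis using False by (auto simp: S_def simp del: upt_Suc)
  qed
  finally show ?thesis .
qed

text \<open>Which half is the head depends on \<open>b\<close>. Only the unordered pair is
  identified, and this is what the definition of slots uses.\<close>

lemma soliton_head_tail:
  assumes "sorted_wrt (<) as" "sorted_wrt (<) bs" "\<forall>x\<in>set as. \<eta> x = (\<not> b)" "\<forall>x\<in>set bs. \<eta> x = b"
  shows "{soliton_head \<eta> (support (as, bs)) i, soliton_tail \<eta> (support (as, bs)) i} = {as ! i, bs ! i}"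
proof -
  have s: "sorted_list_of_set (set as) = as" "sorted_list_of_set (set bs) = bs"
    using assms(1,2) by (auto simp: strict_sorted_iff sorted_list_of_set.idem_if_sorted_distinct)
  show ?thesis
  proof (cases b)
    case True
    then have "{z \<in> support (as, bs). \<eta> z} = set bs" "{z \<in> support (as, bs). \<not> \<eta> z} = set as"
      using assms(3,4) by (auto simp: support_def)
    then show ?thesis unfolding soliton_head_def soliton_tail_def using s by auto
  next
    case False
    then have "{z \<in> support (as, bs). \<eta> z} = set as" "{z \<in> support (as, bs). \<not> \<eta> z} = set bs"
      using assms(3,4) by (auto simp: support_def)
    then show ?thesis unfolding soliton_head_def soliton_tail_def using s by auto
  qed
qed

lemma set_drop_conv: "set (drop k xs) = {xs ! i |i. k \<le> i \<and> i < length xs}"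
proof -
  have "x \<in> set (drop k xs) \<longleftrightarrow> (\<exists>i. x = xs ! i \<and> k \<le> i \<and> i < length xs)" for x
    unfolding in_set_conv_nth
  proof
    assume "\<exists>i<length (drop k xs). drop k xs ! i = x"
    then obtain i where "i < length xs - k" "xs ! (k + i) = x" by auto
    then show "\<exists>i. x = xs ! i \<and> k \<le> i \<and> i < length xs" by (intro exI[of _ "k + i"]) auto
  next
    assume "\<exists>i. x = xs ! i \<and> k \<le> i \<and> i < length xs"
    then obtain i where "x = xs ! i" "k \<le> i" "i < length xs" by blast
    then show "\<exists>i<length (drop k xs). drop k xs ! i = x" by (intro exI[of _ "i - k"]) auto
  qed
  then show ?thesis by blast
qed

text \<open>Deleting level \<open>m > k\<close> removes from the late boxes exactly the boxes of
  index at least \<open>k\<close> in \<open>m\<close>-solitons, and at the top nothing is left.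
  Hence the late boxes of \<open>P (Suc k)\<close> are the boxes by which slots are defined, and the
  reading at level \<open>k\<close> has them, together with \<open>0\<close>, as its slots.\<close>

lemma slots_of_levels:
  assumes levels: "soliton_levels e P gs" and k: "1 \<le> k"
  shows "excursion_slots k e = fst ` set (gs k)"
proof -
  note P = soliton_levelsD[OF levels]
  let ?\<eta> = "ball_config e" and ?N = "2 * half_length e"
  define D where "D m = (\<Union>(as, bs)\<in>set (concat (map snd (gs m))). set (drop k as) \<union> set (drop k bs))" for m
  have step: "late_boxes ?\<eta> k k False (P m) = late_boxes ?\<eta> k k False (P (Suc m)) \<union> D m" if "k < m" for m
    unfolding D_def by (rule box_level_late[OF P(4)]) (use that k in auto)
  have "late_boxes ?\<eta> k k False (P (Suc k)) = late_boxes ?\<eta> k k False (P (Suc k + j)) \<union> (\<Union>m\<in>{Suc k..<Suc k + j}. D m)" for j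
  proof (induction j)
    case (Suc j)
    have "{Suc k..<Suc k + Suc j} = insert (Suc k + j) {Suc k..<Suc k + j}" by auto
    then show ?case using Suc step[of "Suc k + j"] by auto
  qed simp
  from this[of ?N] have late: "late_boxes ?\<eta> k k False (P (Suc k)) = (\<Union>m\<in>{Suc k..<Suc k + ?N}. D m)"
    using P(5)[of "Suc k + ?N"] by simp
  have D: "D m = {z. \<exists>\<gamma> i. \<gamma> \<in> excursion_solitons m e \<and> k \<le> i \<and> i < m \<and>
        z \<in> {soliton_head ?\<eta> \<gamma> i, soliton_tail ?\<eta> \<gamma> i}}" if m: "k < m" for m
  proof -
    have m1: "1 \<le> m" using m k by simp
    have sol: "excursion_solitons m e = support ` set (concat (map snd (gs m)))"
      by (rule solitons_of_levels[OF levels m1])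
    have ht: "{soliton_head ?\<eta> (support (as, bs)) i, soliton_tail ?\<eta> (support (as, bs)) i} = {as ! i, bs ! i}"
      and len: "length as = m" "length bs = m"
      if "(as, bs) \<in> set (concat (map snd (gs m)))" for as bs i
    proof -
      note f = box_level_form[OF P(4)[OF m1] P(2)[OF m1] that]
      then obtain b where "\<forall>x\<in>set as. ?\<eta> x = (\<not> b)" "\<forall>x\<in>set bs. ?\<eta> x = b" by blast
      then show "{soliton_head ?\<eta> (support (as, bs)) i, soliton_tail ?\<eta> (support (as, bs)) i} = {as ! i, bs ! i}"
        using soliton_head_tail f by blast
      show "length as = m" "length bs = m" using f by auto
    qed
    have *: "(\<Union>s\<in>A. {z. \<exists>i. k \<le> i \<and> i < m \<and> z \<in> Q (support s) i}) =
        {z. \<exists>\<gamma> i. \<gamma> \<in> support ` A \<and> k \<le> i \<and> i < m \<and> z \<in> Q \<gamma> i}" for A and Q :: "_ \<Rightarrow> _ \<Rightarrow> int set"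
      by blast
    have "D m = (\<Union>s\<in>set (concat (map snd (gs m))). {z. \<exists>i. k \<le> i \<and> i < m \<and>
        z \<in> {soliton_head ?\<eta> (support s) i, soliton_tail ?\<eta> (support s) i}})"
      unfolding D_def
    proof (rule SUP_cong[OF refl])
      fix s assume s: "s \<in> set (concat (map snd (gs m)))"
      obtain as bs where sab: "s = (as, bs)" by fastforce
      show "(case s of (as, bs) \<Rightarrow> set (drop k as) \<union> set (drop k bs)) =
        {z. \<exists>i. k \<le> i \<and> i < m \<and> z \<in> {soliton_head ?\<eta> (support s) i, soliton_tail ?\<eta> (support s) i}}"
        using s unfolding sab by (auto simp only: ht len set_drop_conv prod.case)
    qed
    also have "\<dots> = {z. \<exists>\<gamma> i. \<gamma> \<in> excursion_solitons m e \<and> k \<le> i \<and> i < m \<and>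
        z \<in> {soliton_head ?\<eta> \<gamma> i, soliton_tail ?\<eta> \<gamma> i}}"
      unfolding sol by (rule *)
    finally show ?thesis .
  qed
  \<comment> \<open>Levels beyond the length of the excursion contribute nothing, so the finite
    union extends to all \<open>m > k\<close>.\<close>
  have D0: "D m = {}" if "k < m" "Suc k + ?N \<le> m" for m
  proof -
    have "P m = []" using P(5) that by simp
    then have "gs m = [(0, [])]" using P(4)[of m] that by (auto elim: box_level.cases)
    then show ?thesis by (simp add: D_def)
  qed
  have "fst ` set (gs k) = insert 0 (\<Union>m\<in>{Suc k..<Suc k + ?N}. D m)"
    using box_level_late_slots[OF P(4)[OF k] k] late by simp
  also have "\<dots> = insert 0 (\<Union>m\<in>{k<..}. D m)"
    using D0 by (auto 4 3 simp: Suc_le_eq not_less[symmetric])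
  also have "(\<Union>m\<in>{k<..}. D m) = {z. \<exists>m. k < m \<and> z \<in> D m}" by auto
  also have "\<dots> = {z. \<exists>m. k < m \<and> (\<exists>\<gamma> i. \<gamma> \<in> excursion_solitons m e \<and> k \<le> i \<and> i < m \<and>
        z \<in> {soliton_head ?\<eta> \<gamma> i, soliton_tail ?\<eta> \<gamma> i})}"
    by (intro Collect_cong ex_cong1 conj_cong[OF refl]) (simp only: D mem_Collect_eq)
  also have "insert 0 \<dots> = excursion_slots k e"
    unfolding excursion_slots_def by blast
  finally show ?thesis by simp
qed

subsection \<open>Counting solitons between slots\<close>

definition nslots :: "nat \<Rightarrow> int list \<Rightarrow> nat" where
  "nslots k e = card (excursion_slots k e)"

text \<open>The slot after the last one is, by convention, the next record.\<close>

definition eslot :: "nat \<Rightarrow> int list \<Rightarrow> nat \<Rightarrow> int" where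
  "eslot k e j = (if j < nslots k e then sorted_list_of_set (excursion_slots k e) ! j
     else 2 * int (half_length e) + 1)"

definition ecount :: "nat \<Rightarrow> int list \<Rightarrow> nat \<Rightarrow> nat" where
  "ecount k e j = card {\<gamma> \<in> excursion_solitons k e. \<gamma> \<subseteq> {eslot k e j<..<eslot k e (Suc j)}}"

text \<open>The definition assigns solitons to slots by position, the reading by order. Both agree,
  since a soliton recorded at slot \<open>i\<close> lies between that slot and the next, hence not
  between any other two consecutive slots.\<close>

lemma slot_counts_of_levels:
  assumes levels: "soliton_levels e P gs" and k: "1 \<le> k"
  shows "map (length \<circ> snd) (gs k) = map (ecount k e) [0..<nslots k e]"
    "nslots k e = length (gs k)"
    "j < nslots k e \<Longrightarrow> eslot k e j = fst (gs k ! j)"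
    "sorted_wrt (<) (map fst (gs k))"
    "fst (gs k ! 0) = 0"
proof -
  note P = soliton_levelsD[OF levels]
  let ?\<eta> = "ball_config e"
  let ?sl = "map fst (gs k)"
  note lev = P(4)[OF k]
  have srt: "sorted_wrt (<) (0 # P k)" using P(2,3)[OF k] by auto
  note slots = box_level_slots[OF lev srt]
  have slots_eq: "excursion_slots k e = fst ` set (gs k)" by (rule slots_of_levels[OF levels k])
  have sols_eq: "excursion_solitons k e = support ` set (concat (map snd (gs k)))"
    by (rule solitons_of_levels[OF levels k])
  have sl: "sorted_list_of_set (excursion_slots k e) = ?sl"
    unfolding slots_eq list.set_map[symmetric] using slots
    by (intro sorted_list_of_set.idem_if_sorted_distinct) (auto simp: strict_sorted_iff)
  have "distinct ?sl" using slots strict_sorted_iff by blast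
  from distinct_card[OF this] show n: "nslots k e = length (gs k)"
    unfolding nslots_def slots_eq by simp
  show es: "eslot k e j = fst (gs k ! j)" if "j < nslots k e" for j
    using that n unfolding eslot_def sl by simp
  show "sorted_wrt (<) ?sl" using slots by blast
  show "fst (gs k ! 0) = 0" using box_level_hd[OF lev] by auto
  have dist: "distinct (map support (concat (map snd (gs k))))"
    by (rule box_level_distinct[OF lev k P(2)[OF k]])
  have ne: "support s \<noteq> {}" if "s \<in> set (concat (map snd (gs k)))" for s
    using box_level_form[OF lev P(2)[OF k], of "fst s" "snd s"] that k by (auto simp: support_def)
  have mono: "fst (gs k ! i) \<le> fst (gs k ! j)" if "i \<le> j" "j < length (gs k)" for i j
    using slots that sorted_wrt_nth_less[of "(<)" ?sl i j] by (cases "i = j") auto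
  show "map (length \<circ> snd) (gs k) = map (ecount k e) [0..<nslots k e]"
  proof (rule nth_equalityI)
    fix j assume "j < length (map (length \<circ> snd) (gs k))"
    then have j: "j < length (gs k)" by simp
    have sub: "set (snd (gs k ! i)) \<subseteq> set (concat (map snd (gs k)))" if "i < length (gs k)" for i
      using nth_mem[OF that] by auto
    have "{\<gamma> \<in> excursion_solitons k e. \<gamma> \<subseteq> {eslot k e j<..<eslot k e (Suc j)}} = support ` set (snd (gs k ! j))"
    proof (intro equalityI subsetI)
      fix \<gamma> assume "\<gamma> \<in> support ` set (snd (gs k ! j))"
      then obtain s where s: "\<gamma> = support s" "s \<in> set (snd (gs k ! j))" by blast
      have "y \<in> {eslot k e j<..<eslot k e (Suc j)}" if "y \<in> \<gamma>" for y
        using box_level_bounds[OF lev srt j s(2), of y] that s j es[of j] es[of "Suc j"] n P(3)[OF k]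
        by (cases "Suc j < nslots k e") (auto simp: eslot_def[of k e "Suc j"])
      moreover have "\<gamma> \<in> excursion_solitons k e"
        unfolding sols_eq using s sub[OF j] by blast
      ultimately show "\<gamma> \<in> {\<gamma> \<in> excursion_solitons k e. \<gamma> \<subseteq> {eslot k e j<..<eslot k e (Suc j)}}" by blast
    next
      fix \<gamma> assume *: "\<gamma> \<in> {\<gamma> \<in> excursion_solitons k e. \<gamma> \<subseteq> {eslot k e j<..<eslot k e (Suc j)}}"
      then obtain s where s: "\<gamma> = support s" "s \<in> set (concat (map snd (gs k)))"
        unfolding sols_eq by blast
      then obtain g where "g \<in> set (gs k)" "s \<in> set (snd g)" by auto
      then obtain i where i: "i < length (gs k)" "s \<in> set (snd (gs k ! i))"
        by (metis in_set_conv_nth)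
      obtain y where y: "y \<in> \<gamma>" using ne[OF s(2)] s by blast
      have b: "fst (gs k ! i) < y" "Suc i < length (gs k) \<longrightarrow> y < fst (gs k ! Suc i)"
        using box_level_bounds[OF lev srt i] y s(1) by blast+
      have y': "fst (gs k ! j) < y" "Suc j < length (gs k) \<longrightarrow> y < fst (gs k ! Suc j)"
        using * y es[of j] es[of "Suc j"] j n by auto
      have "\<not> i < j" using b y' mono[of "Suc i" j] j by auto
      moreover have "\<not> j < i" using b y' mono[of "Suc j" i] i by auto
      ultimately show "\<gamma> \<in> support ` set (snd (gs k ! j))" using s i by auto
    qed
    moreover have "card (support ` set (snd (gs k ! j))) = length (snd (gs k ! j))"
    proof -
      have "gs k = take j (gs k) @ gs k ! j # drop (Suc j) (gs k)" using j by (rule id_take_nth_drop)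
      then have "concat (map snd (gs k)) = concat (map snd (take j (gs k))) @ snd (gs k ! j) @ concat (map snd (drop (Suc j) (gs k)))"
        by (metis concat.simps(2) concat_append list.simps(9) map_append)
      then have "distinct (map support (snd (gs k ! j)))" using dist by simp
      then show ?thesis using distinct_card by fastforce
    qed
    ultimately show "map (length \<circ> snd) (gs k) ! j = map (ecount k e) [0..<nslots k e] ! j"
      using j n by (simp add: ecount_def)
  qed (use n in simp)
qed

text \<open>This keeps only the words of the levels and the counts at their slots, the data of the
  bijection between excursions and counts.\<close>

lemma excursion_words:
  assumes e: "e \<in> excursions"
  obtains W where "W 1 = word_of e"
    "\<And>k. 1 \<le> k \<Longrightarrow> level k False (W k) (W (Suc k)) (map (ecount k e) [0..<nslots k e])"
    "\<And>k. 2 * half_length e < k \<Longrightarrow> W k = []"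
proof -
  obtain P gs where levels: "soliton_levels e P gs" by (rule excursion_levels[OF e])
  note P = soliton_levelsD[OF levels]
  show ?thesis
  proof (rule that[of "\<lambda>k. map (ball_config e) (P k)"])
    show "level k False (map (ball_config e) (P k)) (map (ball_config e) (P (Suc k))) (map (ecount k e) [0..<nslots k e])"
      if "1 \<le> k" for k
      using P(6)[OF that] slot_counts_of_levels(1)[OF levels that] by simp
  qed (simp_all only: P(1,5) word_of_def list.map)
qed

lemma excursion_slot_facts:
  assumes e: "e \<in> excursions" and k: "1 \<le> k"
  shows "finite (excursion_slots k e)" "1 \<le> nslots k e" "eslot k e 0 = 0"
    "\<And>i j. i < j \<Longrightarrow> j \<le> nslots k e \<Longrightarrow> eslot k e i < eslot k e j"
    "excursion_slots k e = eslot k e ` {..<nslots k e}"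
    "soliton_number k e = (\<Sum>j<nslots k e. ecount k e j)"
    "\<And>\<gamma>. \<gamma> \<in> excursion_solitons k e \<Longrightarrow> \<gamma> \<noteq> {} \<and> \<gamma> \<subseteq> {1..2 * int (half_length e)}"
    "finite (excursion_solitons k e)"
proof -
  obtain P gs where levels: "soliton_levels e P gs" by (rule excursion_levels[OF e])
  note P = soliton_levelsD[OF levels]
  note c = slot_counts_of_levels[OF levels k]
  have sl: "excursion_slots k e = fst ` set (gs k)" by (rule slots_of_levels[OF levels k])
  have so: "excursion_solitons k e = support ` set (concat (map snd (gs k)))"
    by (rule solitons_of_levels[OF levels k])
  have srt: "sorted_wrt (<) (0 # P k)" using P(2,3)[OF k] by auto
  show "finite (excursion_slots k e)" unfolding sl by simp
  show "finite (excursion_solitons k e)" unfolding so by simp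
  have "gs k \<noteq> []" using box_level_hd[OF P(4)[OF k]] by auto
  then show n1: "1 \<le> nslots k e" using c(2) by (cases "gs k") auto
  then show "eslot k e 0 = 0" using c(3)[of 0] c(5) by simp
  show "excursion_slots k e = eslot k e ` {..<nslots k e}"
    unfolding sl using c(2,3) by (force simp: in_set_conv_nth image_iff)
  show "eslot k e i < eslot k e j" if "i < j" "j \<le> nslots k e" for i j
  proof (cases "j < nslots k e")
    case True
    then show ?thesis using c(2) c(3)[of i] c(3)[of j] that sorted_wrt_nth_less[OF c(4), of i j] by simp
  next
    case False
    have i: "i < length (gs k)" using that c(2) by simp
    then have "fst (gs k ! i) \<in> insert 0 (set (P k))"
      using box_level_slots[OF P(4)[OF k] srt] by force
    then have "eslot k e i \<le> 2 * int (half_length e)" using c(3)[of i] that P(3)[OF k] by auto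
    moreover have "eslot k e j = 2 * int (half_length e) + 1" using False by (simp add: eslot_def)
    ultimately show ?thesis by simp
  qed
  show "soliton_number k e = (\<Sum>j<nslots k e. ecount k e j)"
  proof -
    have "soliton_number k e = length (concat (map snd (gs k)))"
      unfolding soliton_number_def so using distinct_card[OF box_level_distinct[OF P(4)[OF k] k P(2)[OF k]]] by simp
    also have "\<dots> = sum_list (map (length \<circ> snd) (gs k))" by (simp add: length_concat comp_def)
    also have c1: "map (length \<circ> snd) (gs k) = map (ecount k e) [0..<nslots k e]" by (rule c(1))
    also have "sum_list \<dots> = (\<Sum>j<nslots k e. ecount k e j)" by (simp add: interv_sum_list_conv_sum_set_nat atLeast0LessThan)
    finally show ?thesis .
  qed
  show "\<gamma> \<noteq> {} \<and> \<gamma> \<subseteq> {1..2 * int (half_length e)}" if "\<gamma> \<in> excursion_solitons k e" for \<gamma>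
  proof -
    obtain s where s: "\<gamma> = support s" "s \<in> set (concat (map snd (gs k)))" using \<open>\<gamma> \<in> _\<close> unfolding so by blast
    then show ?thesis using box_level_support[OF P(4)[OF k] s(2)] P(3)[OF k]
        box_level_form[OF P(4)[OF k] P(2)[OF k], of "fst s" "snd s"] k by (auto simp: support_def)
  qed
qed

lemma soliton_number_large:
  assumes e: "e \<in> excursions" and k: "2 * half_length e < k"
  shows "soliton_number k e = 0" "nslots k e = 1"
proof -
  obtain W where W: "W 1 = word_of e"
    "\<And>k. 1 \<le> k \<Longrightarrow> level k False (W k) (W (Suc k)) (map (ecount k e) [0..<nslots k e])"
    "\<And>k. 2 * half_length e < k \<Longrightarrow> W k = []"
    using excursion_words[OF e] by blast
  have l: "level k False [] [] (map (ecount k e) [0..<nslots k e])" using W(2)[of k] W(3)[of k] W(3)[of "Suc k"] k by simp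
  show "nslots k e = 1" using level_length_slots[OF l] by simp
  show "soliton_number k e = 0"
    using level_length[OF l] k excursion_slot_facts(6)[OF e, of k]
    by (auto simp: interv_sum_list_conv_sum_set_nat atLeast0LessThan)
qed

text \<open>By \<open>level_length_slots\<close> the number of \<open>k\<close>-slots is
  \<open>1\<close> plus the length minus \<open>k\<close> times the number of value changes of the
  word at level \<open>k + 1\<close>. Each \<open>m\<close>-soliton carries \<open>2 * m\<close>
  boxes and two changes, hence contributes \<open>2 * (m - k)\<close>.\<close>

lemma nslots_formula:
  assumes e: "e \<in> excursions" and k: "1 \<le> k" and M: "2 * half_length e < M"
  shows "nslots k e = 1 + (\<Sum>m\<in>{k<..<M}. 2 * (m - k) * soliton_number m e)"
proof -
  obtain W where W: "W 1 = word_of e"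
    "\<And>k. 1 \<le> k \<Longrightarrow> level k False (W k) (W (Suc k)) (map (ecount k e) [0..<nslots k e])"
    "\<And>k. 2 * half_length e < k \<Longrightarrow> W k = []"
    using excursion_words[OF e] by blast
  have n: "sum_list (map (ecount k e) [0..<nslots k e]) = soliton_number k e" if "1 \<le> k" for k
    using excursion_slot_facts(6)[OF e that] by (simp add: interv_sum_list_conv_sum_set_nat atLeast0LessThan)
  define d where "d m = int (length (W m)) - int k * int (flips False (W m))" for m
  have d: "d m = d (Suc m) + int (2 * (m - k) * soliton_number m e)" if "k < m" for m
    using level_length[OF W(2)[of m]] level_flips[OF W(2)[of m]] n[of m] that k
    by (simp add: d_def algebra_simps of_nat_diff)
  have "d (Suc k) = d (Suc k + j) + (\<Sum>m\<in>{Suc k..<Suc k + j}. int (2 * (m - k) * soliton_number m e))" for j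
  proof (induction j)
    case (Suc j)
    then show ?case using d[of "Suc k + j"] by (simp add: algebra_simps)
  qed simp
  from this[of M] have "d (Suc k) = (\<Sum>m\<in>{Suc k..<Suc k + M}. int (2 * (m - k) * soliton_number m e))"
    using W(3)[of "Suc k + M"] M by (simp add: d_def)
  also have "\<dots> = (\<Sum>m\<in>{k<..<M}. int (2 * (m - k) * soliton_number m e))"
    by (rule sum.mono_neutral_right) (use soliton_number_large[OF e] M in auto)
  finally have "int (nslots k e) = int (1 + (\<Sum>m\<in>{k<..<M}. 2 * (m - k) * soliton_number m e))"
    using arg_cong[OF level_length_slots[OF W(2)[OF k]], of int] by (simp add: d_def)
  then show ?thesis by linarith
qed

text \<open>Equality is passed down from a top level where both words are empty: equal words at
  level \<open>k + 1\<close> have equally many slots, so \<open>G\<close> gives equal counts, so the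
  words at level \<open>k\<close> agree. The number of slots is an argument of \<open>G\<close>
  because to the left of the origin the place where counts are read depends on it.\<close>

lemma excursion_determined:
  assumes e: "e \<in> excursions" "e' \<in> excursions"
    and c: "\<And>k j. 1 \<le> k \<Longrightarrow> j < nslots k e \<Longrightarrow> ecount k e j = G k (nslots k e) j"
    and c': "\<And>k j. 1 \<le> k \<Longrightarrow> j < nslots k e' \<Longrightarrow> ecount k e' j = G k (nslots k e') j"
  shows "e = e'"
proof -
  obtain W where W: "W 1 = word_of e"
    "\<And>k. 1 \<le> k \<Longrightarrow> level k False (W k) (W (Suc k)) (map (ecount k e) [0..<nslots k e])"
    "\<And>k. 2 * half_length e < k \<Longrightarrow> W k = []"
    using excursion_words[OF e(1)] by blast
  obtain W' where W': "W' 1 = word_of e'"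
    "\<And>k. 1 \<le> k \<Longrightarrow> level k False (W' k) (W' (Suc k)) (map (ecount k e') [0..<nslots k e'])"
    "\<And>k. 2 * half_length e' < k \<Longrightarrow> W' k = []"
    using excursion_words[OF e(2)] by blast
  define M where "M = Suc (2 * half_length e + 2 * half_length e')"
  have "W (M - i) = W' (M - i)" if "i < M" for i
    using that
  proof (induction i)
    case 0
    then show ?case using W(3)[of M] W'(3)[of M] by (simp add: M_def)
  next
    case (Suc i)
    define k where "k = M - Suc i"
    have k: "1 \<le> k" "Suc k = M - i" using Suc.prems by (auto simp: k_def)
    then have eq: "W (Suc k) = W' (Suc k)" using Suc by simp
    have "nslots k e = nslots k e'"
      using level_length_slots[OF W(2)[OF k(1)]] level_length_slots[OF W'(2)[OF k(1)]] eq by simp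
    then have "map (ecount k e) [0..<nslots k e] = map (ecount k e') [0..<nslots k e']"
      using c[OF k(1)] c'[OF k(1)] by simp
    then show ?case
      using level_inj_up[of k False "W k" "W (Suc k)" _ "W' k"] W(2)[OF k(1)] W'(2)[OF k(1)] eq
      by (simp add: k_def[symmetric])
  qed
  from this[of "M - 1"] have "word_of e = word_of e'" using W(1) W'(1) by (simp add: M_def)
  then show ?thesis using heights_word_of e by metis
qed

text \<open>An empty word has the single slot \<open>0\<close>, so \<open>G k 1 0 = 0\<close> says
  that nothing is prescribed above level \<open>K\<close>. From there the word is enlarged level by
  level, with the counts that \<open>G\<close> gives for the number of slots it has reached.\<close>

lemma excursion_with_counts:
  assumes G: "\<And>k. K < k \<Longrightarrow> G k 1 0 = 0"
  obtains e where "e \<in> excursions" "\<And>k j. 1 \<le> k \<Longrightarrow> j < nslots k e \<Longrightarrow> ecount k e j = G k (nslots k e) j"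
proof -
  define lev where "lev k w c \<longleftrightarrow> (\<exists>s. level k False w c (map (G k s) [0..<s]))" for k w c
  \<comment> \<open>The word \<open>U i\<close> belongs to level \<open>Suc K - i\<close>.\<close>
  have "\<exists>U. \<forall>i. (dyck 0 (U i) \<and> runs_ge (Suc K - i) False (U i) \<and> (i = 0 \<longrightarrow> U i = [])) \<and>
      (i < K \<longrightarrow> lev (K - i) (U (Suc i)) (U i))"
  proof (rule dependent_nat_choice)
    show "\<exists>x. dyck 0 x \<and> runs_ge (Suc K - 0) False x \<and> ((0::nat) = 0 \<longrightarrow> x = [])"
      by (intro exI[of _ "[]"]) (auto intro: runs_ge.Nil)
  next
    fix c i assume "dyck 0 c \<and> runs_ge (Suc K - i) False c \<and> (i = 0 \<longrightarrow> c = [])"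
    then have c: "dyck 0 c" "runs_ge (Suc K - i) False c" by auto
    show "\<exists>w. (dyck 0 w \<and> runs_ge (Suc K - Suc i) False w \<and> (Suc i = 0 \<longrightarrow> w = [])) \<and>
      (i < K \<longrightarrow> lev (K - i) w c)"
    proof (cases "i < K")
      case True
      then have "Suc K - i = Suc (K - i)" by simp
      then obtain s where s: "\<And>xs. length xs = s \<Longrightarrow> \<exists>w. level (K - i) False w c xs"
        using level_insert[of "K - i" False c] c by auto
      obtain w where w: "level (K - i) False w c (map (G (K - i) s) [0..<s])"
        using s[of "map (G (K - i) s) [0..<s]"] by auto
      then show ?thesis
        using level_dyck_up[OF w c(1)] level_runs_ge[OF w] unfolding lev_def by auto
    next
      case False
      have "runs_ge 0 False []" by (rule runs_ge.Nil)
      then show ?thesis using False by (intro exI[of _ "[]"]) auto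
    qed
  qed
  then obtain U where U: "\<And>i. dyck 0 (U i)" "U 0 = []" "\<And>i. i < K \<Longrightarrow> lev (K - i) (U (Suc i)) (U i)"
    by auto
  define V where "V k = U (Suc K - k)" for k
  have V: "lev k (V k) (V (Suc k))" if "1 \<le> k" for k
  proof (cases "k \<le> K")
    case True
    then have "Suc (K - k) = Suc K - k" "K - (K - k) = k" "K - k < K" using that by auto
    then show ?thesis using U(3)[of "K - k"] by (simp add: V_def)
  next
    case False
    then have "level k False (V k) (V (Suc k)) (map (G k 1) [0..<1])"
      using G[of k] level.Nil U(2) by (simp add: V_def)
    then show ?thesis unfolding lev_def by blast
  qed
  obtain e where e: "e \<in> excursions" "word_of e = V 1"
    using excursion_of_word[of "V 1"] U(1) by (auto simp: V_def)
  obtain W where W: "W 1 = word_of e"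
    "\<And>k. 1 \<le> k \<Longrightarrow> level k False (W k) (W (Suc k)) (map (ecount k e) [0..<nslots k e])"
    by (rule excursion_words[OF e(1)]) blast
  \<comment> \<open>The levels computed from \<open>e\<close> are the constructed words: they agree
    at level \<open>1\<close>, and a word determines its shorter word.\<close>
  have WV: "W (Suc i) = V (Suc i)" for i
  proof (induction i)
    case (Suc i)
    then show ?case
      using V[of "Suc i"] W(2)[of "Suc i"] level_inj_down[of "Suc i" False "W (Suc i)"] unfolding lev_def by fastforce
  qed (use W e in simp)
  show ?thesis
  proof (rule that[OF e(1)])
    fix k j assume k: "1 \<le> k" and j: "j < nslots k e"
    have "W k = V k" using WV[of "k - 1"] k by simp
    with V[OF k] have "lev k (W k) (V (Suc k))" by simp
    then obtain s where "level k False (W k) (V (Suc k)) (map (G k s) [0..<s])" unfolding lev_def by blast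
    then have eq: "map (ecount k e) [0..<nslots k e] = map (G k s) [0..<s]"
      using level_inj_down[OF W(2)[OF k] _ k] by blast
    then have "s = nslots k e" by (metis diff_zero length_map length_upt)
    then show "ecount k e j = G k (nslots k e) j" using eq j by simp
  qed
qed

subsection \<open>Concatenation of excursions\<close>

text \<open>The two-sided sum with value \<open>0\<close> at \<open>0\<close>. It gives both the
  positions of records and the numbering of slots; there the summands are at least \<open>1\<close>
  and cut the integers into blocks.\<close>

definition partial_sum :: "(int \<Rightarrow> int) \<Rightarrow> int \<Rightarrow> int" where
  "partial_sum f i = (\<Sum>j\<in>{0..<i}. f j) - (\<Sum>j\<in>{i..<0}. f j)"

lemma partial_sum_0 [simp]: "partial_sum f 0 = 0"
  by (simp add: partial_sum_def)

lemma partial_sum_step: "partial_sum f (i + 1) = partial_sum f i + f i"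
proof (cases "0 \<le> i")
  case True
  then have "{0..<i + 1} = insert i {0..<i}" by auto
  with True show ?thesis by (simp add: partial_sum_def)
next
  case False
  then have "{i..<0} = insert i {i + 1..<0}" by auto
  with False show ?thesis by (simp add: partial_sum_def)
qed

lemma partial_sum_cong:
  "(\<And>j. 0 \<le> j \<and> j < i \<or> i \<le> j \<and> j < 0 \<Longrightarrow> f j = g j) \<Longrightarrow> partial_sum f i = partial_sum g i"
  unfolding partial_sum_def by (intro arg_cong2[where f = "(-)"] sum.cong) auto

lemma strict_mono_int_step:
  fixes s :: "int \<Rightarrow> int"
  assumes "\<And>x. s x < s (x + 1)" shows "strict_mono s"
proof (rule strict_monoI)
  fix x y :: int assume "x < y"
  then show "s x < s y"
  proof (induction rule: int_gr_induct)
    case (step i)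
    then show ?case using assms[of i] by simp
  qed (use assms in simp)
qed

lemma strict_mono_partial_sum:
  assumes "\<And>j. 1 \<le> f j" shows "strict_mono (partial_sum f)"
proof (rule strict_mono_int_step)
  show "partial_sum f x < partial_sum f (x + 1)" for x using assms[of x] by (simp add: partial_sum_step)
qed

lemma partial_sum_block:
  assumes "\<And>j. 1 \<le> f j"
  obtains i where "partial_sum f i \<le> x" "x < partial_sum f (i + 1)"
proof -
  have "\<exists>i. partial_sum f i \<le> x \<and> x < partial_sum f (i + 1)"
  proof (induction x rule: int_induct[where k = 0])
    case base
    then show ?case using assms[of 0] partial_sum_step[of f 0] by (intro exI[of _ 0]) simp
  next
    case (step1 x)
    then obtain i where i: "partial_sum f i \<le> x" "x < partial_sum f (i + 1)" by blast
    show ?case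
    proof (cases "x + 1 < partial_sum f (i + 1)")
      case True
      then show ?thesis using i by (intro exI[of _ i]) simp
    next
      case False
      then show ?thesis using i assms[of "i + 1"] partial_sum_step[of f "i + 1"] by (intro exI[of _ "i + 1"]) auto
    qed
  next
    case (step2 x)
    then obtain i where i: "partial_sum f i \<le> x" "x < partial_sum f (i + 1)" by blast
    show ?case
    proof (cases "partial_sum f i \<le> x - 1")
      case True
      then show ?thesis using i by (intro exI[of _ i]) simp
    next
      case False
      then show ?thesis using i assms[of "i - 1"] partial_sum_step[of f "i - 1"] by (intro exI[of _ "i - 1"]) auto
    qed
  qed
  then show ?thesis using that by blast
qed

lemma partial_sum_block_unique:
  assumes f: "\<And>j. 1 \<le> f j"
    and "partial_sum f i \<le> x" "x < partial_sum f (i + 1)" "partial_sum f i' \<le> x" "x < partial_sum f (i' + 1)"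
  shows "i = i'"
proof -
  have "partial_sum f i < partial_sum f (i' + 1)" "partial_sum f i' < partial_sum f (i + 1)" using assms by simp_all
  then have "i < i' + 1" "i' < i + 1"
    using strict_mono_less[OF strict_mono_partial_sum[of f, OF f]] by blast+
  then show ?thesis by simp
qed

lemma concat_pos_eq: "concat_pos \<epsilon> = partial_sum (\<lambda>j. 2 * int (half_length (\<epsilon> j)) + 1)"
  by (simp add: concat_pos_def partial_sum_def fun_eq_iff)

lemma concat_pos_0 [simp]: "concat_pos \<epsilon> 0 = 0"
  by (simp add: concat_pos_eq)

lemma concat_pos_step: "concat_pos \<epsilon> (i + 1) = concat_pos \<epsilon> i + 2 * int (half_length (\<epsilon> i)) + 1"
  by (simp add: concat_pos_eq partial_sum_step)

lemma concat_pos_strict_mono: "strict_mono (concat_pos \<epsilon>)"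
  unfolding concat_pos_eq by (rule strict_mono_partial_sum) simp

lemma concat_pos_block:
  obtains i z where "x = concat_pos \<epsilon> i + int z" "z \<le> 2 * half_length (\<epsilon> i)"
proof -
  obtain i where i: "concat_pos \<epsilon> i \<le> x" "x < concat_pos \<epsilon> (i + 1)"
    unfolding concat_pos_eq by (rule partial_sum_block[of "\<lambda>j. 2 * int (half_length (\<epsilon> j)) + 1" x]) auto
  then show ?thesis
    using that[of i "nat (x - concat_pos \<epsilon> i)"] concat_pos_step[of \<epsilon> i] by auto
qed

lemma concat_pos_block_unique:
  assumes "concat_pos \<epsilon> i \<le> x" "x < concat_pos \<epsilon> (i + 1)" "concat_pos \<epsilon> i' \<le> x" "x < concat_pos \<epsilon> (i' + 1)"
  shows "i = i'"
  using assms unfolding concat_pos_eq by (intro partial_sum_block_unique) auto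

lemma concat_excursions_at:
  assumes "z \<le> 2 * half_length (\<epsilon> i)"
  shows "concat_excursions \<epsilon> (concat_pos \<epsilon> i + int z) \<longleftrightarrow> ball_config (\<epsilon> i) (int z)"
proof
  assume "concat_excursions \<epsilon> (concat_pos \<epsilon> i + int z)"
  then obtain i' z' where *: "0 \<le> z'" "z' \<le> 2 * int (half_length (\<epsilon> i'))"
      "concat_pos \<epsilon> i + int z = concat_pos \<epsilon> i' + z'" "ball_config (\<epsilon> i') z'"
    unfolding concat_excursions_def by blast
  then have "i = i'"
    using assms concat_pos_step[of \<epsilon> i] concat_pos_step[of \<epsilon> i']
    by (intro concat_pos_block_unique[of \<epsilon> i "concat_pos \<epsilon> i + int z" i']) auto
  then show "ball_config (\<epsilon> i) (int z)" using * by simp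
next
  assume "ball_config (\<epsilon> i) (int z)"
  then show "concat_excursions \<epsilon> (concat_pos \<epsilon> i + int z)"
    unfolding concat_excursions_def using assms by (intro exI[of _ i] exI[of _ "int z"]) simp
qed

lemma ball_config_0 [simp]: "\<not> ball_config e 0"
  by (simp add: ball_config_def)

context
  fixes \<epsilon> :: "int \<Rightarrow> int list"
  assumes exc: "\<And>i. \<epsilon> i \<in> excursions"
begin

lemma excursion_nth_0: "\<epsilon> i ! 0 = 0" "\<epsilon> i ! (2 * half_length (\<epsilon> i)) = 0"
  using exc[of i] excursion_length[OF exc[of i]] by (auto simp: excursions_def)

lemma excursion_nth_nonneg: "z \<le> 2 * half_length (\<epsilon> i) \<Longrightarrow> 0 \<le> \<epsilon> i ! z"
  using exc[of i] excursion_length[OF exc[of i]] by (auto simp: excursions_def)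

lemma walk_concat_rel:
  "z \<le> 2 * half_length (\<epsilon> i) \<Longrightarrow>
    walk (concat_excursions \<epsilon>) (concat_pos \<epsilon> i + int z) = walk (concat_excursions \<epsilon>) (concat_pos \<epsilon> i) + \<epsilon> i ! z"
proof (induction z)
  case 0
  then show ?case using excursion_nth_0 by simp
next
  case (Suc z)
  have "walk (concat_excursions \<epsilon>) (concat_pos \<epsilon> i + int (Suc z)) = walk (concat_excursions \<epsilon>) (concat_pos \<epsilon> i + int z)
     + (2 * of_bool (ball_config (\<epsilon> i) (int (Suc z))) - 1)"
    using walk_step[of "concat_excursions \<epsilon>" "concat_pos \<epsilon> i + int (Suc z)"] concat_excursions_at[of "Suc z" \<epsilon> i] Suc.prems
    by (simp add: algebra_simps)
  then show ?case using Suc ball_config_Suc[OF exc, of z i] by (auto simp: add.commute)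
qed

lemma walk_concat_pos_step:
  "walk (concat_excursions \<epsilon>) (concat_pos \<epsilon> (i + 1)) = walk (concat_excursions \<epsilon>) (concat_pos \<epsilon> i) - 1"
proof -
  have "\<not> concat_excursions \<epsilon> (concat_pos \<epsilon> (i + 1))"
    using concat_excursions_at[of 0 \<epsilon> "i + 1"] by simp
  moreover have "concat_pos \<epsilon> (i + 1) - 1 = concat_pos \<epsilon> i + int (2 * half_length (\<epsilon> i))"
    using concat_pos_step[of \<epsilon> i] by simp
  ultimately show ?thesis
    using walk_step[of "concat_excursions \<epsilon>" "concat_pos \<epsilon> (i + 1)"]
      walk_concat_rel[of "2 * half_length (\<epsilon> i)" i] excursion_nth_0 by simp
qed

lemma walk_concat_pos: "walk (concat_excursions \<epsilon>) (concat_pos \<epsilon> i) = - i"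
proof (induction i rule: int_induct[where k = 0])
  case base
  then show ?case by (simp add: walk_0)
next
  case (step1 i)
  then show ?case using walk_concat_pos_step[of i] by simp
next
  case (step2 i)
  then show ?case using walk_concat_pos_step[of "i - 1"] by simp
qed

lemma walk_concat:
  "z \<le> 2 * half_length (\<epsilon> i) \<Longrightarrow> walk (concat_excursions \<epsilon>) (concat_pos \<epsilon> i + int z) = \<epsilon> i ! z - i"
  using walk_concat_rel walk_concat_pos by simp

text \<open>An earlier excursion has an index \<open>i' < i\<close> and stays at height at least
  \<open>- i'\<close>.\<close>

lemma walk_concat_before:
  assumes "x < concat_pos \<epsilon> i" shows "- i < walk (concat_excursions \<epsilon>) x"
proof -
  obtain i' z where x: "x = concat_pos \<epsilon> i' + int z" "z \<le> 2 * half_length (\<epsilon> i')"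
    using concat_pos_block by blast
  have "concat_pos \<epsilon> i' < concat_pos \<epsilon> i" using x assms by simp
  then have "i' < i" using strict_mono_less[OF concat_pos_strict_mono] by blast
  then show ?thesis using walk_concat[OF x(2)] excursion_nth_nonneg[OF x(2)] x(1) by simp
qed

lemma record_pos_concat: "record_pos (concat_excursions \<epsilon>) i = concat_pos \<epsilon> i"
  unfolding record_pos_def
proof (rule Least_equality)
  show "walk (concat_excursions \<epsilon>) (concat_pos \<epsilon> i) = - i" by (rule walk_concat_pos)
  show "concat_pos \<epsilon> i \<le> y" if "walk (concat_excursions \<epsilon>) y = - i" for y
    using walk_concat_before[of y i] that by force
qed

lemma concat_in_Omega_hat: "concat_excursions \<epsilon> \<in> Omega_hat"
proof -
  have "is_record (concat_excursions \<epsilon>) 0"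
    unfolding is_record_def using walk_concat_before[of _ 0] by (simp add: walk_0)
  moreover have "concat_pos \<epsilon> i \<le> z" if "walk (concat_excursions \<epsilon>) z = - i" for z i
    using walk_concat_before[of z i] that by force
  ultimately show ?thesis unfolding Omega_hat_def using walk_concat_pos by blast
qed

lemma excursion_at_concat: "excursion_at (concat_excursions \<epsilon>) i = \<epsilon> i"
proof -
  have n: "nat ((concat_pos \<epsilon> (i + 1) - concat_pos \<epsilon> i - 1) div 2) = half_length (\<epsilon> i)"
    using concat_pos_step[of \<epsilon> i] by simp
  show ?thesis
    unfolding excursion_at_def record_pos_concat Let_def n
  proof (rule nth_equalityI)
    show "length (map (\<lambda>z. walk (concat_excursions \<epsilon>) (concat_pos \<epsilon> i + int z) - walk (concat_excursions \<epsilon>) (concat_pos \<epsilon> i)) [0..<2 * half_length (\<epsilon> i) + 1]) = length (\<epsilon> i)"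
      using excursion_length[OF exc] by simp
  qed (simp add: walk_concat_rel del: upt_Suc)
qed

end

text \<open>Seen from record \<open>i\<close>, the sequence of excursions is the old one with its
  index shifted; translation by a record thereby becomes a shift.\<close>

lemma translate_concat:
  assumes "\<And>i. \<epsilon> i \<in> excursions"
  shows "translate (concat_pos \<epsilon> i) (concat_excursions \<epsilon>) = concat_excursions (\<lambda>j. \<epsilon> (i + j))"
proof
  fix x
  have pos: "concat_pos (\<lambda>j. \<epsilon> (i + j)) l = concat_pos \<epsilon> (i + l) - concat_pos \<epsilon> i" for l
  proof (induction l rule: int_induct[where k = 0])
    case (step1 l)
    then show ?case using concat_pos_step[of \<epsilon> "i + l"] concat_pos_step[of "\<lambda>j. \<epsilon> (i + j)" l] by (simp add: add.assoc)
  next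
    case (step2 l)
    then show ?case using concat_pos_step[of \<epsilon> "i + l - 1"] concat_pos_step[of "\<lambda>j. \<epsilon> (i + j)" "l - 1"] by (simp add: algebra_simps)
  qed simp
  obtain l z where x: "x = concat_pos (\<lambda>j. \<epsilon> (i + j)) l + int z" "z \<le> 2 * half_length (\<epsilon> (i + l))"
    using concat_pos_block[of x "\<lambda>j. \<epsilon> (i + j)"] by blast
  then have eq: "x + concat_pos \<epsilon> i = concat_pos \<epsilon> (i + l) + int z" using pos by simp
  then show "translate (concat_pos \<epsilon> i) (concat_excursions \<epsilon>) x = concat_excursions (\<lambda>j. \<epsilon> (i + j)) x"
    using concat_excursions_at[of z \<epsilon> "i + l"] concat_excursions_at[of z "\<lambda>j. \<epsilon> (i + j)" l] x(2)
    unfolding translate_def eq by (simp flip: x(1))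
qed

section \<open>From a configuration back to its excursions\<close>

lemma walk_Suc: "walk \<eta> (x + 1) = walk \<eta> x + (if \<eta> (x + 1) then 1 else -1)"
  using walk_step[of \<eta> "x + 1"] by (cases "\<eta> (x + 1)") auto

lemma walk_abs_step: "\<bar>walk \<eta> (x + 1) - walk \<eta> x\<bar> = 1"
  by (simp add: walk_Suc)

lemma walk_parity: "even (walk \<eta> (x + int n) - walk \<eta> x - int n)"
proof (induction n)
  case (Suc n)
  then show ?case using walk_Suc[of \<eta> "x + int n"] by (auto simp: add.assoc add.commute[of 1] split: if_splits)
qed simp

lemma walk_intermediate:
  assumes "x \<le> y" "walk \<eta> y \<le> c" "c \<le> walk \<eta> x"
  obtains z where "x \<le> z" "z \<le> y" "walk \<eta> z = c"
proof -
  have "\<exists>z. x \<le> z \<and> z \<le> y \<and> walk \<eta> z = c"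
    using assms
  proof (induction y rule: int_ge_induct)
    case base
    then show ?case by (intro exI[of _ x]) auto
  next
    case (step y)
    show ?case
    proof (cases "walk \<eta> y \<le> c")
      case True
      then show ?thesis using step by force
    next
      case False
      then have "walk \<eta> (y + 1) = c" using step.prems walk_abs_step[of \<eta> y] by linarith
      then show ?thesis using step by (intro exI[of _ "y + 1"]) auto
    qed
  qed
  then show ?thesis using that by blast
qed

context
  fixes \<eta> :: "int \<Rightarrow> bool"
  assumes om: "\<eta> \<in> Omega_hat"
begin

lemma walk_record_pos: "walk \<eta> (record_pos \<eta> i) = - i"
  and record_pos_le: "walk \<eta> z = - i \<Longrightarrow> record_pos \<eta> i \<le> z"
proof -
  obtain z0 where z0: "walk \<eta> z0 = - i" "\<And>z. walk \<eta> z = - i \<Longrightarrow> z0 \<le> z"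
    using om unfolding Omega_hat_def by blast
  then have "record_pos \<eta> i = z0" unfolding record_pos_def by (intro Least_equality)
  then show "walk \<eta> (record_pos \<eta> i) = - i" "walk \<eta> z = - i \<Longrightarrow> record_pos \<eta> i \<le> z"
    using z0 by auto
qed

text \<open>The walk is positive to the left of the record at \<open>0\<close>. If it were also
  bounded above there, some value would be taken infinitely often, hence arbitrarily far to the
  left, against the existence of a leftmost visit to each value.\<close>

lemma walk_left_unbounded: "\<exists>z<y. v < walk \<eta> z"
proof (rule ccontr)
  assume "\<not> ?thesis"
  then have le: "walk \<eta> z \<le> v" if "z < min y 0" for z using that by force
  have pos: "0 < walk \<eta> z" if "z < 0" for z
    using om that unfolding Omega_hat_def is_record_def by (simp add: walk_0)
  have "walk \<eta> ` {..<min y 0} \<subseteq> {1..v}" using le pos by force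
  then have "finite (walk \<eta> ` {..<min y 0})" using finite_subset by blast
  moreover have "infinite {..<min y 0}" using infinite_Iio by blast
  ultimately obtain z0 where inf: "infinite {z \<in> {..<min y 0}. walk \<eta> z = walk \<eta> z0}"
    using pigeonhole_infinite by blast
  have "{z \<in> {..<min y 0}. walk \<eta> z = walk \<eta> z0} \<subseteq> {record_pos \<eta> (- walk \<eta> z0)..<min y 0}"
    using record_pos_le[of _ "- walk \<eta> z0"] by auto
  then show False using inf finite_subset by blast
qed

text \<open>Further to the left the walk exceeds \<open>- i\<close>, so a value at most
  \<open>- i\<close> at \<open>x\<close> would force a visit to \<open>- i\<close> before the first
  one.\<close>

lemma walk_before_record: "x < record_pos \<eta> i \<Longrightarrow> - i < walk \<eta> x"
proof (rule ccontr)
  assume x: "x < record_pos \<eta> i" "\<not> - i < walk \<eta> x"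
  obtain z where z: "z < x" "- i < walk \<eta> z" using walk_left_unbounded by blast
  then obtain y where "y \<le> x" "walk \<eta> y = - i"
    using walk_intermediate[of z x \<eta> "- i"] x by auto
  then show False using record_pos_le[of y i] x by simp
qed

lemma record_pos_0: "record_pos \<eta> 0 = 0"
proof -
  have "record_pos \<eta> 0 \<le> 0" using record_pos_le[of 0 0] walk_0 by simp
  moreover have "\<not> record_pos \<eta> 0 < 0"
    using om walk_record_pos[of 0] walk_0 unfolding Omega_hat_def is_record_def by auto
  ultimately show ?thesis by simp
qed

lemma record_pos_less: "record_pos \<eta> i < record_pos \<eta> (i + 1)"
proof (rule ccontr)
  assume "\<not> ?thesis"
  then have "record_pos \<eta> (i + 1) < record_pos \<eta> i"
    using walk_record_pos[of i] walk_record_pos[of "i + 1"] by (cases "record_pos \<eta> i = record_pos \<eta> (i + 1)") auto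
  from walk_before_record[OF this] show False using walk_record_pos[of "i + 1"] by simp
qed

lemma not_at_record: "\<not> \<eta> (record_pos \<eta> i)"
  using walk_before_record[of "record_pos \<eta> i - 1" i] walk_record_pos[of i] walk_Suc[of \<eta> "record_pos \<eta> i - 1"]
  by (auto split: if_splits)

lemma record_pos_step: "record_pos \<eta> (i + 1) = record_pos \<eta> i + 2 * int (half_length (excursion_at \<eta> i)) + 1"
  and length_excursion_at: "length (excursion_at \<eta> i) = Suc (2 * half_length (excursion_at \<eta> i))"
  and excursion_at_nth: "z \<le> 2 * half_length (excursion_at \<eta> i) \<Longrightarrow>
    excursion_at \<eta> i ! z = walk \<eta> (record_pos \<eta> i + int z) + i"
proof -
  define n where "n = nat ((record_pos \<eta> (i + 1) - record_pos \<eta> i - 1) div 2)"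
  define d where "d = nat (record_pos \<eta> (i + 1) - record_pos \<eta> i)"
  have d: "record_pos \<eta> (i + 1) = record_pos \<eta> i + int d" using record_pos_less[of i] by (simp add: d_def)
  have "even (walk \<eta> (record_pos \<eta> i + int d) - walk \<eta> (record_pos \<eta> i) - int d)" by (rule walk_parity)
  \<comment> \<open>The walk falls by \<open>1\<close> between consecutive records and changes
    parity at each step.\<close>
  then have "odd d" using walk_record_pos[of i] walk_record_pos[of "i + 1"] d by simp
  then have r: "record_pos \<eta> (i + 1) = record_pos \<eta> i + 2 * int n + 1"
    unfolding n_def using d by (auto elim!: oddE)
  have e: "excursion_at \<eta> i = map (\<lambda>z. walk \<eta> (record_pos \<eta> i + int z) - walk \<eta> (record_pos \<eta> i)) [0..<2 * n + 1]"
    unfolding excursion_at_def n_def Let_def ..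
  then have h: "half_length (excursion_at \<eta> i) = n" unfolding half_length_def by simp
  show "record_pos \<eta> (i + 1) = record_pos \<eta> i + 2 * int (half_length (excursion_at \<eta> i)) + 1"
    using r h by simp
  show "length (excursion_at \<eta> i) = Suc (2 * half_length (excursion_at \<eta> i))"
    unfolding h by (simp add: e)
  show "excursion_at \<eta> i ! z = walk \<eta> (record_pos \<eta> i + int z) + i" if "z \<le> 2 * half_length (excursion_at \<eta> i)"
    using that walk_record_pos[of i] unfolding h unfolding e by (simp del: upt_Suc)
qed

lemma excursion_at_in: "excursion_at \<eta> i \<in> excursions"
proof -
  let ?e = "excursion_at \<eta> i" and ?r = "record_pos \<eta> i" 
  let ?n = "half_length ?e"
  note len = length_excursion_at[of i]
  have lo: "- i \<le> walk \<eta> (?r + int z)" if "z \<le> 2 * ?n" for z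
    using walk_before_record[of "?r + int z" "i + 1"] record_pos_step[of i] that by simp
  have last: "walk \<eta> (?r + int (2 * ?n)) = - i"
    using walk_Suc[of \<eta> "?r + int (2 * ?n)"] walk_record_pos[of "i + 1"] record_pos_step[of i] lo[of "2 * ?n"]
    by (auto simp: algebra_simps split: if_splits)
  show ?thesis
    unfolding excursions_def
  proof (intro CollectI conjI allI impI)
    show "odd (length ?e)" using len by simp
    show "?e ! 0 = 0" using excursion_at_nth[of 0 i] walk_record_pos by simp
    show "?e ! (length ?e - 1) = 0" using excursion_at_nth[of "2 * ?n" i] last len by simp
    show "0 \<le> ?e ! z" if "z < length ?e" for z
      using excursion_at_nth[of z i] lo[of z] that len by simp
    show "\<bar>?e ! z - ?e ! (z - 1)\<bar> = 1" if z0: "1 \<le> z \<and> z < length ?e" for z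
    proof -
      obtain z' where z: "z = Suc z'" using z0 by (cases z) auto
      then show ?thesis
        using excursion_at_nth[of z i] excursion_at_nth[of z' i] z0 len walk_abs_step[of \<eta> "?r + int z'"]
        by (simp add: algebra_simps)
    qed
  qed
qed

lemma concat_excursion_at: "concat_excursions (excursion_at \<eta>) = \<eta>"
proof
  fix x
  have pos: "concat_pos (excursion_at \<eta>) l = record_pos \<eta> l" for l
  proof (induction l rule: int_induct[where k = 0])
    case base
    then show ?case using record_pos_0 by simp
  next
    case (step1 l)
    then show ?case using concat_pos_step[of "excursion_at \<eta>" l] record_pos_step[of l] by simp
  next
    case (step2 l)
    then show ?case using concat_pos_step[of "excursion_at \<eta>" "l - 1"] record_pos_step[of "l - 1"] by simp
  qed
  obtain i z where x: "x = concat_pos (excursion_at \<eta>) i + int z" "z \<le> 2 * half_length (excursion_at \<eta> i)"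
    using concat_pos_block by blast
  show "concat_excursions (excursion_at \<eta>) x = \<eta> x"
  proof (cases z)
    case 0
    then show ?thesis using concat_excursions_at[of z "excursion_at \<eta>" i] x not_at_record[of i] pos by simp
  next
    case (Suc z')
    have "x = record_pos \<eta> i + int z' + 1" using x Suc pos by simp
    then have "\<eta> x \<longleftrightarrow> walk \<eta> (record_pos \<eta> i + int z) - walk \<eta> (record_pos \<eta> i + int z') = 1"
      using walk_Suc[of \<eta> "record_pos \<eta> i + int z'"] Suc by (simp add: algebra_simps)
    also have "\<dots> \<longleftrightarrow> excursion_at \<eta> i ! Suc z' - excursion_at \<eta> i ! z' = 1"
      using excursion_at_nth[of z i] excursion_at_nth[of z' i] x Suc by simp
    also have "\<dots> \<longleftrightarrow> ball_config (excursion_at \<eta> i) (int z)"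
      using ball_config_Suc[OF excursion_at_in, of z' i] x Suc by (simp add: add.commute)
    finally show ?thesis using concat_excursions_at[of z "excursion_at \<eta>" i] x by simp
  qed
qed

end

subsection \<open>The soliton decomposition of a concatenation\<close>

text \<open>The number, in the enumeration of all \<open>k\<close>-slots, of the record that opens
  excursion \<open>i\<close>.\<close>

definition slot_offset :: "(int \<Rightarrow> int list) \<Rightarrow> nat \<Rightarrow> int \<Rightarrow> int" where
  "slot_offset \<epsilon> k = partial_sum (\<lambda>i. int (nslots k (\<epsilon> i)))"

lemma slot_offset_0 [simp]: "slot_offset \<epsilon> k 0 = 0"
  by (simp add: slot_offset_def)

lemma slot_offset_step: "slot_offset \<epsilon> k (i + 1) = slot_offset \<epsilon> k i + int (nslots k (\<epsilon> i))"
  by (simp add: slot_offset_def partial_sum_step)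

lemma increasing_enumeration_unique:
  fixes s t :: "int \<Rightarrow> int"
  assumes "strict_mono s" "strict_mono t" "range s = range t" "s 0 = t 0"
  shows "s = t"
proof
  have up: "s (x + 1) \<le> t (x + 1)" if h: "strict_mono s" "strict_mono t" "range s = range t" "s x = t x" for s t :: "int \<Rightarrow> int" and x
  proof -
    obtain y where y: "t (x + 1) = s y" using h(3) by (metis rangeE rangeI)
    have "s x < s y" using strict_monoD[OF h(2), of x "x + 1"] y h(4) by simp
    then have "x + 1 \<le> y" using strict_mono_less[OF h(1)] by simp
    then show ?thesis using y strict_mono_less_eq[OF h(1)] by simp
  qed
  have down: "t (x - 1) \<le> s (x - 1)" if h: "strict_mono s" "strict_mono t" "range s = range t" "s x = t x" for s t :: "int \<Rightarrow> int" and x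
  proof -
    obtain y where y: "t (x - 1) = s y" using h(3) by (metis rangeE rangeI)
    have "s y < s x" using strict_monoD[OF h(2), of "x - 1" x] y h(4) by simp
    then have "y \<le> x - 1" using strict_mono_less[OF h(1)] by simp
    then show ?thesis using y strict_mono_less_eq[OF h(1)] by simp
  qed
  fix x show "s x = t x"
  proof (induction x rule: int_induct[where k = 0])
    case (step1 i)
    then show ?case using up[of s t i] up[of t s i] assms by simp
  next
    case (step2 i)
    then show ?case using down[of s t i] down[of t s i] assms by simp
  qed (use assms in simp)
qed

context
  fixes \<epsilon> :: "int \<Rightarrow> int list" and k :: nat
  assumes exc: "\<And>i. \<epsilon> i \<in> excursions" and k: "1 \<le> k"
begin

lemma one_le_nslots: "1 \<le> int (nslots k (\<epsilon> i))"
  using excursion_slot_facts(2)[OF exc k, of i] by simp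

lemma slot_offset_block:
  obtains i j where "x = slot_offset \<epsilon> k i + int j" "j < nslots k (\<epsilon> i)"
proof -
  obtain i where i: "slot_offset \<epsilon> k i \<le> x" "x < slot_offset \<epsilon> k (i + 1)"
    unfolding slot_offset_def by (rule partial_sum_block[of "\<lambda>i. int (nslots k (\<epsilon> i))" x, OF one_le_nslots])
  then show ?thesis
    using that[of i "nat (x - slot_offset \<epsilon> k i)"] slot_offset_step[of \<epsilon> k i] by auto
qed

lemma slot_offset_block_unique:
  assumes "slot_offset \<epsilon> k i + int j = slot_offset \<epsilon> k i' + int j'" "j < nslots k (\<epsilon> i)" "j' < nslots k (\<epsilon> i')"
  shows "i = i' \<and> j = j'"
proof -
  have "i = i'"
  proof (rule partial_sum_block_unique[of "\<lambda>i. int (nslots k (\<epsilon> i))" i "slot_offset \<epsilon> k i + int j", OF one_le_nslots])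
  qed (use assms slot_offset_step[of \<epsilon> k i] slot_offset_step[of \<epsilon> k i'] in \<open>auto simp flip: slot_offset_def\<close>)
  then show ?thesis using assms by simp
qed

text \<open>The slots of the excursions, one excursion after another, form the increasing
  enumeration. The case \<open>j = nslots k (\<epsilon> i)\<close> is included: by the convention
  for \<open>eslot\<close> it is the next record, which closes the interval of the last
  slot.\<close>

lemma slot_concat:
  assumes "j \<le> nslots k (\<epsilon> i)"
  shows "slot k (concat_excursions \<epsilon>) (slot_offset \<epsilon> k i + int j) = concat_pos \<epsilon> i + eslot k (\<epsilon> i) j"
proof -
  have "\<exists>s. \<forall>x. \<exists>i j. x = slot_offset \<epsilon> k i + int j \<and> j < nslots k (\<epsilon> i) \<and> s x = concat_pos \<epsilon> i + eslot k (\<epsilon> i) j"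
    by (rule choice) (metis slot_offset_block)
  then obtain s where "\<And>x. \<exists>i j. x = slot_offset \<epsilon> k i + int j \<and> j < nslots k (\<epsilon> i) \<and> s x = concat_pos \<epsilon> i + eslot k (\<epsilon> i) j"
    by blast
  then have s0: "s (slot_offset \<epsilon> k i + int j) = concat_pos \<epsilon> i + eslot k (\<epsilon> i) j" if "j < nslots k (\<epsilon> i)" for i j
    using slot_offset_block_unique that by metis
  have s: "s (slot_offset \<epsilon> k i + int j) = concat_pos \<epsilon> i + eslot k (\<epsilon> i) j" if "j \<le> nslots k (\<epsilon> i)" for i j
  proof (cases "j = nslots k (\<epsilon> i)")
    case True
    have "s (slot_offset \<epsilon> k (i + 1) + int 0) = concat_pos \<epsilon> (i + 1) + eslot k (\<epsilon> (i + 1)) 0"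
      using one_le_nslots[of "i + 1"] by (intro s0) simp
    then show ?thesis
      using True slot_offset_step[of \<epsilon> k i] concat_pos_step[of \<epsilon> i] excursion_slot_facts(3)[OF exc k, of "i + 1"]
      by (simp add: eslot_def[of k "\<epsilon> i"])
  qed (use that s0 in simp)
  have mono: "strict_mono s"
  proof (rule strict_mono_int_step)
    fix x
    obtain i j where x: "x = slot_offset \<epsilon> k i + int j" "j < nslots k (\<epsilon> i)" using slot_offset_block by blast
    then have "s x = concat_pos \<epsilon> i + eslot k (\<epsilon> i) j" "s (x + 1) = concat_pos \<epsilon> i + eslot k (\<epsilon> i) (Suc j)"
      using s[of j i] s[of "Suc j" i] by (auto simp: add.assoc add.commute)
    then show "s x < s (x + 1)" using excursion_slot_facts(4)[OF exc k, of j "Suc j" i] x by simp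
  qed
  have slots: "slots k (concat_excursions \<epsilon>) = range s"
  proof (intro equalityI subsetI)
    fix y assume "y \<in> slots k (concat_excursions \<epsilon>)"
    then obtain i z where "z \<in> excursion_slots k (\<epsilon> i)" "y = concat_pos \<epsilon> i + z"
      unfolding slots_def by (auto simp: record_pos_concat[of \<epsilon>, OF exc] excursion_at_concat[of \<epsilon>, OF exc])
    then obtain j where "j < nslots k (\<epsilon> i)" "y = concat_pos \<epsilon> i + eslot k (\<epsilon> i) j"
      using excursion_slot_facts(5)[OF exc k] by auto
    then show "y \<in> range s" using s[of j i] by (metis less_imp_le rangeI)
  next
    fix y assume "y \<in> range s"
    then obtain x where y: "y = s x" by blast
    obtain i j where x: "x = slot_offset \<epsilon> k i + int j" "j < nslots k (\<epsilon> i)" using slot_offset_block by blast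
    then have "y = concat_pos \<epsilon> i + eslot k (\<epsilon> i) j" "eslot k (\<epsilon> i) j \<in> excursion_slots k (\<epsilon> i)"
      using s0 y excursion_slot_facts(5)[OF exc k] by auto
    then show "y \<in> slots k (concat_excursions \<epsilon>)"
      unfolding slots_def by (auto simp: record_pos_concat[of \<epsilon>, OF exc] excursion_at_concat[of \<epsilon>, OF exc])
  qed
  have "s 0 = 0"
    using s[of 0 0] excursion_slot_facts(3)[OF exc k, of 0] by simp
  then have "slot k (concat_excursions \<epsilon>) = s"
    unfolding slot_def slots using mono increasing_enumeration_unique[of _ s]
    by (intro the_equality) auto
  then show ?thesis using s[OF assms] by simp
qed

lemma soliton_decomposition_concat:
  assumes j: "j < nslots k (\<epsilon> i)"
  shows "soliton_decomposition (concat_excursions \<epsilon>) k (slot_offset \<epsilon> k i + int j) = ecount k (\<epsilon> i) j"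
proof -
  let ?\<eta> = "concat_excursions \<epsilon>" and ?h = "2 * int (half_length (\<epsilon> i))"
  let ?E = "{\<gamma> \<in> excursion_solitons k (\<epsilon> i). \<gamma> \<subseteq> {eslot k (\<epsilon> i) j<..<eslot k (\<epsilon> i) (Suc j)}}"
  have s: "slot k ?\<eta> (slot_offset \<epsilon> k i + int j) = concat_pos \<epsilon> i + eslot k (\<epsilon> i) j"
    "slot k ?\<eta> (slot_offset \<epsilon> k i + int j + 1) = concat_pos \<epsilon> i + eslot k (\<epsilon> i) (Suc j)"
    using slot_concat[of j i] slot_concat[of "Suc j" i] j by (auto simp: add.assoc add.commute)
  note f = excursion_slot_facts[OF exc k]
  have "0 \<le> eslot k (\<epsilon> i) j" using f(3)[of i] f(4)[of 0 j i] j by (cases "j = 0") auto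
  moreover have "eslot k (\<epsilon> i) (Suc j) \<le> eslot k (\<epsilon> i) (nslots k (\<epsilon> i))"
    using f(4)[of "Suc j" "nslots k (\<epsilon> i)" i] j by (cases "Suc j = nslots k (\<epsilon> i)") auto
  moreover have "eslot k (\<epsilon> i) (nslots k (\<epsilon> i)) = ?h + 1" by (simp add: eslot_def)
  ultimately have range: "0 \<le> eslot k (\<epsilon> i) j" "eslot k (\<epsilon> i) (Suc j) \<le> ?h + 1" by simp_all
  have shift: "((+) (concat_pos \<epsilon> i)) ` \<gamma> \<subseteq> {concat_pos \<epsilon> i + a<..<concat_pos \<epsilon> i + b} \<longleftrightarrow> \<gamma> \<subseteq> {a<..<b}" for \<gamma> a b
    by auto
  have "{\<gamma> \<in> solitons k ?\<eta>. \<gamma> \<subseteq> {concat_pos \<epsilon> i + eslot k (\<epsilon> i) j<..<concat_pos \<epsilon> i + eslot k (\<epsilon> i) (Suc j)}}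
     = (\<lambda>\<gamma>. (+) (concat_pos \<epsilon> i) ` \<gamma>) ` ?E"
  proof (intro equalityI subsetI)
    fix \<gamma> assume *: "\<gamma> \<in> {\<gamma> \<in> solitons k ?\<eta>. \<gamma> \<subseteq> {concat_pos \<epsilon> i + eslot k (\<epsilon> i) j<..<concat_pos \<epsilon> i + eslot k (\<epsilon> i) (Suc j)}}"
    then obtain i' \<gamma>' where g: "\<gamma>' \<in> excursion_solitons k (\<epsilon> i')" "\<gamma> = (+) (concat_pos \<epsilon> i') ` \<gamma>'"
      unfolding solitons_def by (auto simp: record_pos_concat[of \<epsilon>, OF exc] excursion_at_concat[of \<epsilon>, OF exc])
    \<comment> \<open>A box of the soliton lies inside excursion \<open>i\<close>, and solitons do
      not leave their excursion.\<close>
    obtain z where z: "z \<in> \<gamma>'" "1 \<le> z" "z \<le> 2 * int (half_length (\<epsilon> i'))" using f(7)[OF g(1)] by fastforce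
    then have "concat_pos \<epsilon> i' + z \<in> \<gamma>" using g by blast
    then have "concat_pos \<epsilon> i < concat_pos \<epsilon> i' + z" "concat_pos \<epsilon> i' + z < concat_pos \<epsilon> (i + 1)"
      using * range concat_pos_step[of \<epsilon> i] by fastforce+
    then have "i = i'"
      using z concat_pos_step[of \<epsilon> i'] by (intro concat_pos_block_unique[of \<epsilon> i "concat_pos \<epsilon> i' + z" i']) auto
    then have "\<gamma>' \<in> ?E" using g * shift by simp
    then show "\<gamma> \<in> (\<lambda>\<gamma>. (+) (concat_pos \<epsilon> i) ` \<gamma>) ` ?E" using g(2) \<open>i = i'\<close> by blast
  next
    fix \<gamma> assume "\<gamma> \<in> (\<lambda>\<gamma>. (+) (concat_pos \<epsilon> i) ` \<gamma>) ` ?E"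
    then obtain \<gamma>' where g: "\<gamma>' \<in> ?E" "\<gamma> = (+) (concat_pos \<epsilon> i) ` \<gamma>'" by blast
    then have "\<gamma> \<in> solitons k ?\<eta>"
      unfolding solitons_def by (auto simp: record_pos_concat[of \<epsilon>, OF exc] excursion_at_concat[of \<epsilon>, OF exc])
    then show "\<gamma> \<in> {\<gamma> \<in> solitons k ?\<eta>. \<gamma> \<subseteq> {concat_pos \<epsilon> i + eslot k (\<epsilon> i) j<..<concat_pos \<epsilon> i + eslot k (\<epsilon> i) (Suc j)}}"
      using g shift by simp
  qed
  moreover have "inj_on (\<lambda>\<gamma>. (+) (concat_pos \<epsilon> i) ` \<gamma>) ?E"
    by (rule inj_onI) (simp add: inj_image_eq_iff)
  ultimately show ?thesis
    unfolding soliton_decomposition_def s ecount_def by (simp add: card_image)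
qed

end

text \<open>This says that the concatenation of \<open>\<epsilon>\<close> has decomposition
  \<open>\<zeta>\<close> on all levels from \<open>1\<close> on, expressed excursion by
  excursion.\<close>

definition matches :: "(int \<Rightarrow> int list) \<Rightarrow> (nat \<Rightarrow> int \<Rightarrow> nat) \<Rightarrow> bool" where
  "matches \<epsilon> \<zeta> \<longleftrightarrow> (\<forall>i. \<epsilon> i \<in> excursions) \<and>
     (\<forall>i k j. 1 \<le> k \<longrightarrow> j < nslots k (\<epsilon> i) \<longrightarrow> \<zeta> k (slot_offset \<epsilon> k i + int j) = ecount k (\<epsilon> i) j)"

lemma matches_soliton_decomposition:
  assumes "\<And>i. \<epsilon> i \<in> excursions"
  shows "matches \<epsilon> (soliton_decomposition (concat_excursions \<epsilon>))"
  unfolding matches_def using assms soliton_decomposition_concat by blast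

lemma matches_imp_soliton_decomposition:
  assumes "matches \<epsilon> \<zeta>" "1 \<le> k"
  shows "soliton_decomposition (concat_excursions \<epsilon>) k x = \<zeta> k x"
proof -
  have exc: "\<And>i. \<epsilon> i \<in> excursions" using assms unfolding matches_def by blast
  obtain i j where "x = slot_offset \<epsilon> k i + int j" "j < nslots k (\<epsilon> i)"
    using slot_offset_block[of \<epsilon>, OF exc assms(2)] by blast
  then show ?thesis
    using soliton_decomposition_concat[of \<epsilon>, OF exc assms(2)] assms unfolding matches_def by simp
qed

text \<open>Slots are numbered from record \<open>0\<close>, so the entries that belong to excursion
  \<open>i\<close> can be located once the excursions between \<open>0\<close> and \<open>i\<close>
  are known. Hence the window reaches \<open>0\<close>, and the backward direction identifies the
  excursions one at a time, outward from \<open>0\<close>.\<close>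

lemma matches_window:
  assumes m: "matches \<epsilon> \<zeta>" and x: "\<And>i. x i \<in> excursions" and ab: "a \<le> 0" "0 \<le> b"
  shows "(\<forall>i\<in>{a..<b}. \<epsilon> i = x i) \<longleftrightarrow>
    (\<forall>k\<ge>1. \<forall>i\<in>{a..<b}. \<forall>j<nslots k (x i). \<zeta> k (slot_offset x k i + int j) = ecount k (x i) j)"
    (is "?L \<longleftrightarrow> ?R")
proof
  have exc: "\<And>i. \<epsilon> i \<in> excursions" and
    z: "\<And>i k j. 1 \<le> k \<Longrightarrow> j < nslots k (\<epsilon> i) \<Longrightarrow> \<zeta> k (slot_offset \<epsilon> k i + int j) = ecount k (\<epsilon> i) j"
    using m unfolding matches_def by blast+
  {
    assume L: ?L
    have off: "slot_offset x k i = slot_offset \<epsilon> k i" if "i \<in> {a..<b}" for i k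
      unfolding slot_offset_def using that ab L by (intro partial_sum_cong) auto
    show ?R using off L z by metis
  next
    assume R: ?R
    have up: "\<forall>i\<in>{0..<int n}. \<epsilon> i = x i" if "int n \<le> b" for n
      using that
    proof (induction n)
      case (Suc n)
      then have IH: "\<forall>i\<in>{0..<int n}. \<epsilon> i = x i" by simp
      have off: "slot_offset x k (int n) = slot_offset \<epsilon> k (int n)" for k
        unfolding slot_offset_def using IH by (intro partial_sum_cong) auto
      have "int n \<in> {a..<b}" using Suc.prems ab by auto
      then have "\<epsilon> (int n) = x (int n)"
        using R z off by (intro excursion_determined[OF exc x, where G = "\<lambda>k s j. \<zeta> k (slot_offset \<epsilon> k (int n) + int j)"]) metis+
      moreover have "{0..<int (Suc n)} = insert (int n) {0..<int n}" by auto
      ultimately show ?case using IH by simp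
    qed simp
    have down: "\<forall>i\<in>{- int n..<0}. \<epsilon> i = x i" if "a \<le> - int n" for n
      using that
    proof (induction n)
      case (Suc n)
      then have IH: "\<forall>i\<in>{- int n..<0}. \<epsilon> i = x i" by simp
      let ?i = "- int (Suc n)"
      have i: "?i + 1 = - int n" by simp
      have off: "slot_offset x k (?i + 1) = slot_offset \<epsilon> k (?i + 1)" for k
        unfolding slot_offset_def i using IH by (intro partial_sum_cong) auto
      have mem: "?i \<in> {a..<b}" using Suc.prems ab by auto
      \<comment> \<open>To the left of \<open>0\<close> it is the end of the excursion whose slot
        number is known; an excursion with \<open>s\<close> slots starts \<open>s\<close> places
        earlier.\<close>
      have "\<epsilon> ?i = x ?i"
      proof (rule excursion_determined[OF exc x, where G = "\<lambda>k s j. \<zeta> k (slot_offset \<epsilon> k (?i + 1) - int s + int j)"])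
        show "ecount k (\<epsilon> ?i) j = \<zeta> k (slot_offset \<epsilon> k (?i + 1) - int (nslots k (\<epsilon> ?i)) + int j)"
          if "1 \<le> k" "j < nslots k (\<epsilon> ?i)" for k j
          using z[OF that] slot_offset_step[of \<epsilon> k ?i] by simp
        show "ecount k (x ?i) j = \<zeta> k (slot_offset \<epsilon> k (?i + 1) - int (nslots k (x ?i)) + int j)"
          if "1 \<le> k" "j < nslots k (x ?i)" for k j
        proof -
          have "\<zeta> k (slot_offset x k ?i + int j) = ecount k (x ?i) j" using R mem that by blast
          moreover have "slot_offset x k ?i = slot_offset \<epsilon> k (?i + 1) - int (nslots k (x ?i))"
            using slot_offset_step[of x k ?i] off by simp
          ultimately show ?thesis by simp
        qed
      qed
      moreover have "{?i..<0} = insert ?i {- int n..<0}" by auto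
      ultimately show ?case using IH by simp
    qed simp
    show ?L
    proof
      fix i assume "i \<in> {a..<b}"
      then show "\<epsilon> i = x i"
        using up[of "nat b"] down[of "nat (- a)"] ab by (cases "0 \<le> i") auto
    qed
  }
qed

lemma matches_unique:
  assumes "matches \<epsilon> \<zeta>" "matches \<epsilon>' \<zeta>" shows "\<epsilon> = \<epsilon>'"
proof
  fix i
  have exc: "\<And>i. \<epsilon>' i \<in> excursions" and
    z: "\<And>i k j. 1 \<le> k \<Longrightarrow> j < nslots k (\<epsilon>' i) \<Longrightarrow> \<zeta> k (slot_offset \<epsilon>' k i + int j) = ecount k (\<epsilon>' i) j"
    using assms(2) unfolding matches_def by blast+
  have "\<forall>l\<in>{- \<bar>i\<bar>..<\<bar>i\<bar> + 1}. \<epsilon> l = \<epsilon>' l"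
    using matches_window[OF assms(1) exc, of "- \<bar>i\<bar>" "\<bar>i\<bar> + 1"] z by simp
  moreover have "i \<in> {- \<bar>i\<bar>..<\<bar>i\<bar> + 1}" by (auto simp: abs_if)
  ultimately show "\<epsilon> i = \<epsilon>' i" by blast
qed

text \<open>Excursions are constructed outward from \<open>0\<close>, to the right for
  \<open>b = True\<close> and to the left for \<open>b = False\<close>. The bound in
  \<open>soliton_arrays\<close> concerns one index \<open>j\<close> on all levels; it suffices
  because the excursions built so far have a single slot on every high level.\<close>

lemma exists_matches:
  assumes Z: "\<zeta> \<in> soliton_arrays"
  shows "\<exists>\<epsilon>. matches \<epsilon> \<zeta>"
proof -
  have bdd: "\<exists>K. \<forall>k>K. \<zeta> k j = 0" for j
  proof -
    have "bdd_above {k. 1 \<le> k \<and> 0 < \<zeta> k j}" using Z unfolding soliton_arrays_def mem_Collect_eq by (rule spec)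
    then obtain K where "\<And>k. 1 \<le> k \<Longrightarrow> 0 < \<zeta> k j \<Longrightarrow> k \<le> K" by (auto simp: bdd_above_def)
    then show ?thesis by (intro exI[of _ K]) (metis gr_implies_not0 less_one not_le not_gr_zero)
  qed
  \<comment> \<open>\<open>A k\<close> is the signed number of \<open>k\<close>-slots used so far.
    On all high levels it equals \<open>n\<close> or \<open>- n\<close>, so the entries read there
    share one index.\<close>
  define good where "good b n st = (case st of (A, e) \<Rightarrow> e \<in> excursions \<and> (\<exists>K. \<forall>k>K. A k = (if b then int n else - int n)) \<and> (n = 0 \<longrightarrow> A = (\<lambda>_. 0)) \<and>
     (\<forall>k\<ge>1. \<forall>j<nslots k e. ecount k e j = \<zeta> k (A k + (if b then 0 else - int (nslots k e)) + int j)))"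
    for b :: bool and n :: nat and st :: "(nat \<Rightarrow> int) \<times> int list"
  define succ where "succ b st A' \<longleftrightarrow> (case st of (A, e) \<Rightarrow> \<forall>k. A' k = A k + (if b then 1 else -1) * int (nslots k e))"
    for b :: bool and st :: "(nat \<Rightarrow> int) \<times> int list" and A' :: "nat \<Rightarrow> int"
  have ex: "\<exists>e. good b n (A, e)" if A: "\<exists>K. \<forall>k>K. A k = (if b then int n else - int n)" "n = 0 \<longrightarrow> A = (\<lambda>_. 0)" for b n A
  proof -
    obtain K where K: "\<And>k. K < k \<Longrightarrow> A k = (if b then int n else - int n)" using A by blast
    \<comment> \<open>The index read on high levels, where the excursion is to have one slot:
      \<open>n\<close> to the right, and \<open>- n - 1\<close> to the left, one place before the
      known end.\<close>
    obtain K' where K': "\<And>k. K' < k \<Longrightarrow> \<zeta> k (if b then int n else - int n - 1) = 0"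
      using bdd[of "if b then int n else - int n - 1"] by blast
    obtain e where "e \<in> excursions"
       "\<And>k j. 1 \<le> k \<Longrightarrow> j < nslots k e \<Longrightarrow> ecount k e j = \<zeta> k (A k + (if b then 0 else - int (nslots k e)) + int j)"
    proof (rule excursion_with_counts[of "max K K'" "\<lambda>k s j. \<zeta> k (A k + (if b then 0 else - int s) + int j)"])
      fix k assume "max K K' < k"
      then show "\<zeta> k (A k + (if b then 0 else - int 1) + int 0) = 0" using K[of k] K'[of k] by (cases b) auto
    qed blast
    then show ?thesis using A unfolding good_def by auto
  qed
  have "\<exists>S. \<forall>n. good b n (S n) \<and> succ b (S n) (fst (S (Suc n)))" for b
  proof (rule dependent_nat_choice)
    have "\<exists>e. good b 0 ((\<lambda>_. 0), e)" by (rule ex) simp_all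
    then show "\<exists>st. good b 0 st" by blast
  next
    fix st n assume st: "good b n st"
    obtain A e where ste: "st = (A, e)" by fastforce
    define A' where "A' k = A k + (if b then 1 else -1) * int (nslots k e)" for k
    have e: "e \<in> excursions" using st ste by (simp add: good_def)
    obtain K where K: "\<And>k. K < k \<Longrightarrow> A k = (if b then int n else - int n)" using st unfolding ste good_def by auto
    have "A' k = (if b then int (Suc n) else - int (Suc n))" if "max K (2 * half_length e) < k" for k
      using that K[of k] soliton_number_large(2)[OF e, of k] by (simp add: A'_def)
    then have "\<exists>e'. good b (Suc n) (A', e')" by (intro ex) blast+
    then show "\<exists>st'. good b (Suc n) st' \<and> succ b st (fst st')"
      unfolding ste succ_def A'_def by force
  qed
  then obtain S where S: "\<And>b n. good b n (S b n)" "\<And>b n. succ b (S b n) (fst (S b (Suc n)))"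
    by metis
  define A where "A b n = fst (S b n)" for b n
  define e where "e b n = snd (S b n)" for b n
  have exc: "e b n \<in> excursions" and A0: "A b 0 k = 0"
    and cnt: "1 \<le> k \<Longrightarrow> j < nslots k (e b n) \<Longrightarrow> ecount k (e b n) j = \<zeta> k (A b n k + (if b then 0 else - int (nslots k (e b n))) + int j)" for b n k j
    using S(1)[of b n] S(1)[of b 0] unfolding good_def A_def e_def by (auto simp: case_prod_beta)
  have AS: "A b (Suc n) k = A b n k + (if b then 1 else -1) * int (nslots k (e b n))" for b n k
    using S(2)[of b n] unfolding succ_def A_def e_def by (auto simp: case_prod_beta)
  define \<epsilon> where "\<epsilon> i = (if 0 \<le> i then e True (nat i) else e False (nat (- i - 1)))" for i :: int
  have \<epsilon>R: "\<epsilon> (int n) = e True n" and \<epsilon>L: "\<epsilon> (- 1 - int n) = e False n" for n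
    by (simp_all add: \<epsilon>_def)
  have offR: "slot_offset \<epsilon> k (int n) = A True n k" for n k
  proof (induction n)
    case (Suc n)
    then show ?case using slot_offset_step[of \<epsilon> k "int n"] AS[of True n k] by (simp add: \<epsilon>R add.commute)
  qed (simp add: A0)
  have offL: "slot_offset \<epsilon> k (- int n) = A False n k" for n k
  proof (induction n)
    case (Suc n)
    have "slot_offset \<epsilon> k (- int (Suc n) + 1) = slot_offset \<epsilon> k (- int n)" by simp
    then show ?case using Suc slot_offset_step[of \<epsilon> k "- int (Suc n)"] AS[of False n k] \<epsilon>L[of n] by simp
  qed (simp add: A0)
  have "matches \<epsilon> \<zeta>"
    unfolding matches_def
  proof (intro conjI allI impI)
    show "\<epsilon> i \<in> excursions" for i using exc by (simp add: \<epsilon>_def)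
    fix i :: int and k j :: nat assume k: "1 \<le> k" and j: "j < nslots k (\<epsilon> i)"
    show "\<zeta> k (slot_offset \<epsilon> k i + int j) = ecount k (\<epsilon> i) j"
    proof (cases "0 \<le> i")
      case True
      then obtain n where n: "i = int n" using nonneg_int_cases by blast
      then show ?thesis using offR[of k n] cnt[OF k, of j True n] j \<epsilon>R[of n] by simp
    next
      case False
      define n where "n = nat (- 1 - i)"
      then have i: "i = - 1 - int n" using False by simp
      have "slot_offset \<epsilon> k (i + 1) = A False n k" using offL[of k n] i by simp
      then show ?thesis
        using cnt[OF k, of j False n] j slot_offset_step[of \<epsilon> k i] \<epsilon>L[of n] i by simp
    qed
  qed
  then show ?thesis by blast
qed

lemma inverse_decomposition_eq:
  assumes "matches \<epsilon> \<zeta>" shows "inverse_decomposition \<zeta> = concat_excursions \<epsilon>"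
  unfolding inverse_decomposition_def
proof (rule the_equality)
  have exc: "\<And>i. \<epsilon> i \<in> excursions" using assms unfolding matches_def by blast
  show "concat_excursions \<epsilon> \<in> Omega_hat \<and> (\<forall>k\<ge>1. \<forall>j. soliton_decomposition (concat_excursions \<epsilon>) k j = \<zeta> k j)"
    using concat_in_Omega_hat[of \<epsilon>, OF exc] matches_imp_soliton_decomposition[OF assms] by blast
  fix \<eta> assume \<eta>: "\<eta> \<in> Omega_hat \<and> (\<forall>k\<ge>1. \<forall>j. soliton_decomposition \<eta> k j = \<zeta> k j)"
  have exc': "\<And>i. excursion_at \<eta> i \<in> excursions" using excursion_at_in \<eta> by blast
  have c: "concat_excursions (excursion_at \<eta>) = \<eta>" using concat_excursion_at \<eta> by blast
  have "matches (excursion_at \<eta>) (soliton_decomposition \<eta>)"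
    using matches_soliton_decomposition[of "excursion_at \<eta>", OF exc'] c by simp
  then have "matches (excursion_at \<eta>) \<zeta>" using \<eta> unfolding matches_def by auto
  then show "\<eta> = concat_excursions \<epsilon>" using matches_unique[OF assms] c by metis
qed

subsection \<open>Joint laws\<close>

text \<open>Independence together with prescribed marginals becomes one equation between measures on
  the product, a form that is easily carried through image measures.\<close>

lemma joint_law_iff:
  assumes M: "prob_space M" and I: "I \<noteq> {}" and L: "\<And>i. prob_space (L i)"
    and X: "\<And>i. i \<in> I \<Longrightarrow> X i \<in> M \<rightarrow>\<^sub>M L i"
  shows "distr M (PiM I L) (\<lambda>\<omega>. \<lambda>i\<in>I. X i \<omega>) = PiM I L \<longleftrightarrow>
    prob_space.indep_vars M L X I \<and> (\<forall>i\<in>I. distr M (L i) (X i) = L i)"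
proof -
  interpret M: prob_space M by (rule M)
  interpret L: product_prob_space L I
    by (simp add: L product_prob_space_def product_prob_space_axioms_def product_sigma_finite_def prob_space_imp_sigma_finite)
  have R: "(\<lambda>\<omega>. \<lambda>i\<in>I. X i \<omega>) \<in> M \<rightarrow>\<^sub>M PiM I L" by (intro measurable_restrict X)
  show ?thesis
  proof
    assume eq: "distr M (PiM I L) (\<lambda>\<omega>. \<lambda>i\<in>I. X i \<omega>) = PiM I L"
    have marg: "distr M (L i) (X i) = L i" if "i \<in> I" for i
    proof -
      have "distr M (L i) (X i) = distr (distr M (PiM I L) (\<lambda>\<omega>. \<lambda>i\<in>I. X i \<omega>)) (L i) (\<lambda>f. f i)"
        using that by (subst distr_distr[OF _ R]) (auto simp: comp_def)
      also have "\<dots> = L i" unfolding eq using that by (rule L.PiM_component)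
      finally show ?thesis .
    qed
    have "PiM I L = PiM I (\<lambda>i. distr M (L i) (X i))" by (intro PiM_cong) (simp_all add: marg)
    then show "M.indep_vars L X I \<and> (\<forall>i\<in>I. distr M (L i) (X i) = L i)"
      using M.indep_vars_iff_distr_eq_PiM'[of I X L, OF I X] eq marg by simp
  next
    assume *: "M.indep_vars L X I \<and> (\<forall>i\<in>I. distr M (L i) (X i) = L i)"
    have "PiM I L = PiM I (\<lambda>i. distr M (L i) (X i))" by (intro PiM_cong) (simp_all add: *)
    then show "distr M (PiM I L) (\<lambda>\<omega>. \<lambda>i\<in>I. X i \<omega>) = PiM I L"
      using M.indep_vars_iff_distr_eq_PiM'[of I X L, OF I X] * by simp
  qed
qed

lemma (in prob_space) indep_vars_sets_cong:
  assumes "\<And>i. i \<in> I \<Longrightarrow> sets (A i) = sets (B i)"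
  shows "indep_vars A X I \<longleftrightarrow> indep_vars B X I"
proof -
  have "indep_sets (\<lambda>i. {X i -` S \<inter> space M |S. S \<in> sets (A i)}) I \<longleftrightarrow>
      indep_sets (\<lambda>i. {X i -` S \<inter> space M |S. S \<in> sets (B i)}) I"
    using assms by (intro indep_sets_cong) auto
  moreover have "(\<forall>i\<in>I. random_variable (A i) (X i)) \<longleftrightarrow> (\<forall>i\<in>I. random_variable (B i) (X i))"
    using measurable_cong_sets[OF refl assms] by blast
  ultimately show ?thesis unfolding indep_vars_def2 by blast
qed

section \<open>Geometric arrays as product measures\<close>

definition geometric_law :: "(nat \<Rightarrow> real) \<Rightarrow> nat \<times> int \<Rightarrow> nat measure" where
  "geometric_law p = (\<lambda>(k, j). measure_pmf (geometric_pmf (p k)))"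

abbreviation array_index :: "(nat \<times> int) set" where
  "array_index \<equiv> {1..} \<times> UNIV"

lemma prob_space_geometric_law: "prob_space (geometric_law p i)"
  by (simp add: geometric_law_def case_prod_beta measure_pmf.prob_space_axioms)

lemma sets_geometric_law: "sets (geometric_law p i) = UNIV"
  by (simp add: geometric_law_def case_prod_beta)

lemma measurable_geometric_law: "M \<rightarrow>\<^sub>M geometric_law p i = M \<rightarrow>\<^sub>M count_space UNIV"
  by (rule measurable_cong_sets) (simp_all add: sets_geometric_law)

lemma independent_geometric_array_iff:
  assumes p: "\<And>k. 1 \<le> k \<Longrightarrow> p k \<in> {0<..1}"
  shows "independent_geometric_array M \<zeta> p \<longleftrightarrow> prob_space M \<and>
    (\<forall>k\<ge>1. \<forall>j. \<zeta> k j \<in> M \<rightarrow>\<^sub>M count_space UNIV) \<and>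
    distr M (PiM array_index (geometric_law p)) (\<lambda>\<omega>. \<lambda>i\<in>array_index. (case i of (k, j) \<Rightarrow> \<zeta> k j) \<omega>) =
      PiM array_index (geometric_law p)"
proof (cases "prob_space M \<and> (\<forall>k\<ge>1. \<forall>j. \<zeta> k j \<in> M \<rightarrow>\<^sub>M count_space UNIV)")
  case True
  then interpret M: prob_space M by blast
  have X: "(case i of (k, j) \<Rightarrow> \<zeta> k j) \<in> M \<rightarrow>\<^sub>M geometric_law p i" if "i \<in> array_index" for i
    using True that by (auto simp: measurable_geometric_law)
  have "M.indep_vars (geometric_law p) (\<lambda>(k, j). \<zeta> k j) array_index \<longleftrightarrow>
      M.indep_vars (\<lambda>_. count_space UNIV) (\<lambda>(k, j). \<zeta> k j) array_index"
    by (rule M.indep_vars_sets_cong) (simp add: sets_geometric_law)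
  moreover have "(\<forall>i\<in>array_index. distr M (geometric_law p i) (case i of (k, j) \<Rightarrow> \<zeta> k j) = geometric_law p i) \<longleftrightarrow>
      (\<forall>k\<ge>1. \<forall>j. has_law M (\<zeta> k j) (measure_pmf (geometric_pmf (p k))))"
    using True by (auto simp: has_law_def geometric_law_def)
  moreover have "distr M (PiM array_index (geometric_law p)) (\<lambda>\<omega>. \<lambda>i\<in>array_index. (case i of (k, j) \<Rightarrow> \<zeta> k j) \<omega>) =
      PiM array_index (geometric_law p) \<longleftrightarrow> M.indep_vars (geometric_law p) (\<lambda>(k, j). \<zeta> k j) array_index \<and>
      (\<forall>i\<in>array_index. distr M (geometric_law p i) (case i of (k, j) \<Rightarrow> \<zeta> k j) = geometric_law p i)"
    by (rule joint_law_iff) (use X prob_space_geometric_law M.prob_space_axioms in auto)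
  ultimately show ?thesis
    unfolding independent_geometric_array_def using True p by blast
next
  case False
  then show ?thesis unfolding independent_geometric_array_def has_law_def by force
qed

lemma distr_restrict_full:
  assumes S: "S \<in> sets N" "emeasure N (space N - S) = 0" and X: "X \<in> N \<rightarrow>\<^sub>M P"
  shows "distr (restrict_space N S) P X = distr N P X"
proof (rule measure_eqI)
  have X': "X \<in> restrict_space N S \<rightarrow>\<^sub>M P" using X by (rule measurable_restrict_space1)
  have SN: "S \<inter> space N = S" using S(1) sets.sets_into_space by blast
  fix A assume "A \<in> sets (distr (restrict_space N S) P X)"
  then have A: "A \<in> sets P" by simp
  have pre: "X -` A \<inter> space N \<in> sets N" using X A by (rule measurable_sets)
  have "emeasure (distr (restrict_space N S) P X) A = emeasure N (X -` A \<inter> S)"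
    using A X' S SN by (simp add: emeasure_distr emeasure_restrict_space space_restrict_space)
  also have "\<dots> = emeasure N (X -` A \<inter> space N)"
  proof (rule emeasure_eq_AE)
    show "AE x in N. (x \<in> X -` A \<inter> S) = (x \<in> X -` A \<inter> space N)"
      using S by (intro AE_I[of _ _ "space N - S"]) auto
    have "X -` A \<inter> S = (X -` A \<inter> space N) \<inter> S" using SN by blast
    then show "X -` A \<inter> S \<in> sets N" using pre S(1) by auto
  qed (rule pre)
  finally show "emeasure (distr (restrict_space N S) P X) A = emeasure (distr N P X) A"
    using A X by (simp add: emeasure_distr)
qed simp

text \<open>The inverse decomposition is considered on an event of probability \<open>1\<close>;
  restricting to it leaves the joint law of the array unchanged.\<close>

lemma independent_geometric_array_restrict:
  assumes N: "independent_geometric_array N \<zeta> p" and S: "S \<in> sets N" "measure N S = 1"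
  shows "independent_geometric_array (restrict_space N S) \<zeta> p"
proof -
  interpret N: prob_space N using N unfolding independent_geometric_array_def by blast
  have p: "p k \<in> {0<..1}" if "1 \<le> k" for k using N that unfolding independent_geometric_array_def by blast
  have null: "emeasure N (space N - S) = 0"
    using S by (simp add: N.emeasure_eq_measure N.prob_compl)
  have "emeasure (restrict_space N S) (space (restrict_space N S)) = 1"
    using S sets.sets_into_space[OF S(1)] by (simp add: emeasure_restrict_space space_restrict_space Int_absorb2 N.emeasure_eq_measure)
  then have ps: "prob_space (restrict_space N S)" by (rule prob_spaceI)
  note iff = independent_geometric_array_iff[of p _ \<zeta>]
  have z: "\<forall>k\<ge>1. \<forall>j. \<zeta> k j \<in> N \<rightarrow>\<^sub>M count_space UNIV"
    and d: "distr N (PiM array_index (geometric_law p)) (\<lambda>\<omega>. \<lambda>i\<in>array_index. (case i of (k, j) \<Rightarrow> \<zeta> k j) \<omega>) =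
      PiM array_index (geometric_law p)"
    using N iff[of N] p by blast+
  have R: "(\<lambda>\<omega>. \<lambda>i\<in>array_index. (case i of (k, j) \<Rightarrow> \<zeta> k j) \<omega>) \<in> N \<rightarrow>\<^sub>M PiM array_index (geometric_law p)"
    using z by (intro measurable_restrict) (auto simp: measurable_geometric_law)
  have "\<zeta> k j \<in> restrict_space N S \<rightarrow>\<^sub>M count_space UNIV" if "1 \<le> k" for k j
    using z that by (intro measurable_restrict_space1) blast
  then show ?thesis
    using iff[of "restrict_space N S"] p ps d distr_restrict_full[OF S(1) null R] by simp
qed

lemma exists_geometric_array:
  assumes p: "\<And>k. 1 \<le> k \<Longrightarrow> p k \<in> {0<..1}"
  shows "independent_geometric_array (PiM array_index (geometric_law p)) (\<lambda>k j \<omega>. \<omega> (k, j)) p"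
proof -
  have "distr (PiM array_index (geometric_law p)) (PiM array_index (geometric_law p))
     (\<lambda>\<omega>. \<lambda>i\<in>array_index. (case i of (k, j) \<Rightarrow> \<lambda>\<omega>. \<omega> (k, j)) \<omega>) =
     distr (PiM array_index (geometric_law p)) (PiM array_index (geometric_law p)) (\<lambda>\<omega>. \<omega>)"
    by (rule distr_cong) (auto simp: space_PiM PiE_def extensional_def fun_eq_iff)
  moreover have "(\<lambda>\<omega>. \<omega> (k, j)) \<in> PiM array_index (geometric_law p) \<rightarrow>\<^sub>M count_space UNIV" if "1 \<le> k" for k j
    using measurable_component_singleton[of "(k, j)" array_index "geometric_law p"] that
    by (simp add: measurable_geometric_law)
  moreover have "prob_space (PiM array_index (geometric_law p))"
    by (intro prob_space_PiM prob_space_geometric_law)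
  ultimately show ?thesis
    using independent_geometric_array_iff[of p "PiM array_index (geometric_law p)" "\<lambda>k j \<omega>. \<omega> (k, j)"] p
    by (simp add: distr_id)
qed

text \<open>With countable quantifiers only, the event becomes measurable; the shift by
  \<open>Suc\<close> lets Borel-Cantelli run over all naturals while leaving out level
  \<open>0\<close>.\<close>

lemma soliton_arrays_iff:
  "\<zeta> \<in> soliton_arrays \<longleftrightarrow> (\<forall>j. \<exists>K. \<forall>k\<ge>K. \<zeta> (Suc k) j = 0)"
proof -
  have "bdd_above {k. 1 \<le> k \<and> 0 < \<zeta> k j} \<longleftrightarrow> (\<exists>K. \<forall>k\<ge>K. \<zeta> (Suc k) j = 0)" for j
  proof
    assume "bdd_above {k. 1 \<le> k \<and> 0 < \<zeta> k j}"
    then obtain K where "\<And>k. 1 \<le> k \<Longrightarrow> 0 < \<zeta> k j \<Longrightarrow> k \<le> K" by (auto simp: bdd_above_def)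
    then show "\<exists>K. \<forall>k\<ge>K. \<zeta> (Suc k) j = 0" by (intro exI[of _ K]) force
  next
    assume "\<exists>K. \<forall>k\<ge>K. \<zeta> (Suc k) j = 0"
    then obtain K where K: "\<And>k. K \<le> k \<Longrightarrow> \<zeta> (Suc k) j = 0" by blast
    have "k \<le> K" if "1 \<le> k" "0 < \<zeta> k j" for k using K[of "k - 1"] that by (cases "K \<le> k - 1") auto
    then show "bdd_above {k. 1 \<le> k \<and> 0 < \<zeta> k j}" by (auto simp: bdd_above_def)
  qed
  then show ?thesis unfolding soliton_arrays_def by simp
qed

text \<open>An entry at level \<open>k\<close> is nonzero with probability \<open>q k\<close>, which
  is summable; so Borel-Cantelli applies to each of the countably many \<open>j\<close>.\<close>

lemma soliton_arrays_almost_surely: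
  assumes N: "independent_geometric_array N \<zeta> (\<lambda>k. 1 - q k)" and q: "q \<in> param_Q"
  defines "S \<equiv> {\<omega> \<in> space N. (\<lambda>k j. \<zeta> k j \<omega>) \<in> soliton_arrays}"
  shows "S \<in> sets N" "measure N S = 1"
proof -
  interpret N: prob_space N using N unfolding independent_geometric_array_def by blast
  have rv[measurable]: "\<zeta> (Suc k) j \<in> N \<rightarrow>\<^sub>M count_space UNIV" for k j
    using N unfolding independent_geometric_array_def has_law_def by simp
  show S: "S \<in> sets N" unfolding S_def soliton_arrays_iff by measurable
  have pr: "measure N {\<omega> \<in> space N. \<zeta> (Suc k) j \<omega> \<noteq> 0} = q (Suc k)" for k j
  proof -
    have "measure N {\<omega> \<in> space N. \<zeta> (Suc k) j \<omega> = 0} = measure (distr N (count_space UNIV) (\<zeta> (Suc k) j)) {0}"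
      by (subst measure_distr) (auto intro!: arg_cong[where f = "measure N"])
    also have "distr N (count_space UNIV) (\<zeta> (Suc k) j) = distr N (measure_pmf (geometric_pmf (1 - q (Suc k)))) (\<zeta> (Suc k) j)"
      by (rule distr_cong) auto
    also have "\<dots> = measure_pmf (geometric_pmf (1 - q (Suc k)))"
      using N unfolding independent_geometric_array_def has_law_def by simp
    also have "measure \<dots> {0} = 1 - q (Suc k)"
      using q by (simp add: measure_pmf_single pmf_geometric param_Q_def)
    finally show ?thesis using N.prob_neg[of "\<lambda>\<omega>. \<zeta> (Suc k) j \<omega> = 0"] by simp
  qed
  have "AE \<omega> in N. \<forall>\<^sub>F k in sequentially. \<omega> \<in> space N - {\<omega> \<in> space N. \<zeta> (Suc k) j \<omega> \<noteq> 0}" for j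
    by (rule borel_cantelli_AE1) (use q in \<open>simp_all only: pr param_Q_def N.emeasure_eq_measure, auto\<close>)
  then have "AE \<omega> in N. \<exists>K. \<forall>k\<ge>K. \<zeta> (Suc k) j \<omega> = 0" for j
    by (rule AE_mp) (rule AE_I2, auto simp: eventually_sequentially)
  then have "AE \<omega> in N. \<forall>j. \<exists>K. \<forall>k\<ge>K. \<zeta> (Suc k) j \<omega> = 0"
    unfolding AE_all_countable by blast
  then have "AE \<omega> in N. \<omega> \<in> S" by (rule AE_mp) (auto intro!: AE_I2 simp: S_def soliton_arrays_iff)
  then show "measure N S = 1" using S N.prob_eq_1 by blast
qed

subsection \<open>The law of the excursions\<close>

text \<open>For a geometric array this is the probability that the entries at slot \<open>0\<close>
  vanish on the levels up to \<open>K\<close>; its limit is the probability of the empty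
  excursion.\<close>

definition survival :: "(nat \<Rightarrow> real) \<Rightarrow> nat \<Rightarrow> real" where
  "survival q K = (\<Prod>k\<in>{1..K}. 1 - q k)"

lemma excursion_weight_eq:
  assumes e: "e \<in> excursions" and K: "2 * half_length e \<le> K"
  shows "excursion_weight \<alpha> e = (\<Prod>k\<in>{1..K}. \<alpha> k ^ soliton_number k e)"
proof -
  have "excursion_weight \<alpha> e = (\<Prod>k\<in>{..<K}. \<alpha> (Suc k) ^ soliton_number (Suc k) e)"
    unfolding excursion_weight_def by (rule prodinf_finite) (use soliton_number_large(1)[OF e] K in auto)
  then show ?thesis by (simp add: prod.atLeast1_atMost_eq)
qed

text \<open>One slot per level gives \<open>survival q K\<close>. The other slots are created by
  larger solitons, \<open>2 * (m - k)\<close> of them on level \<open>k\<close> by each soliton of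
  size \<open>m\<close>; regrouping their factors \<open>1 - q k\<close> by soliton turns
  \<open>q m\<close> into \<open>alpha_of q m\<close>.\<close>

lemma slot_weight:
  assumes e: "e \<in> excursions" and K: "2 * half_length e \<le> K"
  shows "(\<Prod>k\<in>{1..K}. (1 - q k) ^ nslots k e * q k ^ soliton_number k e) =
    survival q K * excursion_weight (alpha_of q) e"
proof -
  let ?n = "\<lambda>k. soliton_number k e"
  have "(\<Prod>k\<in>{1..K}. \<Prod>l\<in>{1..<k}. (1 - q l) ^ (2 * (k - l) * ?n k)) =
      (\<Prod>k\<in>{1..K}. \<Prod>l\<in>{l\<in>{1..K}. l < k}. (1 - q l) ^ (2 * (k - l) * ?n k))"
    by (intro prod.cong) auto
  also have "\<dots> = (\<Prod>l\<in>{1..K}. \<Prod>k\<in>{k\<in>{1..K}. l < k}. (1 - q l) ^ (2 * (k - l) * ?n k))"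
    by (rule prod.swap_restrict) auto
  also have "\<dots> = (\<Prod>l\<in>{1..K}. (1 - q l) ^ (nslots l e - 1))"
  proof (rule prod.cong[OF refl])
    fix l assume l: "l \<in> {1..K}"
    then have "{k\<in>{1..K}. l < k} = {l<..<Suc K}" by auto
    moreover have "nslots l e - 1 = (\<Sum>k\<in>{l<..<Suc K}. 2 * (k - l) * ?n k)"
      using nslots_formula[OF e, of l "Suc K"] l K by simp
    ultimately show "(\<Prod>k\<in>{k\<in>{1..K}. l < k}. (1 - q l) ^ (2 * (k - l) * ?n k)) = (1 - q l) ^ (nslots l e - 1)"
      by (simp add: power_sum)
  qed
  finally have swap: "(\<Prod>k\<in>{1..K}. \<Prod>l\<in>{1..<k}. (1 - q l) ^ (2 * (k - l) * ?n k)) =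
     (\<Prod>l\<in>{1..K}. (1 - q l) ^ (nslots l e - 1))" .
  have "excursion_weight (alpha_of q) e =
      (\<Prod>k\<in>{1..K}. q k ^ ?n k * (\<Prod>l\<in>{1..<k}. (1 - q l) ^ (2 * (k - l) * ?n k)))"
    unfolding excursion_weight_eq[OF e K] alpha_of_def
    by (simp add: power_mult_distrib prod_power_distrib power_mult)
  also have "\<dots> = (\<Prod>k\<in>{1..K}. q k ^ ?n k) * (\<Prod>l\<in>{1..K}. (1 - q l) ^ (nslots l e - 1))"
    unfolding prod.distrib swap ..
  finally have "survival q K * excursion_weight (alpha_of q) e =
      (\<Prod>k\<in>{1..K}. (1 - q k) * (q k ^ ?n k * (1 - q k) ^ (nslots k e - 1)))"
    unfolding survival_def by (simp add: prod.distrib)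
  also have "\<dots> = (\<Prod>k\<in>{1..K}. (1 - q k) ^ nslots k e * q k ^ ?n k)"
  proof (rule prod.cong[OF refl])
    fix k assume "k \<in> {1..K}"
    then have "nslots k e = Suc (nslots k e - 1)" using excursion_slot_facts(2)[OF e, of k] by simp
    then have "(1 - q k) ^ nslots k e = (1 - q k) * (1 - q k) ^ (nslots k e - 1)" by (metis power_Suc)
    then show "(1 - q k) * (q k ^ ?n k * (1 - q k) ^ (nslots k e - 1)) = (1 - q k) ^ nslots k e * q k ^ ?n k"
      by simp
  qed
  finally show ?thesis by simp
qed

lemma slot_offset_mono:
  assumes "\<And>i. \<epsilon> i \<in> excursions" "1 \<le> k" "i \<le> j" shows "slot_offset \<epsilon> k i \<le> slot_offset \<epsilon> k j"
  using strict_mono_partial_sum[of "\<lambda>i. int (nslots k (\<epsilon> i))"] one_le_nslots[of \<epsilon>, OF assms(1,2)] assms(3)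
  unfolding slot_offset_def by (simp add: strict_mono_less_eq)

lemma prod_over_slots:
  fixes g :: "nat \<Rightarrow> real"
  assumes x: "\<And>i. x i \<in> excursions" and k: "1 \<le> k" and ab: "a \<le> b"
  shows "(\<Prod>u\<in>{slot_offset x k a..<slot_offset x k b}. g (soliton_decomposition (concat_excursions x) k u)) =
    (\<Prod>i\<in>{a..<b}. \<Prod>j<nslots k (x i). g (ecount k (x i) j))"
  using ab
proof (induction b rule: int_ge_induct)
  case (step b)
  let ?f = "\<lambda>u. g (soliton_decomposition (concat_excursions x) k u)"
  have "{slot_offset x k a..<slot_offset x k (b + 1)} =
      {slot_offset x k a..<slot_offset x k b} \<union> {slot_offset x k b..<slot_offset x k b + int (nslots k (x b))}"
    using slot_offset_mono[of x k a b, OF x k step.hyps] slot_offset_step[of x k b] by auto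
  then have "(\<Prod>u\<in>{slot_offset x k a..<slot_offset x k (b + 1)}. ?f u) =
     (\<Prod>u\<in>{slot_offset x k a..<slot_offset x k b}. ?f u) *
     (\<Prod>u\<in>{slot_offset x k b..<slot_offset x k b + int (nslots k (x b))}. ?f u)"
    by (simp add: prod.union_disjoint ivl_disj_int)
  also have "(\<Prod>u\<in>{slot_offset x k b..<slot_offset x k b + int (nslots k (x b))}. ?f u) =
      (\<Prod>j<nslots k (x b). g (ecount k (x b) j))"
  proof (rule prod.reindex_bij_witness[of _ "\<lambda>j. slot_offset x k b + int j" "\<lambda>u. nat (u - slot_offset x k b)"])
    fix u assume "u \<in> {slot_offset x k b..<slot_offset x k b + int (nslots k (x b))}"
    then show "g (ecount k (x b) (nat (u - slot_offset x k b))) = ?f u"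
      using soliton_decomposition_concat[of x k "nat (u - slot_offset x k b)" b, OF x k] by auto
  qed auto
  also have "{a..<b + 1} = insert b {a..<b}" using step.hyps by auto
  ultimately show ?case using step.IH by (simp add: mult.commute)
qed simp

lemma empty_excursion: "[0] \<in> excursions"
  by (simp add: excursions_def)

text \<open>The products decrease and stay nonnegative. That \<open>C\<close> is positive comes out
  later, when \<open>C\<close> times the partition function turns out to be
  \<open>1\<close>.\<close>

lemma survival_limit:
  assumes q: "q \<in> param_Q" obtains C where "survival q \<longlonglongrightarrow> C" "0 \<le> C"
proof -
  have q': "0 \<le> 1 - q k" "1 - q k \<le> 1" if "1 \<le> k" for k using q that unfolding param_Q_def by (auto simp: less_imp_le)
  have pos: "0 \<le> survival q K" for K unfolding survival_def by (rule prod_nonneg) (use q' in auto)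
  have "survival q (Suc K) \<le> survival q K" for K
  proof -
    have "survival q (Suc K) = survival q K * (1 - q (Suc K))" by (simp add: survival_def mult.commute)
    then show ?thesis using pos[of K] q'[of "Suc K"] by (simp add: mult_left_le)
  qed
  then have "decseq (survival q)" by (rule decseq_SucI)
  then obtain C where C: "survival q \<longlonglongrightarrow> C" using pos decseq_convergent[of "survival q" 0] by blast
  moreover have "0 \<le> C" using C pos by (intro LIMSEQ_le_const) auto
  ultimately show ?thesis using that by blast
qed

text \<open>\<open>E\<close> may be any family of excursions that matches the array; its
  measurability is derived from the window events.\<close>

context
  fixes N :: "'b measure" and \<zeta> :: "nat \<Rightarrow> int \<Rightarrow> 'b \<Rightarrow> nat" and q :: "nat \<Rightarrow> real" and E :: "int \<Rightarrow> 'b \<Rightarrow> int list"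
    and C :: real
  assumes N: "independent_geometric_array N \<zeta> (\<lambda>k. 1 - q k)" and q: "q \<in> param_Q"
    and E: "\<And>\<omega>. \<omega> \<in> space N \<Longrightarrow> matches (\<lambda>i. E i \<omega>) (\<lambda>k j. \<zeta> k j \<omega>)"
    and C: "survival q \<longlonglongrightarrow> C" "0 \<le> C"
begin

interpretation N: prob_space N using N unfolding independent_geometric_array_def by blast

lemma geometric_rv [measurable]: "1 \<le> k \<Longrightarrow> \<zeta> k j \<in> N \<rightarrow>\<^sub>M count_space UNIV"
  using N unfolding independent_geometric_array_def has_law_def by simp

lemma geometric_prob:
  assumes k: "1 \<le> k" shows "N.prob (\<zeta> k j -` {n} \<inter> space N) = (1 - q k) * q k ^ n"
proof -
  have "N.prob (\<zeta> k j -` {n} \<inter> space N) = measure (distr N (count_space UNIV) (\<zeta> k j)) {n}"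
    using geometric_rv[OF k] by (subst measure_distr) auto
  also have "distr N (count_space UNIV) (\<zeta> k j) = distr N (measure_pmf (geometric_pmf (1 - q k))) (\<zeta> k j)"
    by (rule distr_cong) auto
  also have "\<dots> = measure_pmf (geometric_pmf (1 - q k))"
    using N k unfolding independent_geometric_array_def has_law_def by simp
  also have "measure \<dots> {n} = (1 - q k) * q k ^ n"
    using q k by (simp add: measure_pmf_single pmf_geometric param_Q_def)
  finally show ?thesis .
qed

text \<open>The event prescribes entries on infinitely many levels. Cut off at a large level
  \<open>K\<close>, it is a finite product of geometric probabilities, equal to
  \<open>survival q K\<close> times the weight for each excursion; then \<open>K\<close> tends to
  infinity along decreasing events.\<close>

lemma window_event:
  fixes x :: "int \<Rightarrow> int list"
  assumes x: "\<And>i. x i \<in> excursions" and ab: "a \<le> 0" "0 \<le> b" "a < b"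
  shows "{\<omega> \<in> space N. \<forall>i\<in>{a..<b}. E i \<omega> = x i} \<in> sets N"
    "N.prob {\<omega> \<in> space N. \<forall>i\<in>{a..<b}. E i \<omega> = x i} =
      (\<Prod>i\<in>{a..<b}. C * excursion_weight (alpha_of q) (x i))"
proof -
  define y where "y = soliton_decomposition (concat_excursions x)"
  define J where "J k = {slot_offset x k a..<slot_offset x k b}" for k
  define F where "F K = {\<omega> \<in> space N. \<forall>k\<in>{1..K}. \<forall>u\<in>J k. \<zeta> k u \<omega> = y k u}" for K
  have F[measurable]: "F K \<in> sets N" for K
    unfolding F_def J_def by (intro sets.sets_Collect_finite_All' sets.sets_Collect_finite_All) auto
  \<comment> \<open>The slots of the excursions in the window fill the interval \<open>J k\<close>
    without gaps.\<close>
  have blocks: "(\<forall>i\<in>{a..<b}. \<forall>j<nslots k (x i). P (slot_offset x k i + int j)) \<longleftrightarrow> (\<forall>u\<in>J k. P u)"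
    if k: "1 \<le> k" for k P
  proof (intro iffI ballI allI impI)
    fix u assume *: "\<forall>i\<in>{a..<b}. \<forall>j<nslots k (x i). P (slot_offset x k i + int j)" "u \<in> J k"
    obtain i j where u: "u = slot_offset x k i + int j" "j < nslots k (x i)"
      using slot_offset_block[of x, OF x k] by blast
    have "\<not> i < a" using *(2) u slot_offset_mono[of x k "i + 1" a, OF x k] slot_offset_step[of x k i]
      by (auto simp: J_def)
    moreover have "\<not> b \<le> i" using *(2) u slot_offset_mono[of x k b i, OF x k] by (auto simp: J_def)
    ultimately show "P u" using * u by simp
  next
    fix i j assume *: "\<forall>u\<in>J k. P u" "i \<in> {a..<b}" "j < nslots k (x i)"
    then show "P (slot_offset x k i + int j)"
      using slot_offset_mono[of x k a i, OF x k] slot_offset_mono[of x k "i + 1" b, OF x k] slot_offset_step[of x k i]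
      by (auto simp: J_def)
  qed
  have ev: "{\<omega> \<in> space N. \<forall>i\<in>{a..<b}. E i \<omega> = x i} = (\<Inter>K. F K)"
  proof -
    have "(\<forall>i\<in>{a..<b}. E i \<omega> = x i) \<longleftrightarrow> (\<forall>K. \<omega> \<in> F K)" if w: "\<omega> \<in> space N" for \<omega>
    proof -
      have "(\<forall>i\<in>{a..<b}. E i \<omega> = x i) \<longleftrightarrow>
        (\<forall>k\<ge>1. \<forall>i\<in>{a..<b}. \<forall>j<nslots k (x i). \<zeta> k (slot_offset x k i + int j) \<omega> = y k (slot_offset x k i + int j))"
        unfolding y_def using matches_window[OF E[OF w] x ab(1,2)] soliton_decomposition_concat[of x, OF x] by simp
      also have "\<dots> \<longleftrightarrow> (\<forall>k\<ge>1. \<forall>u\<in>J k. \<zeta> k u \<omega> = y k u)" by (intro all_cong blocks)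
      also have "\<dots> \<longleftrightarrow> (\<forall>K. \<omega> \<in> F K)" using w unfolding F_def by fastforce
      finally show ?thesis .
    qed
    then show ?thesis unfolding F_def by auto
  qed
  show "{\<omega> \<in> space N. \<forall>i\<in>{a..<b}. E i \<omega> = x i} \<in> sets N" unfolding ev by auto
  \<comment> \<open>This exceeds all soliton sizes in the window; \<open>Suc\<close> ensures
    \<open>1 \<le> K\<close>, so that the index set of the product is nonempty.\<close>
  define K0 where "K0 = Suc (\<Sum>i\<in>{a..<b}. 2 * half_length (x i))"
  have K0: "2 * half_length (x i) \<le> K" if "K0 \<le> K" "i \<in> {a..<b}" for i K
    using that member_le_sum[of i "{a..<b}" "\<lambda>i. 2 * half_length (x i)"] by (simp add: K0_def)
  have prF: "N.prob (F K) = (\<Prod>i\<in>{a..<b}. survival q K * excursion_weight (alpha_of q) (x i))" if K: "K0 \<le> K" for K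
  proof -
    let ?I = "Sigma {1..K} J"
    have fin: "finite ?I" by (auto simp: J_def)
    have "slot_offset x 1 a < slot_offset x 1 b"
      using slot_offset_mono[of x 1 "a + 1" b, OF x] ab slot_offset_step[of x 1 a] one_le_nslots[of x 1 a, OF x] by simp
    moreover have "1 \<le> K" using K by (simp add: K0_def)
    ultimately have ne: "?I \<noteq> {}" by (force simp: J_def)
    have iv: "N.indep_vars (\<lambda>_. count_space UNIV) (\<lambda>(k, j). \<zeta> k j) ({1..} \<times> UNIV)"
      using N unfolding independent_geometric_array_def by blast
    have "F K = (\<Inter>p\<in>?I. (case p of (k, j) \<Rightarrow> \<zeta> k j) -` {case p of (k, u) \<Rightarrow> y k u} \<inter> space N)"
      using ne unfolding F_def by auto
    then have "N.prob (F K) = (\<Prod>p\<in>?I. N.prob ((case p of (k, j) \<Rightarrow> \<zeta> k j) -` {case p of (k, u) \<Rightarrow> y k u} \<inter> space N))"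
      by (simp only:) (rule N.indep_varsD[OF iv ne fin], auto)
    also have "\<dots> = (\<Prod>p\<in>?I. (1 - q (fst p)) * q (fst p) ^ (y (fst p) (snd p)))"
      by (intro prod.cong) (auto simp: geometric_prob)
    also have "\<dots> = (\<Prod>k\<in>{1..K}. \<Prod>u\<in>J k. (1 - q k) * q k ^ y k u)"
      by (subst prod.Sigma) (auto simp: J_def case_prod_beta)
    also have "\<dots> = (\<Prod>k\<in>{1..K}. \<Prod>i\<in>{a..<b}. \<Prod>j<nslots k (x i). (1 - q k) * q k ^ ecount k (x i) j)"
      unfolding J_def y_def using prod_over_slots[of x _ a b] x ab by (intro prod.cong[OF refl]) auto
    also have "\<dots> = (\<Prod>k\<in>{1..K}. \<Prod>i\<in>{a..<b}. (1 - q k) ^ nslots k (x i) * q k ^ soliton_number k (x i))"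
      using excursion_slot_facts(6)[OF x] by (intro prod.cong[OF refl]) (simp add: prod.distrib power_sum)
    also have "\<dots> = (\<Prod>i\<in>{a..<b}. \<Prod>k\<in>{1..K}. (1 - q k) ^ nslots k (x i) * q k ^ soliton_number k (x i))"
      by (rule prod.swap)
    also have "\<dots> = (\<Prod>i\<in>{a..<b}. survival q K * excursion_weight (alpha_of q) (x i))"
      using K0[OF K] by (intro prod.cong[OF refl] slot_weight x) auto
    finally show ?thesis .
  qed
  have "(\<lambda>K. N.prob (F K)) \<longlonglongrightarrow> N.prob (\<Inter>K. F K)"
    by (rule N.finite_Lim_measure_decseq) (use F in \<open>auto simp: decseq_def F_def\<close>)
  moreover have "(\<lambda>K. N.prob (F K)) \<longlonglongrightarrow> (\<Prod>i\<in>{a..<b}. C * excursion_weight (alpha_of q) (x i))"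
  proof (rule Lim_transform_eventually)
    show "(\<lambda>K. \<Prod>i\<in>{a..<b}. survival q K * excursion_weight (alpha_of q) (x i)) \<longlonglongrightarrow>
      (\<Prod>i\<in>{a..<b}. C * excursion_weight (alpha_of q) (x i))"
      by (intro tendsto_intros C)
    show "\<forall>\<^sub>F K in sequentially. (\<Prod>i\<in>{a..<b}. survival q K * excursion_weight (alpha_of q) (x i)) = N.prob (F K)"
      using prF by (auto simp: eventually_sequentially intro!: exI[of _ K0])
  qed
  ultimately show "N.prob {\<omega> \<in> space N. \<forall>i\<in>{a..<b}. E i \<omega> = x i} =
      (\<Prod>i\<in>{a..<b}. C * excursion_weight (alpha_of q) (x i))"
    unfolding ev by (rule LIMSEQ_unique)
qed

lemma alpha_of_nonneg: "1 \<le> k \<Longrightarrow> 0 \<le> alpha_of q k"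
  using q unfolding alpha_of_def param_Q_def by (auto intro!: mult_nonneg_nonneg prod_nonneg simp: less_imp_le)

lemma excursion_weight_nonneg: "e \<in> excursions \<Longrightarrow> 0 \<le> excursion_weight (alpha_of q) e"
  unfolding excursion_weight_eq[OF _ order_refl] by (intro prod_nonneg zero_le_power) (use alpha_of_nonneg in auto)

lemma excursions_in_space: "\<omega> \<in> space N \<Longrightarrow> E i \<omega> \<in> excursions"
  using E unfolding matches_def by blast

text \<open>There are countably many excursions, so measurability reduces to the events that fix the
  whole window.\<close>

lemma window_measurable:
  assumes ab: "a \<le> 0" "0 \<le> b" "a < b"
  shows "(\<lambda>\<omega>. \<lambda>i\<in>{a..<b}. E i \<omega>) \<in> N \<rightarrow>\<^sub>M count_space (PiE {a..<b} (\<lambda>_. excursions))"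
proof (subst measurable_count_space_eq_countable)
  show "countable (PiE {a..<b} (\<lambda>_. excursions))" by (intro countable_PiE) auto
  show "(\<lambda>\<omega>. \<lambda>i\<in>{a..<b}. E i \<omega>) \<in> space N \<rightarrow> PiE {a..<b} (\<lambda>_. excursions) \<and>
    (\<forall>f\<in>PiE {a..<b} (\<lambda>_. excursions). (\<lambda>\<omega>. \<lambda>i\<in>{a..<b}. E i \<omega>) -` {f} \<inter> space N \<in> sets N)"
  proof (intro conjI ballI)
    show "(\<lambda>\<omega>. \<lambda>i\<in>{a..<b}. E i \<omega>) \<in> space N \<rightarrow> PiE {a..<b} (\<lambda>_. excursions)"
      using excursions_in_space by auto
    fix f assume f: "f \<in> PiE {a..<b} (\<lambda>_. excursions)"
    define x where "x i = (if i \<in> {a..<b} then f i else [0])" for i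
    have "(\<lambda>\<omega>. \<lambda>i\<in>{a..<b}. E i \<omega>) -` {f} \<inter> space N = {\<omega> \<in> space N. \<forall>i\<in>{a..<b}. E i \<omega> = x i}"
      using f by (auto simp: x_def fun_eq_iff PiE_def extensional_def)
    moreover have "x i \<in> excursions" for i using f empty_excursion by (auto simp: x_def)
    ultimately show "(\<lambda>\<omega>. \<lambda>i\<in>{a..<b}. E i \<omega>) -` {f} \<inter> space N \<in> sets N"
      using window_event(1)[of x a b] ab by simp
  qed
qed

lemma excursion_measurable: "E i \<in> N \<rightarrow>\<^sub>M count_space excursions"
proof -
  \<comment> \<open>The window has to contain \<open>i\<close> and to reach
    \<open>0\<close>.\<close>
  let ?a = "min i 0" and ?b = "max (i + 1) 1"
  have "(\<lambda>f. f i) \<circ> (\<lambda>\<omega>. \<lambda>i\<in>{?a..<?b}. E i \<omega>) \<in> N \<rightarrow>\<^sub>M count_space excursions"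
    by (rule measurable_comp[OF window_measurable]) auto
  moreover have "((\<lambda>f. f i) \<circ> (\<lambda>\<omega>. \<lambda>i\<in>{?a..<?b}. E i \<omega>)) = E i" by (auto simp: fun_eq_iff)
  ultimately show ?thesis by simp
qed

lemma excursion_law:
  "density (count_space excursions) (\<lambda>e. ennreal (C * excursion_weight (alpha_of q) e)) =
    distr N (count_space excursions) (E 0)"
proof (rule measure_eqI_countable[of _ excursions])
  fix e assume e: "e \<in> excursions"
  have *: "{0..<1::int} = {0}" by auto
  have "E 0 -` {e} \<inter> space N = {\<omega> \<in> space N. \<forall>i\<in>{0..<1}. E i \<omega> = e}"
    unfolding * by auto
  then have "emeasure (distr N (count_space excursions) (E 0)) {e} = ennreal (C * excursion_weight (alpha_of q) e)"
    using window_event(2)[of "\<lambda>_. e" 0 1] e excursion_measurable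
    by (subst emeasure_distr) (auto simp: N.emeasure_eq_measure)
  then show "emeasure (density (count_space excursions) (\<lambda>e. ennreal (C * excursion_weight (alpha_of q) e))) {e} =
      emeasure (distr N (count_space excursions) (E 0)) {e}"
    using e by (subst emeasure_density) (auto simp: nn_integral_count_space_indicator[symmetric] nn_integral_indicator_singleton)
qed auto

text \<open>This is the total mass of the law of excursion \<open>0\<close>.\<close>

lemma partition_function_eq: "ennreal C * partition_function (alpha_of q) = 1"
proof -
  interpret D: prob_space "distr N (count_space excursions) (E 0)"
    by (rule N.prob_space_distr[OF excursion_measurable])
  have "1 = emeasure (density (count_space excursions) (\<lambda>e. ennreal (C * excursion_weight (alpha_of q) e))) excursions"
    unfolding excursion_law using D.emeasure_space_1 by simp
  also have "\<dots> = (\<integral>\<^sup>+ e. ennreal (C * excursion_weight (alpha_of q) e) \<partial>count_space excursions)"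
    by (subst emeasure_density) (auto intro!: nn_integral_cong)
  also have "\<dots> = (\<integral>\<^sup>+ e. ennreal C * ennreal (excursion_weight (alpha_of q) e) \<partial>count_space excursions)"
    by (intro nn_integral_cong) (use C(2) excursion_weight_nonneg in \<open>auto simp: ennreal_mult\<close>)
  also have "\<dots> = ennreal C * partition_function (alpha_of q)"
    unfolding partition_function_def by (rule nn_integral_cmult) simp
  finally show ?thesis by simp
qed

lemma nu_eq: "nu (alpha_of q) = density (count_space excursions) (\<lambda>e. ennreal (C * excursion_weight (alpha_of q) e))"
proof -
  let ?Z = "partition_function (alpha_of q)"
  \<comment> \<open>An infinite partition function would make the product \<open>0\<close> or
    \<open>\<top>\<close>, according to whether \<open>C\<close> vanishes.\<close>
  have "?Z \<noteq> \<top>"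
  proof
    assume "?Z = \<top>"
    then show False using partition_function_eq by (cases "ennreal C = 0") (auto simp: ennreal_mult_top)
  qed
  then obtain z where z: "?Z = ennreal z" "0 \<le> z" by (cases ?Z) auto
  then have Cz: "C * z = 1" using partition_function_eq C(2) by (simp flip: ennreal_mult)
  then have "0 < z" using z by (cases "z = 0") auto
  then have "inverse z = C" using Cz by (simp add: field_simps)
  then have "inverse ?Z = ennreal C" using z \<open>0 < z\<close> by (simp add: inverse_ennreal)
  then show ?thesis
    unfolding nu_def divide_ennreal_def
    by (intro density_cong) (use C(2) excursion_weight_nonneg in \<open>auto simp: ennreal_mult mult.commute\<close>)
qed

lemma prob_space_nu_alpha: "prob_space (nu (alpha_of q))"
  unfolding nu_eq excursion_law by (rule N.prob_space_distr[OF excursion_measurable])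

lemma nu_singleton: "e \<in> excursions \<Longrightarrow> emeasure (nu (alpha_of q)) {e} = ennreal (C * excursion_weight (alpha_of q) e)"
  unfolding nu_eq by (subst emeasure_density) (auto simp: nn_integral_count_space_indicator[symmetric] nn_integral_indicator_singleton)

text \<open>Both measures live on a countable set, so single points suffice, and there the window
  probabilities have product form.\<close>

lemma window_law:
  assumes ab: "a \<le> 0" "0 \<le> b" "a < b"
  shows "distr N (PiM {a..<b} (\<lambda>_. nu (alpha_of q))) (\<lambda>\<omega>. \<lambda>i\<in>{a..<b}. E i \<omega>) = PiM {a..<b} (\<lambda>_. nu (alpha_of q))"
proof -
  let ?I = "{a..<b}"
  let ?P = "PiM ?I (\<lambda>_. nu (alpha_of q))" and ?PE = "PiE ?I (\<lambda>_. excursions)"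
  interpret nu: prob_space "nu (alpha_of q)" by (rule prob_space_nu_alpha)
  interpret P: product_sigma_finite "\<lambda>_::int. nu (alpha_of q)"
    by (simp add: product_sigma_finite_def nu.sigma_finite_measure_axioms)
  have "sets ?P = sets (PiM ?I (\<lambda>_. count_space excursions))"
    by (intro sets_PiM_cong) (simp_all add: nu_def)
  then have sets: "sets ?P = Pow ?PE"
    using count_space_PiM_finite[of ?I "\<lambda>_. excursions"] by simp
  have "sets ?P = sets (count_space ?PE)" using sets by simp
  then have rv: "(\<lambda>\<omega>. \<lambda>i\<in>?I. E i \<omega>) \<in> N \<rightarrow>\<^sub>M ?P"
    using window_measurable[OF ab] measurable_cong_sets by blast
  show ?thesis
  proof (rule measure_eqI_countable)
    show "sets (distr N ?P (\<lambda>\<omega>. \<lambda>i\<in>?I. E i \<omega>)) = Pow ?PE" using sets by simp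
    show "countable ?PE" by (intro countable_PiE) auto
    fix f assume f: "f \<in> ?PE"
    define x where "x i = (if i \<in> ?I then f i else [0])" for i
    have x: "x i \<in> excursions" for i using f empty_excursion by (auto simp: x_def)
    have "(\<lambda>\<omega>. \<lambda>i\<in>?I. E i \<omega>) -` {f} \<inter> space N = {\<omega> \<in> space N. \<forall>i\<in>?I. E i \<omega> = x i}"
      using f by (auto simp: x_def fun_eq_iff PiE_def extensional_def)
    then have "emeasure (distr N ?P (\<lambda>\<omega>. \<lambda>i\<in>?I. E i \<omega>)) {f} =
        ennreal (\<Prod>i\<in>?I. C * excursion_weight (alpha_of q) (x i))"
      using rv f sets window_event(2)[of x a b] x ab
      by (subst emeasure_distr) (auto simp: N.emeasure_eq_measure)
    also have "\<dots> = (\<Prod>i\<in>?I. ennreal (C * excursion_weight (alpha_of q) (x i)))"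
      using C(2) excursion_weight_nonneg x by (intro prod_ennreal[symmetric]) auto
    also have "\<dots> = (\<Prod>i\<in>?I. emeasure (nu (alpha_of q)) {f i})"
      using PiE_mem[OF f] by (intro prod.cong) (auto simp: nu_singleton x_def)
    also have "\<dots> = emeasure ?P (PiE ?I (\<lambda>i. {f i}))"
      using f by (intro P.emeasure_PiM[symmetric]) (auto simp: nu_def)
    also have "PiE ?I (\<lambda>i. {f i}) = {f}"
      using f by (intro PiE_singleton) (auto simp: PiE_def)
    finally show "emeasure (distr N ?P (\<lambda>\<omega>. \<lambda>i\<in>?I. E i \<omega>)) {f} = emeasure ?P {f}" .
  qed (rule sets)
qed

lemma excursion_rv: "E i \<in> N \<rightarrow>\<^sub>M nu (alpha_of q)"
  using excursion_measurable measurable_cong_sets[of N N "nu (alpha_of q)" "count_space excursions"]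
  by (auto simp: nu_def)

lemma joint_excursion_law:
  "distr N (PiM UNIV (\<lambda>_. nu (alpha_of q))) (\<lambda>\<omega> i. E i \<omega>) = PiM UNIV (\<lambda>_. nu (alpha_of q))"
proof -
  let ?L = "\<lambda>_::int. nu (alpha_of q)"
  have L: "product_prob_space ?L"
    using prob_space_nu_alpha
    by (simp add: product_prob_space_def product_prob_space_axioms_def product_sigma_finite_def prob_space_imp_sigma_finite)
  have rv: "(\<lambda>\<omega> i. E i \<omega>) \<in> N \<rightarrow>\<^sub>M PiM UNIV ?L"
    using excursion_rv by (intro measurable_PiM_single') (auto dest: measurable_space)
  show ?thesis
  proof (rule measure_eqI_PiM_infinite)
    show "finite_measure (distr N (PiM UNIV ?L) (\<lambda>\<omega> i. E i \<omega>))"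
      using N.prob_space_distr[OF rv] prob_space.finite_measure by blast
    fix A :: "int \<Rightarrow> int list set" and J :: "int set"
    assume J: "finite J" and A: "\<And>i. i \<in> J \<Longrightarrow> A i \<in> sets (nu (alpha_of q))"
    \<comment> \<open>A cylinder event over \<open>J\<close> is viewed as one over a symmetric
      window, where the joint law is known.\<close>
    define m where "m = Max (insert 0 (abs ` J))"
    have m: "0 \<le> m" "\<And>i. i \<in> J \<Longrightarrow> \<bar>i\<bar> \<le> m" using J by (auto simp: m_def)
    let ?I = "{- m..<m + 1}"
    have JI: "J \<subseteq> ?I" using m(2) by force
    have rvI: "(\<lambda>\<omega>. \<lambda>i\<in>?I. E i \<omega>) \<in> N \<rightarrow>\<^sub>M PiM ?I ?L" by (intro measurable_restrict excursion_rv)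
    have emb: "prod_emb K ?L J (PiE J A) \<in> sets (PiM K ?L)" if "J \<subseteq> K" for K
      using J A that by (intro sets_PiM_I) auto
    have mem: "E i \<omega> \<in> space (nu (alpha_of q))" if "\<omega> \<in> space N" for i \<omega>
      using measurable_space[OF excursion_rv that] .
    have "emeasure (distr N (PiM UNIV ?L) (\<lambda>\<omega> i. E i \<omega>)) (prod_emb UNIV ?L J (PiE J A)) =
        emeasure N {\<omega> \<in> space N. \<forall>i\<in>J. E i \<omega> \<in> A i}"
      by (subst emeasure_distr[OF rv emb]) (auto intro!: arg_cong[where f = "emeasure N"] simp: prod_emb_iff mem)
    also have "\<dots> = emeasure (distr N (PiM ?I ?L) (\<lambda>\<omega>. \<lambda>i\<in>?I. E i \<omega>)) (prod_emb ?I ?L J (PiE J A))"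
      using JI by (subst emeasure_distr[OF rvI emb]) (auto intro!: arg_cong[where f = "emeasure N"] simp: prod_emb_iff mem Int_absorb1[OF JI])
    also have "\<dots> = emeasure (PiM ?I ?L) (prod_emb ?I ?L J (PiE J A))"
      using window_law[of "- m" "m + 1"] m(1) by simp
    also have "\<dots> = (\<Prod>i\<in>J. emeasure (nu (alpha_of q)) (A i))"
      using product_prob_space.emeasure_PiM_emb[OF L JI J A] by simp
    also have "\<dots> = emeasure (PiM UNIV ?L) (prod_emb UNIV ?L J (PiE J A))"
      using product_prob_space.emeasure_PiM_emb[OF L _ J A, of UNIV] by simp
    finally show "emeasure (distr N (PiM UNIV ?L) (\<lambda>\<omega> i. E i \<omega>)) (prod_emb UNIV ?L J (PiE J A)) =
      emeasure (PiM UNIV ?L) (prod_emb UNIV ?L J (PiE J A))" .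
  qed simp_all
qed

end

subsection \<open>Measurability\<close>

abbreviation excursion_space :: "(int \<Rightarrow> int list) measure" where
  "excursion_space \<equiv> PiM UNIV (\<lambda>_. count_space excursions)"

lemma sets_nu [simp]: "sets (nu \<alpha>) = Pow excursions" and space_nu [simp]: "space (nu \<alpha>) = excursions"
  by (simp_all add: nu_def)

lemma sets_PiM_nu: "sets (PiM UNIV (\<lambda>_. nu \<alpha>)) = sets excursion_space"
  by (intro sets_PiM_cong) simp_all

lemma measurable_PiM_nu: "PiM UNIV (\<lambda>_. nu \<alpha>) \<rightarrow>\<^sub>M K = excursion_space \<rightarrow>\<^sub>M K"
  by (rule measurable_cong_sets[OF sets_PiM_nu refl])

lemma excursion_spaceD: "\<epsilon> \<in> space excursion_space \<Longrightarrow> \<epsilon> i \<in> excursions"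
  by (auto simp: space_PiM PiE_def)

lemma measurable_coordinate [measurable]:
  "(\<lambda>\<epsilon>. f (\<epsilon> i)) \<in> excursion_space \<rightarrow>\<^sub>M count_space UNIV"
  by (rule measurable_compose[OF measurable_component_singleton]) auto

text \<open>For the discrete sigma-algebra it is enough to fix one summand at each of its countably
  many values.\<close>

lemma measurable_sum_count_space:
  fixes f :: "'i \<Rightarrow> 'a \<Rightarrow> int"
  assumes "\<And>i. f i \<in> M \<rightarrow>\<^sub>M count_space UNIV"
  shows "(\<lambda>x. \<Sum>i\<in>I. f i x) \<in> M \<rightarrow>\<^sub>M count_space UNIV"
proof (induction I rule: infinite_finite_induct)
  case (insert i I)
  have "(\<lambda>x. n + (\<Sum>i\<in>I. f i x)) \<in> M \<rightarrow>\<^sub>M count_space UNIV" for n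
    using insert.IH measurable_count_space by (rule measurable_compose[where g = "\<lambda>s. n + s"])
  then have "(\<lambda>x. f i x + (\<Sum>i\<in>I. f i x)) \<in> M \<rightarrow>\<^sub>M count_space UNIV"
    using assms by (rule measurable_compose_countable[where f = "\<lambda>n x. n + (\<Sum>i\<in>I. f i x)" and g = "f i"])
  then show ?case unfolding sum.insert[OF insert.hyps] .
qed simp_all

lemma measurable_partial_sum:
  assumes "\<And>i. f i \<in> M \<rightarrow>\<^sub>M count_space UNIV"
  shows "(\<lambda>x. partial_sum (\<lambda>i. f i x) j) \<in> M \<rightarrow>\<^sub>M count_space UNIV"
proof -
  have "(\<lambda>x. n - (\<Sum>i\<in>{j..<0}. f i x)) \<in> M \<rightarrow>\<^sub>M count_space UNIV" for n
    using measurable_sum_count_space[OF assms] measurable_count_space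
    by (rule measurable_compose[where g = "\<lambda>s. n - s"])
  then show ?thesis unfolding partial_sum_def
    using measurable_sum_count_space[OF assms]
    by (rule measurable_compose_countable[where f = "\<lambda>n x. n - (\<Sum>i\<in>{j..<0}. f i x)" and g = "\<lambda>x. \<Sum>i\<in>{0..<j}. f i x"])
qed

lemma measurable_concat_pos [measurable]: "(\<lambda>\<epsilon>. concat_pos \<epsilon> i) \<in> excursion_space \<rightarrow>\<^sub>M count_space UNIV"
  unfolding concat_pos_eq by (rule measurable_partial_sum) (rule measurable_coordinate)

lemma measurable_slot_offset [measurable]: "(\<lambda>\<epsilon>. slot_offset \<epsilon> k i) \<in> excursion_space \<rightarrow>\<^sub>M count_space UNIV"
  unfolding slot_offset_def by (rule measurable_partial_sum) (rule measurable_coordinate)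

lemma measurable_config_spaceI:
  assumes "\<And>x. \<eta> x \<in> Omega_hat \<or> x \<notin> space M" "\<And>z. Measurable.pred M (\<lambda>x. \<eta> x z)"
  shows "\<eta> \<in> M \<rightarrow>\<^sub>M config_space"
  unfolding config_space_def
proof (rule measurable_restrict_space2)
  show "\<eta> \<in> space M \<rightarrow> Omega_hat" using assms(1) by blast
  have "(\<lambda>x z. \<eta> x z) \<in> M \<rightarrow>\<^sub>M PiM UNIV (\<lambda>_. count_space UNIV)"
    using assms(2) by (intro measurable_PiM_single') auto
  then show "\<eta> \<in> M \<rightarrow>\<^sub>M PiM UNIV (\<lambda>_. count_space UNIV)" by simp
qed

lemma measurable_concat [measurable]: "concat_excursions \<in> excursion_space \<rightarrow>\<^sub>M config_space"
proof (rule measurable_config_spaceI)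
  show "concat_excursions \<epsilon> \<in> Omega_hat \<or> \<epsilon> \<notin> space excursion_space" for \<epsilon>
    using concat_in_Omega_hat[of \<epsilon>] excursion_spaceD by blast
  have 1: "Measurable.pred excursion_space (\<lambda>\<epsilon>. x = concat_pos \<epsilon> i + z)" for x i z
    by (rule measurable_compose[OF measurable_concat_pos]) simp
  have 2: "Measurable.pred excursion_space (\<lambda>\<epsilon>. z \<le> 2 * int (half_length (\<epsilon> i)) \<and> ball_config (\<epsilon> i) z)" for i z
    by (rule measurable_coordinate)
  have "Measurable.pred excursion_space (\<lambda>\<epsilon>. \<exists>i z. 0 \<le> z \<and> x = concat_pos \<epsilon> i + z \<and>
      z \<le> 2 * int (half_length (\<epsilon> i)) \<and> ball_config (\<epsilon> i) z)" for x
    using 1 2 by (intro pred_intros_countable pred_intros_logic) auto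
  moreover have "concat_excursions \<epsilon> x \<longleftrightarrow> (\<exists>i z. 0 \<le> z \<and> x = concat_pos \<epsilon> i + z \<and>
      z \<le> 2 * int (half_length (\<epsilon> i)) \<and> ball_config (\<epsilon> i) z)" for \<epsilon> x
    unfolding concat_excursions_def by blast
  ultimately show "Measurable.pred excursion_space (\<lambda>\<epsilon>. concat_excursions \<epsilon> x)" for x by simp
qed

text \<open>The enumeration of slots is a definite description, so the preimage is rewritten as a
  countable union over the excursion \<open>i\<close> and the slot \<open>j\<close> in it that carry
  the number \<open>u\<close>.\<close>

lemma measurable_soliton_decomposition:
  assumes k: "1 \<le> k"
  shows "(\<lambda>\<epsilon>. soliton_decomposition (concat_excursions \<epsilon>) k u) \<in> excursion_space \<rightarrow>\<^sub>M count_space UNIV"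
proof -
  have "(\<lambda>\<epsilon>. soliton_decomposition (concat_excursions \<epsilon>) k u) -` {n} \<inter> space excursion_space =
    {\<epsilon> \<in> space excursion_space. \<exists>i j. u = slot_offset \<epsilon> k i + int j \<and> (j < nslots k (\<epsilon> i) \<and> ecount k (\<epsilon> i) j = n)}" for n
  proof -
    have "soliton_decomposition (concat_excursions \<epsilon>) k u = n \<longleftrightarrow>
       (\<exists>i j. u = slot_offset \<epsilon> k i + int j \<and> (j < nslots k (\<epsilon> i) \<and> ecount k (\<epsilon> i) j = n))"
      if e: "\<epsilon> \<in> space excursion_space" for \<epsilon>
    proof -
      have exc: "\<And>i. \<epsilon> i \<in> excursions" using e by (rule excursion_spaceD)
      obtain i j where "u = slot_offset \<epsilon> k i + int j" "j < nslots k (\<epsilon> i)"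
        using slot_offset_block[of \<epsilon>, OF exc k] by blast
      then show ?thesis using soliton_decomposition_concat[of \<epsilon>, OF exc k] by metis
    qed
    then show ?thesis by auto
  qed
  moreover have "Measurable.pred excursion_space (\<lambda>\<epsilon>. \<exists>i j. u = slot_offset \<epsilon> k i + int j \<and> (j < nslots k (\<epsilon> i) \<and> ecount k (\<epsilon> i) j = n))" for n
  proof -
    have 1: "Measurable.pred excursion_space (\<lambda>\<epsilon>. u = slot_offset \<epsilon> k i + int j)" for i j
      by (rule measurable_compose[OF measurable_slot_offset]) simp
    have 2: "Measurable.pred excursion_space (\<lambda>\<epsilon>. j < nslots k (\<epsilon> i) \<and> ecount k (\<epsilon> i) j = n)" for i j
      by (rule measurable_coordinate)
    show ?thesis using 1 2 by (intro pred_intros_countable pred_intros_logic) auto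
  qed
  ultimately show ?thesis unfolding measurable_count_space_eq2_countable by (simp add: pred_def)
qed

subsection \<open>The parameters\<close>

lemma excursion_weight_mono:
  assumes "e \<in> excursions" "\<And>k. 1 \<le> k \<Longrightarrow> 0 \<le> \<alpha>' k \<and> \<alpha>' k \<le> \<alpha> k"
  shows "excursion_weight \<alpha>' e \<le> excursion_weight \<alpha> e"
  unfolding excursion_weight_eq[OF assms(1) order_refl]
  by (intro prod_mono conjI zero_le_power power_mono) (use assms(2) in auto)

lemma partition_function_mono:
  assumes "\<And>k. 1 \<le> k \<Longrightarrow> 0 \<le> \<alpha>' k \<and> \<alpha>' k \<le> \<alpha> k"
  shows "partition_function \<alpha>' \<le> partition_function \<alpha>"
  unfolding partition_function_def
  by (intro nn_integral_mono ennreal_leI excursion_weight_mono) (use assms in auto)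

lemma excursions_of_array:
  assumes "\<zeta> \<in> soliton_arrays"
  shows "matches (excursion_at (inverse_decomposition \<zeta>)) \<zeta>"
    "inverse_decomposition \<zeta> = concat_excursions (excursion_at (inverse_decomposition \<zeta>))"
proof -
  obtain \<epsilon> where e: "matches \<epsilon> \<zeta>" using exists_matches[OF assms] by blast
  then have "\<And>i. \<epsilon> i \<in> excursions" unfolding matches_def by blast
  then have "excursion_at (inverse_decomposition \<zeta>) = \<epsilon>"
    unfolding inverse_decomposition_eq[OF e] using excursion_at_concat[of \<epsilon>] by (intro ext) blast
  then show "matches (excursion_at (inverse_decomposition \<zeta>)) \<zeta>"
    "inverse_decomposition \<zeta> = concat_excursions (excursion_at (inverse_decomposition \<zeta>))"
    using e inverse_decomposition_eq[OF e] by simp_all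
qed

lemma one_minus_q: "q \<in> param_Q \<Longrightarrow> 1 \<le> k \<Longrightarrow> 1 - q k \<in> {0<..1}"
  by (auto simp: param_Q_def)

text \<open>Such an array serves twice: to evaluate partition functions, and as the model with which
  the law of i.i.d. excursions is compared.\<close>

lemma realization_exists:
  assumes q: "q \<in> param_Q"
  obtains N :: "(nat \<times> int \<Rightarrow> nat) measure" and \<zeta>
  where "independent_geometric_array N \<zeta> (\<lambda>k. 1 - q k)"
    "\<And>\<omega>. \<omega> \<in> space N \<Longrightarrow> (\<lambda>k j. \<zeta> k j \<omega>) \<in> soliton_arrays"
proof -
  let ?N = "PiM array_index (geometric_law (\<lambda>k. 1 - q k))" and ?\<zeta> = "\<lambda>k j \<omega>. \<omega> (k, j) :: nat"
  have N: "independent_geometric_array ?N ?\<zeta> (\<lambda>k. 1 - q k)"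
    by (rule exists_geometric_array) (rule one_minus_q[OF q])
  define S where "S = {\<omega> \<in> space ?N. (\<lambda>k j. ?\<zeta> k j \<omega>) \<in> soliton_arrays}"
  have S: "S \<in> sets ?N" "measure ?N S = 1" using soliton_arrays_almost_surely[OF N q] unfolding S_def by blast+
  show ?thesis
    by (rule that[OF independent_geometric_array_restrict[OF N S]]) (auto simp: space_restrict_space S_def)
qed

text \<open>An identity between numbers, obtained from the total mass of a law on an auxiliary
  probability space.\<close>

lemma partition_function_alpha_of:
  assumes q: "q \<in> param_Q" and C: "survival q \<longlonglongrightarrow> C" "0 \<le> C"
  shows "ennreal C * partition_function (alpha_of q) = 1"
proof -
  obtain N :: "(nat \<times> int \<Rightarrow> nat) measure" and \<zeta> where N: "independent_geometric_array N \<zeta> (\<lambda>k. 1 - q k)"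
    "\<And>\<omega>. \<omega> \<in> space N \<Longrightarrow> (\<lambda>k j. \<zeta> k j \<omega>) \<in> soliton_arrays"
    using realization_exists[OF q] by blast
  show ?thesis
    by (rule partition_function_eq[OF N(1) q, of "\<lambda>i \<omega>. excursion_at (inverse_decomposition (\<lambda>k j. \<zeta> k j \<omega>)) i"])
      (use N(2) C excursions_of_array(1) in auto)
qed

text \<open>With all parameters above \<open>K\<close> set to \<open>0\<close> the sequence is
  summable and its survival products are constant from \<open>K\<close> on. The truncated weights
  lie below those of \<open>\<alpha>\<close>, and the partition function is monotone.\<close>

lemma partition_function_truncated:
  assumes q: "\<And>k. 1 \<le> k \<Longrightarrow> k \<le> K \<Longrightarrow> 0 \<le> q k \<and> q k < 1"
    and \<alpha>: "\<And>k. 1 \<le> k \<Longrightarrow> 0 \<le> \<alpha> k" "\<And>k. 1 \<le> k \<Longrightarrow> k \<le> K \<Longrightarrow> alpha_of q k \<le> \<alpha> k"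
  shows "1 \<le> ennreal (survival q K) * partition_function \<alpha>"
proof -
  define q' where "q' k = (if k \<le> K then q k else 0)" for k
  have "summable (\<lambda>k. q' (Suc k))"
    by (rule summable_finite[of "{..<K}"]) (auto simp: q'_def)
  then have q': "q' \<in> param_Q" using q by (auto simp: param_Q_def q'_def)
  have "survival q' n = survival q K" if "K \<le> n" for n
  proof -
    have "survival q' n = (\<Prod>k\<in>{1..K}. 1 - q' k)"
      unfolding survival_def using that by (intro prod.mono_neutral_right) (auto simp: q'_def)
    also have "\<dots> = survival q K" unfolding survival_def by (intro prod.cong) (auto simp: q'_def)
    finally show ?thesis .
  qed
  then have lim: "survival q' \<longlonglongrightarrow> survival q K"
    by (intro tendsto_eventually) (auto simp: eventually_sequentially)
  have "0 \<le> survival q K" unfolding survival_def using q by (intro prod_nonneg) (auto simp: less_imp_le)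
  then have "1 = ennreal (survival q K) * partition_function (alpha_of q')"
    using partition_function_alpha_of[OF q' lim] by simp
  also have "\<dots> \<le> ennreal (survival q K) * partition_function \<alpha>"
  proof (intro mult_left_mono partition_function_mono)
    fix k :: nat assume k: "1 \<le> k"
    have "0 \<le> alpha_of q' k"
      unfolding alpha_of_def using q' k by (auto simp: param_Q_def less_imp_le intro!: mult_nonneg_nonneg prod_nonneg)
    moreover have "alpha_of q' k \<le> \<alpha> k"
    proof (cases "k \<le> K")
      case True
      then have "alpha_of q' k = alpha_of q k" unfolding alpha_of_def by (auto simp: q'_def intro!: prod.cong)
      then show ?thesis using \<alpha>(2)[OF k True] by simp
    next
      case False
      then show ?thesis using \<alpha>(1)[OF k] by (simp add: alpha_of_def q'_def)
    qed
    ultimately show "0 \<le> alpha_of q' k \<and> alpha_of q' k \<le> \<alpha> k" by blast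
  qed simp
  finally show ?thesis .
qed

text \<open>The products \<open>survival (q_of \<alpha>) K\<close> are bounded below by the inverse
  of the partition function. The same bound for a modified parameter keeps each
  \<open>q_of \<alpha> k\<close> below \<open>1\<close>; then \<open>1 - x \<le> exp (- x)\<close>
  bounds the partial sums by the logarithm of the partition function.\<close>

lemma q_of_in_param_Q:
  assumes \<alpha>: "\<alpha> \<in> param_A"
  shows "q_of \<alpha> \<in> param_Q" "\<And>k. 1 \<le> k \<Longrightarrow> alpha_of (q_of \<alpha>) k = \<alpha> k"
proof -
  let ?q = "q_of \<alpha>"
  have a: "0 \<le> \<alpha> k \<and> \<alpha> k < 1" if "1 \<le> k" for k using \<alpha> that unfolding param_A_def by blast
  have "partition_function \<alpha> < \<infinity>" using \<alpha> unfolding param_A_def by blast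
  then obtain z where z: "partition_function \<alpha> = ennreal z" "0 \<le> z" by (cases "partition_function \<alpha>") auto
  have inv: "alpha_of ?q k = \<alpha> k" if "\<And>j. 1 \<le> j \<Longrightarrow> j < k \<Longrightarrow> ?q j < 1" for k
  proof -
    have "(\<Prod>j\<in>{1..<k}. (1 - ?q j) ^ (2 * (k - j))) \<noteq> 0" using that by force
    then show ?thesis unfolding alpha_of_def by (subst q_of.simps) simp
  qed
  have le: "1 \<le> survival q K * z" if "\<And>k. 1 \<le> k \<Longrightarrow> k \<le> K \<Longrightarrow> 0 \<le> q k \<and> q k < 1"
    "\<And>k. 1 \<le> k \<Longrightarrow> k \<le> K \<Longrightarrow> alpha_of q k \<le> \<alpha> k" for q K
  proof -
    have "1 \<le> ennreal (survival q K) * partition_function \<alpha>"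
      by (rule partition_function_truncated) (use that a in auto)
    moreover have "0 \<le> survival q K" unfolding survival_def using that by (intro prod_nonneg) (auto simp: less_imp_le)
    ultimately show ?thesis using z by (simp flip: ennreal_mult)
  qed
  have q: "0 \<le> ?q k \<and> ?q k < 1" if "1 \<le> k" for k
    using that
  proof (induction k rule: less_induct)
    case (less k)
    then have IH: "0 \<le> ?q j \<and> ?q j < 1" if "1 \<le> j" "j < k" for j using that by blast
    define D where "D = (\<Prod>j\<in>{1..<k}. (1 - ?q j) ^ (2 * (k - j)))"
    have D: "0 < D" unfolding D_def using IH by (intro prod_pos) auto
    have qk: "?q k = \<alpha> k / D" unfolding D_def by (subst q_of.simps) simp
    have "?q k < 1"
    proof (rule ccontr)
      assume "\<not> ?q k < 1"
      then have Da: "D \<le> \<alpha> k" using D qk by (simp add: field_simps)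
      \<comment> \<open>If the value at \<open>k\<close> were at least \<open>1\<close>, it could be
        lowered to any \<open>t\<close> in \<open>[0, 1)\<close> with the weight staying below
        \<open>\<alpha> k\<close>. This \<open>t\<close> has
        \<open>(1 - t) * z = z / (z + 1) < 1\<close>, against the lower bound.\<close>
      define t where "t = 1 - 1 / (z + 1)"
      have t: "0 \<le> t" "t < 1" using z by (auto simp: t_def field_simps)
      define q' where "q' j = (if j = k then t else ?q j)" for j
      have alq: "alpha_of q' j \<le> \<alpha> j" if j: "1 \<le> j" "j \<le> k" for j
      proof (cases "j = k")
        case True
        have "(\<Prod>l\<in>{1..<k}. (1 - q' l) ^ (2 * (k - l))) = D"
          unfolding D_def by (intro prod.cong) (auto simp: q'_def)
        then have "alpha_of q' k = t * D" unfolding alpha_of_def by (simp add: q'_def)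
        also have "\<dots> \<le> 1 * D" using t D by (intro mult_right_mono) auto
        finally show ?thesis using Da True by simp
      next
        case False
        then have "alpha_of q' j = alpha_of ?q j"
          unfolding alpha_of_def using j by (auto simp: q'_def intro!: prod.cong)
        then show ?thesis using inv[of j] IH j by simp
      qed
      have "1 \<le> survival q' k * z"
        by (rule le) (use IH t less.prems alq in \<open>auto simp: q'_def\<close>)
      moreover have "survival q' k \<le> 1 - t"
      proof -
        have "{1..k} = insert k {1..<k}" using less.prems by auto
        then have "survival q' k = (1 - t) * (\<Prod>j\<in>{1..<k}. 1 - ?q j)"
          unfolding survival_def by (simp add: q'_def)
        also have "\<dots> \<le> (1 - t) * 1"
          using t IH by (intro mult_left_mono prod_le_1) (auto simp: less_imp_le)
        finally show ?thesis by simp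
      qed
      ultimately have "1 \<le> (1 - t) * z" using z(2) mult_right_mono[of "survival q' k" "1 - t" z] by linarith
      then show False using z(2) by (simp add: t_def field_simps)
    qed
    then show ?case using qk D a[OF less.prems] by simp
  qed
  then show "\<And>k. 1 \<le> k \<Longrightarrow> alpha_of ?q k = \<alpha> k" using inv by simp
  have bound: "1 \<le> survival ?q K * z" for K
    using q inv by (intro le) auto
  have zpos: "0 < z" using bound[of 0] by (simp add: survival_def)
  have "summable (\<lambda>k. ?q (Suc k))"
  proof (rule summableI_nonneg_bounded)
    show "0 \<le> ?q (Suc k)" for k using q by simp
    fix n
    have "survival ?q n \<le> (\<Prod>k\<in>{1..n}. exp (- ?q k))"
      unfolding survival_def
    proof (intro prod_mono conjI)
      fix k assume "k \<in> {1..n}"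
      then show "0 \<le> 1 - ?q k" using q[of k] by simp
      show "1 - ?q k \<le> exp (- ?q k)" using exp_ge_add_one_self[of "- ?q k"] by simp
    qed
    also have "\<dots> = exp (- (\<Sum>k\<in>{1..n}. ?q k))" by (simp add: exp_sum flip: sum_negf)
    finally have "1 \<le> exp (- (\<Sum>k\<in>{1..n}. ?q k)) * z"
      using bound[of n] zpos by (meson less_imp_le mult_right_mono order_trans)
    then have "exp (\<Sum>k\<in>{1..n}. ?q k) \<le> z" by (simp add: exp_minus field_simps)
    then have "(\<Sum>k\<in>{1..n}. ?q k) \<le> ln z" using zpos by (simp add: ln_ge_iff)
    then show "(\<Sum>k<n. ?q (Suc k)) \<le> ln z" by (simp add: sum.atLeast1_atMost_eq)
  qed
  then show "?q \<in> param_Q" using q unfolding param_Q_def by blast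
qed

subsection \<open>Laws of configurations\<close>

lemma iid_iff:
  assumes L: "prob_space L"
  shows "iid M X L \<longleftrightarrow> prob_space M \<and> (\<forall>i. X i \<in> M \<rightarrow>\<^sub>M L) \<and>
    distr M (PiM UNIV (\<lambda>_. L)) (\<lambda>\<omega> i. X i \<omega>) = PiM UNIV (\<lambda>_. L)"
proof (cases "prob_space M \<and> (\<forall>i. X i \<in> M \<rightarrow>\<^sub>M L)")
  case True
  then have "distr M (PiM UNIV (\<lambda>_. L)) (\<lambda>\<omega>. \<lambda>i\<in>UNIV. X i \<omega>) = PiM UNIV (\<lambda>_. L) \<longleftrightarrow>
    prob_space.indep_vars M (\<lambda>_. L) X UNIV \<and> (\<forall>i\<in>UNIV. distr M L (X i) = L)"
    by (intro joint_law_iff) (use L in auto)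
  then show ?thesis using True unfolding iid_def has_law_def by (auto simp: restrict_UNIV)
next
  case False
  then show ?thesis unfolding iid_def has_law_def by blast
qed

lemma nu_cong:
  assumes "\<And>k. 1 \<le> k \<Longrightarrow> \<alpha> k = \<alpha>' k" shows "nu \<alpha> = nu \<alpha>'" and "mu_hat \<alpha> = mu_hat \<alpha>'"
proof -
  have "excursion_weight \<alpha> = excursion_weight \<alpha>'" unfolding excursion_weight_def using assms by simp
  then show "nu \<alpha> = nu \<alpha>'" unfolding nu_def partition_function_def by simp
  then show "mu_hat \<alpha> = mu_hat \<alpha>'" unfolding mu_hat_def by simp
qed

lemma sets_mu_hat: "sets (mu_hat \<alpha>) = sets config_space"
  by (simp add: mu_hat_def)

lemma measurable_excursion_sequence:
  assumes "\<And>i. X i \<in> M \<rightarrow>\<^sub>M nu \<alpha>"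
  shows "(\<lambda>\<omega> i. X i \<omega>) \<in> M \<rightarrow>\<^sub>M PiM UNIV (\<lambda>_. nu \<alpha>)"
  by (rule measurable_PiM_single') (use assms measurable_space[OF assms] in auto)

lemma has_law_concat:
  assumes X: "\<And>i. X i \<in> M \<rightarrow>\<^sub>M nu \<alpha>"
    and law: "distr M (PiM UNIV (\<lambda>_. nu \<alpha>)) (\<lambda>\<omega> i. X i \<omega>) = PiM UNIV (\<lambda>_. nu \<alpha>)"
  shows "has_law M (\<lambda>\<omega>. concat_excursions (\<lambda>i. X i \<omega>)) (mu_hat \<alpha>)"
proof -
  have R: "(\<lambda>\<omega> i. X i \<omega>) \<in> M \<rightarrow>\<^sub>M PiM UNIV (\<lambda>_. nu \<alpha>)"
    using X by (rule measurable_excursion_sequence)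
  have c: "concat_excursions \<in> PiM UNIV (\<lambda>_. nu \<alpha>) \<rightarrow>\<^sub>M config_space"
    unfolding measurable_PiM_nu by (rule measurable_concat)
  have "(\<lambda>\<omega>. concat_excursions (\<lambda>i. X i \<omega>)) \<in> M \<rightarrow>\<^sub>M config_space"
    using measurable_compose[OF R c] .
  then have m: "(\<lambda>\<omega>. concat_excursions (\<lambda>i. X i \<omega>)) \<in> M \<rightarrow>\<^sub>M mu_hat \<alpha>"
    using measurable_cong_sets[OF refl sets_mu_hat] by blast
  have "distr M (mu_hat \<alpha>) (\<lambda>\<omega>. concat_excursions (\<lambda>i. X i \<omega>)) =
      distr M config_space (\<lambda>\<omega>. concat_excursions (\<lambda>i. X i \<omega>))"
    by (rule distr_cong) (simp_all add: sets_mu_hat)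
  also have "\<dots> = distr (distr M (PiM UNIV (\<lambda>_. nu \<alpha>)) (\<lambda>\<omega> i. X i \<omega>)) config_space concat_excursions"
    by (subst distr_distr[OF c R]) (simp add: comp_def)
  also have "\<dots> = mu_hat \<alpha>" unfolding law mu_hat_def ..
  finally show ?thesis using m unfolding has_law_def by blast
qed

text \<open>The results for an abstract \<open>E\<close> are applied to the excursions of the
  inverse decomposition, with \<open>C\<close> the survival limit; both directions of the theorem
  rest on this.\<close>

lemma soliton_array_law:
  assumes N: "independent_geometric_array N \<zeta> (\<lambda>k. 1 - q k)" and q: "q \<in> param_Q"
    and S: "\<forall>\<omega>\<in>space N. (\<lambda>k j. \<zeta> k j \<omega>) \<in> soliton_arrays"
  defines "E \<equiv> \<lambda>i \<omega>. excursion_at (inverse_decomposition (\<lambda>k j. \<zeta> k j \<omega>)) i"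
  shows "prob_space (nu (alpha_of q))" "\<And>i. E i \<in> N \<rightarrow>\<^sub>M nu (alpha_of q)"
    "distr N (PiM UNIV (\<lambda>_. nu (alpha_of q))) (\<lambda>\<omega> i. E i \<omega>) = PiM UNIV (\<lambda>_. nu (alpha_of q))"
    "\<And>\<omega>. \<omega> \<in> space N \<Longrightarrow> matches (\<lambda>i. E i \<omega>) (\<lambda>k j. \<zeta> k j \<omega>)"
    "has_law N (\<lambda>\<omega>. inverse_decomposition (\<lambda>k j. \<zeta> k j \<omega>)) (mu_hat (alpha_of q))"
proof -
  obtain C where C: "survival q \<longlonglongrightarrow> C" "0 \<le> C" using survival_limit[OF q] by blast
  show m: "matches (\<lambda>i. E i \<omega>) (\<lambda>k j. \<zeta> k j \<omega>)" if "\<omega> \<in> space N" for \<omega>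
    unfolding E_def using excursions_of_array(1)[OF bspec[OF S that]] by simp
  show "prob_space (nu (alpha_of q))" by (rule prob_space_nu_alpha[OF N q m C])
  show rv: "E i \<in> N \<rightarrow>\<^sub>M nu (alpha_of q)" for i by (rule excursion_rv[OF N q m C])
  show law: "distr N (PiM UNIV (\<lambda>_. nu (alpha_of q))) (\<lambda>\<omega> i. E i \<omega>) = PiM UNIV (\<lambda>_. nu (alpha_of q))"
    by (rule joint_excursion_law[OF N q m C])
  have eq: "concat_excursions (\<lambda>i. E i \<omega>) = inverse_decomposition (\<lambda>k j. \<zeta> k j \<omega>)" if "\<omega> \<in> space N" for \<omega>
    unfolding E_def using excursions_of_array(2)[OF bspec[OF S that]] by simp
  have "has_law N (\<lambda>\<omega>. concat_excursions (\<lambda>i. E i \<omega>)) (mu_hat (alpha_of q))"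
    by (rule has_law_concat[OF rv law])
  moreover have "distr N (mu_hat (alpha_of q)) (\<lambda>\<omega>. concat_excursions (\<lambda>i. E i \<omega>)) =
      distr N (mu_hat (alpha_of q)) (\<lambda>\<omega>. inverse_decomposition (\<lambda>k j. \<zeta> k j \<omega>))"
    by (rule distr_cong) (simp_all add: eq)
  moreover have "(\<lambda>\<omega>. concat_excursions (\<lambda>i. E i \<omega>)) \<in> N \<rightarrow>\<^sub>M mu_hat (alpha_of q) \<longleftrightarrow>
      (\<lambda>\<omega>. inverse_decomposition (\<lambda>k j. \<zeta> k j \<omega>)) \<in> N \<rightarrow>\<^sub>M mu_hat (alpha_of q)"
    by (rule measurable_cong) (rule eq)
  ultimately show "has_law N (\<lambda>\<omega>. inverse_decomposition (\<lambda>k j. \<zeta> k j \<omega>)) (mu_hat (alpha_of q))"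
    unfolding has_law_def by simp
qed

lemma measurable_translate_record:
  "(\<lambda>\<eta>. translate (record_pos \<eta> i) \<eta>) \<in> config_space \<rightarrow>\<^sub>M config_space"
proof (rule measurable_config_spaceI)
  have space: "space config_space = Omega_hat" by (simp add: config_space_def space_restrict_space space_PiM)
  show "translate (record_pos \<eta> i) \<eta> \<in> Omega_hat \<or> \<eta> \<notin> space config_space" for \<eta>
  proof -
    {
      assume \<eta>: "\<eta> \<in> Omega_hat"
      have exc: "\<And>i. excursion_at \<eta> i \<in> excursions" using excursion_at_in[OF \<eta>] .
      have "translate (record_pos \<eta> i) \<eta> = concat_excursions (\<lambda>j. excursion_at \<eta> (i + j))"
        using translate_concat[of "excursion_at \<eta>" i] record_pos_concat[of "excursion_at \<eta>" i] exc
          concat_excursion_at[OF \<eta>] by simp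
      then have "translate (record_pos \<eta> i) \<eta> \<in> Omega_hat" using concat_in_Omega_hat exc by simp
    }
    then show ?thesis using space by blast
  qed
  have coord: "(\<lambda>\<eta>. \<eta> z) \<in> config_space \<rightarrow>\<^sub>M count_space UNIV" for z
    unfolding config_space_def by (rule measurable_restrict_space1) (rule measurable_component_singleton, simp)
  have step: "(\<lambda>\<eta>. 2 * of_bool (\<eta> y) - 1 :: int) \<in> config_space \<rightarrow>\<^sub>M count_space UNIV" for y
    by (rule measurable_compose[OF coord]) simp
  have walk: "(\<lambda>\<eta>. walk \<eta> z) \<in> config_space \<rightarrow>\<^sub>M count_space UNIV" for z
  proof -
    have "(\<lambda>\<eta>. n - (\<Sum>y\<in>{z+1..0}. 2 * of_bool (\<eta> y) - 1 :: int)) \<in> config_space \<rightarrow>\<^sub>M count_space UNIV" for n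
      using measurable_sum_count_space[OF step] measurable_count_space
      by (rule measurable_compose[where g = "\<lambda>s. n - s"])
    then show ?thesis unfolding walk_def
      using measurable_sum_count_space[OF step]
      by (rule measurable_compose_countable[where f = "\<lambda>n \<eta>. n - (\<Sum>y\<in>{z+1..0}. 2 * of_bool (\<eta> y) - 1 :: int)"
            and g = "\<lambda>\<eta>. \<Sum>y\<in>{1..z}. 2 * of_bool (\<eta> y) - 1"])
  qed
  have hit: "Measurable.pred config_space (\<lambda>\<eta>. walk \<eta> z = c)" for z c
    by (rule measurable_compose[OF walk]) simp
  have rec: "(\<lambda>\<eta>. record_pos \<eta> i) \<in> config_space \<rightarrow>\<^sub>M count_space UNIV"
    unfolding measurable_count_space_eq2_countable
  proof (intro conjI ballI)
    fix z :: int
    \<comment> \<open>On \<open>Omega_hat\<close> the least position exists, so the value of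
      \<open>record_pos\<close> is described by countably many conditions on the walk.\<close>
    have "record_pos \<eta> i = z \<longleftrightarrow> walk \<eta> z = - i \<and> (\<forall>z'. z' < z \<longrightarrow> \<not> walk \<eta> z' = - i)" if "\<eta> \<in> Omega_hat" for \<eta>
      using walk_record_pos[OF that, of i] record_pos_le[OF that, of _ i] by (meson leD linorder_neqE order_antisym not_le)
    then have "(\<lambda>\<eta>. record_pos \<eta> i) -` {z} \<inter> space config_space =
      {\<eta> \<in> space config_space. walk \<eta> z = - i \<and> (\<forall>z'. z' < z \<longrightarrow> \<not> walk \<eta> z' = - i)}"
      unfolding space by auto
    moreover have "Measurable.pred config_space (\<lambda>\<eta>. walk \<eta> z = - i \<and> (\<forall>z'. z' < z \<longrightarrow> \<not> walk \<eta> z' = - i))"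
      using hit by (intro pred_intros_countable pred_intros_logic) auto
    ultimately show "(\<lambda>\<eta>. record_pos \<eta> i) -` {z} \<inter> space config_space \<in> sets config_space"
      by (simp add: pred_def)
  qed auto
  show "Measurable.pred config_space (\<lambda>\<eta>. translate (record_pos \<eta> i) \<eta> z)" for z
    unfolding translate_def
  proof (rule measurable_compose_countable[OF _ rec])
    show "Measurable.pred config_space (\<lambda>\<eta>. \<eta> (z + r))" for r by (rule coord)
  qed
qed

text \<open>Recentring at record \<open>i\<close> shifts the sequence of excursions, and a product
  of equal factors is invariant under a bijection of its index set.\<close>

lemma record_translation_invariant_mu_hat:
  assumes nu: "prob_space (nu \<alpha>)"
  shows "record_translation_invariant (mu_hat \<alpha>)"
proof -
  let ?P = "PiM UNIV (\<lambda>_::int. nu \<alpha>)"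
  have c: "concat_excursions \<in> ?P \<rightarrow>\<^sub>M config_space"
    unfolding measurable_PiM_nu by (rule measurable_concat)
  have "prob_space ?P" by (intro prob_space_PiM nu)
  then have 1: "prob_space (mu_hat \<alpha>)" unfolding mu_hat_def by (rule prob_space.prob_space_distr[OF _ c])
  have 2: "space (mu_hat \<alpha>) = Omega_hat" by (simp add: mu_hat_def config_space_def space_restrict_space space_PiM)
  have 3: "(\<integral>\<eta>. f (translate (record_pos \<eta> i) \<eta>) \<partial>mu_hat \<alpha>) = (\<integral>\<eta>. f \<eta> \<partial>mu_hat \<alpha>)"
    if f: "f \<in> borel_measurable config_space" for i and f :: "(int \<Rightarrow> bool) \<Rightarrow> real"
  proof -
    have shift: "(\<lambda>\<epsilon> j. \<epsilon> (i + j)) \<in> ?P \<rightarrow>\<^sub>M ?P"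
      by (rule measurable_PiM_single') (auto simp: space_PiM)
    have fc: "(\<lambda>\<epsilon>. f (concat_excursions \<epsilon>)) \<in> borel_measurable ?P" by (rule measurable_compose[OF c f])
    have "(\<integral>\<eta>. f (translate (record_pos \<eta> i) \<eta>) \<partial>mu_hat \<alpha>) =
        (\<integral>\<epsilon>. f (translate (record_pos (concat_excursions \<epsilon>) i) (concat_excursions \<epsilon>)) \<partial>?P)"
      unfolding mu_hat_def by (rule integral_distr[OF c measurable_compose[OF measurable_translate_record f]])
    also have "\<dots> = (\<integral>\<epsilon>. f (concat_excursions (\<lambda>j. \<epsilon> (i + j))) \<partial>?P)"
    proof (rule Bochner_Integration.integral_cong[OF refl])
      fix \<epsilon> assume "\<epsilon> \<in> space ?P"
      then have exc: "\<And>i. \<epsilon> i \<in> excursions" by (auto simp: space_PiM PiE_def)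
      show "f (translate (record_pos (concat_excursions \<epsilon>) i) (concat_excursions \<epsilon>)) = f (concat_excursions (\<lambda>j. \<epsilon> (i + j)))"
        using record_pos_concat[of \<epsilon> i] translate_concat[of \<epsilon> i] exc by simp
    qed
    also have "\<dots> = (\<integral>\<epsilon>. f (concat_excursions \<epsilon>) \<partial>distr ?P ?P (\<lambda>\<epsilon> j. \<epsilon> (i + j)))"
      by (rule integral_distr[OF shift fc, symmetric])
    also have "distr ?P ?P (\<lambda>\<epsilon> j. \<epsilon> (i + j)) = ?P"
      using distr_PiM_reindex[of UNIV "\<lambda>_. nu \<alpha>" "\<lambda>j. i + j" UNIV] nu
      by (simp add: inj_on_def restrict_UNIV)
    also have "(\<integral>\<epsilon>. f (concat_excursions \<epsilon>) \<partial>?P) = (\<integral>\<eta>. f \<eta> \<partial>mu_hat \<alpha>)"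
      unfolding mu_hat_def by (rule integral_distr[OF c f, symmetric])
    finally show ?thesis .
  qed
  show ?thesis unfolding record_translation_invariant_def using 1 2 3 sets_mu_hat by blast
qed

text \<open>The i.i.d. excursions have the same joint law as the excursions of an auxiliary
  geometric array with parameter \<open>q_of \<alpha>\<close>. The measurable map \<open>D\<close>
  takes both to the same law, and on the auxiliary space its value is the array itself.\<close>

lemma excursions_to_array:
  assumes \<alpha>: "\<alpha> \<in> param_A" and iid: "iid M \<epsilon> (nu \<alpha>)"
  shows "has_law M (\<lambda>\<omega>. concat_excursions (\<lambda>i. \<epsilon> i \<omega>)) (mu_hat \<alpha>)"
    "independent_geometric_array M (\<lambda>k j \<omega>. soliton_decomposition (concat_excursions (\<lambda>i. \<epsilon> i \<omega>)) k j) (\<lambda>k. 1 - q_of \<alpha> k)"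
proof -
  let ?q = "q_of \<alpha>" and ?I = array_index and ?G = "geometric_law (\<lambda>k. 1 - q_of \<alpha> k)"
  have q: "?q \<in> param_Q" by (rule q_of_in_param_Q(1)[OF \<alpha>])
  have nu: "nu (alpha_of ?q) = nu \<alpha>" by (rule nu_cong) (rule q_of_in_param_Q(2)[OF \<alpha>])
  obtain N :: "(nat \<times> int \<Rightarrow> nat) measure" and \<zeta> where N: "independent_geometric_array N \<zeta> (\<lambda>k. 1 - ?q k)"
    and S: "\<forall>\<omega>\<in>space N. (\<lambda>k j. \<zeta> k j \<omega>) \<in> soliton_arrays"
    by (rule realization_exists[OF q]) blast
  define E where "E i \<omega> = excursion_at (inverse_decomposition (\<lambda>k j. \<zeta> k j \<omega>)) i" for i \<omega>
  note law = soliton_array_law[OF N q S, folded E_def, unfolded nu]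
  have M: "prob_space M" "\<And>i. \<epsilon> i \<in> M \<rightarrow>\<^sub>M nu \<alpha>"
    "distr M (PiM UNIV (\<lambda>_. nu \<alpha>)) (\<lambda>\<omega> i. \<epsilon> i \<omega>) = PiM UNIV (\<lambda>_. nu \<alpha>)"
    using iid unfolding iid_iff[OF law(1)] by blast+
  show "has_law M (\<lambda>\<omega>. concat_excursions (\<lambda>i. \<epsilon> i \<omega>)) (mu_hat \<alpha>)" by (rule has_law_concat[OF M(2,3)])
  let ?P = "PiM UNIV (\<lambda>_::int. nu \<alpha>)"
  define D where "D \<epsilon> = (\<lambda>p\<in>?I. soliton_decomposition (concat_excursions \<epsilon>) (fst p) (snd p))" for \<epsilon>
  have D: "D \<in> ?P \<rightarrow>\<^sub>M PiM ?I ?G"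
    unfolding D_def measurable_PiM_nu
    by (intro measurable_restrict) (auto simp: measurable_geometric_law intro!: measurable_soliton_decomposition)
  have RM: "(\<lambda>\<omega> i. \<epsilon> i \<omega>) \<in> M \<rightarrow>\<^sub>M ?P"
    using M(2) by (rule measurable_excursion_sequence)
  have RN: "(\<lambda>\<omega> i. E i \<omega>) \<in> N \<rightarrow>\<^sub>M ?P"
    using law(2) by (rule measurable_excursion_sequence)
  have p: "1 - ?q k \<in> {0<..1}" if "1 \<le> k" for k using one_minus_q[OF q that] .
  have "distr M (PiM ?I ?G) (\<lambda>\<omega>. \<lambda>p\<in>?I. (case p of (k, j) \<Rightarrow> \<lambda>\<omega>. soliton_decomposition (concat_excursions (\<lambda>i. \<epsilon> i \<omega>)) k j) \<omega>)
      = distr M (PiM ?I ?G) (D \<circ> (\<lambda>\<omega> i. \<epsilon> i \<omega>))"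
    by (rule arg_cong[where f = "distr M (PiM ?I ?G)"]) (auto simp: fun_eq_iff D_def)
  also have "\<dots> = distr (distr M ?P (\<lambda>\<omega> i. \<epsilon> i \<omega>)) (PiM ?I ?G) D"
    by (rule distr_distr[OF D RM, symmetric])
  also have "\<dots> = distr (distr N ?P (\<lambda>\<omega> i. E i \<omega>)) (PiM ?I ?G) D" unfolding M(3) law(3) ..
  also have "\<dots> = distr N (PiM ?I ?G) (D \<circ> (\<lambda>\<omega> i. E i \<omega>))"
    by (rule distr_distr[OF D RN])
  also have "\<dots> = distr N (PiM ?I ?G) (\<lambda>\<omega>. \<lambda>p\<in>?I. (case p of (k, j) \<Rightarrow> \<zeta> k j) \<omega>)"
  proof (rule distr_cong[OF refl refl])
    fix \<omega> assume "\<omega> \<in> space N"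
    from matches_imp_soliton_decomposition[OF law(4)[OF this]]
    show "(D \<circ> (\<lambda>\<omega> i. E i \<omega>)) \<omega> = (\<lambda>p\<in>?I. (case p of (k, j) \<Rightarrow> \<zeta> k j) \<omega>)"
      by (auto simp: fun_eq_iff D_def)
  qed
  also have "\<dots> = PiM ?I ?G"
    using N independent_geometric_array_iff[of "\<lambda>k. 1 - ?q k" N \<zeta>] p by blast
  finally have joint: "distr M (PiM ?I ?G) (\<lambda>\<omega>. \<lambda>p\<in>?I. (case p of (k, j) \<Rightarrow> \<lambda>\<omega>. soliton_decomposition (concat_excursions (\<lambda>i. \<epsilon> i \<omega>)) k j) \<omega>)
      = PiM ?I ?G" .
  have rv: "(\<lambda>\<omega>. soliton_decomposition (concat_excursions (\<lambda>i. \<epsilon> i \<omega>)) k j) \<in> M \<rightarrow>\<^sub>M count_space UNIV" if "1 \<le> k" for k j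
    using measurable_compose[OF RM, of _ "count_space UNIV"] measurable_soliton_decomposition[OF that, of j]
    unfolding measurable_PiM_nu by blast
  show "independent_geometric_array M (\<lambda>k j \<omega>. soliton_decomposition (concat_excursions (\<lambda>i. \<epsilon> i \<omega>)) k j) (\<lambda>k. 1 - ?q k)"
    using independent_geometric_array_iff[of "\<lambda>k. 1 - ?q k" M "\<lambda>k j \<omega>. soliton_decomposition (concat_excursions (\<lambda>i. \<epsilon> i \<omega>)) k j"]
      p rv joint M(1) by blast
qed

lemma array_to_excursions:
  assumes q: "q \<in> param_Q" and N: "independent_geometric_array N \<zeta> (\<lambda>k. 1 - q k)"
  defines "S \<equiv> {\<omega> \<in> space N. (\<lambda>k j. \<zeta> k j \<omega>) \<in> soliton_arrays}"
  shows "measure N S = 1"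
    "iid (restrict_space N S) (\<lambda>i \<omega>. excursion_at (inverse_decomposition (\<lambda>k j. \<zeta> k j \<omega>)) i) (nu (alpha_of q))"
    "has_law (restrict_space N S) (\<lambda>\<omega>. inverse_decomposition (\<lambda>k j. \<zeta> k j \<omega>)) (mu_hat (alpha_of q))"
    "record_translation_invariant (mu_hat (alpha_of q))"
proof -
  have S: "S \<in> sets N" "measure N S = 1" using soliton_arrays_almost_surely[OF N q] unfolding S_def by blast+
  show "measure N S = 1" by (rule S(2))
  have NS: "independent_geometric_array (restrict_space N S) \<zeta> (\<lambda>k. 1 - q k)"
    by (rule independent_geometric_array_restrict[OF N S])
  have mem: "\<forall>\<omega>\<in>space (restrict_space N S). (\<lambda>k j. \<zeta> k j \<omega>) \<in> soliton_arrays"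
    by (simp add: space_restrict_space S_def)
  note law = soliton_array_law[OF NS q mem]
  show "has_law (restrict_space N S) (\<lambda>\<omega>. inverse_decomposition (\<lambda>k j. \<zeta> k j \<omega>)) (mu_hat (alpha_of q))"
    by (rule law(5))
  show "record_translation_invariant (mu_hat (alpha_of q))"
    by (rule record_translation_invariant_mu_hat[OF law(1)])
  have "prob_space (restrict_space N S)" using NS unfolding independent_geometric_array_def by blast
  then show "iid (restrict_space N S) (\<lambda>i \<omega>. excursion_at (inverse_decomposition (\<lambda>k j. \<zeta> k j \<omega>)) i) (nu (alpha_of q))"
    using iid_iff[OF law(1)] law(2,3) by blast
qed

theorem theorem10:
  fixes M :: "'a measure" and \<alpha> :: "nat \<Rightarrow> real" and \<epsilon> :: "int \<Rightarrow> 'a \<Rightarrow> int list"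
    and N :: "'b measure" and q :: "nat \<Rightarrow> real" and \<zeta> :: "nat \<Rightarrow> int \<Rightarrow> 'b \<Rightarrow> nat"
  shows
    "(\<alpha> \<in> param_A \<and> iid M \<epsilon> (nu \<alpha>) \<longrightarrow>
        (let \<eta> = (\<lambda>\<omega>. concat_excursions (\<lambda>i. \<epsilon> i \<omega>))
         in has_law M \<eta> (mu_hat \<alpha>) \<and>
            independent_geometric_array M (\<lambda>k j \<omega>. soliton_decomposition (\<eta> \<omega>) k j)
              (\<lambda>k. 1 - q_of \<alpha> k)))
     \<and>
     (q \<in> param_Q \<and> independent_geometric_array N \<zeta> (\<lambda>k. 1 - q k) \<longrightarrow>
        (let S = {\<omega> \<in> space N. (\<lambda>k j. \<zeta> k j \<omega>) \<in> soliton_arrays};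
             \<eta> = (\<lambda>\<omega>. inverse_decomposition (\<lambda>k j. \<zeta> k j \<omega>))
         in measure N S = 1 \<and>
            iid (restrict_space N S) (\<lambda>i \<omega>. excursion_at (\<eta> \<omega>) i) (nu (alpha_of q)) \<and>
            has_law (restrict_space N S) \<eta> (mu_hat (alpha_of q)) \<and>
            record_translation_invariant (mu_hat (alpha_of q))))"
proof (intro conjI impI)
  assume "\<alpha> \<in> param_A \<and> iid M \<epsilon> (nu \<alpha>)"
  then show "let \<eta> = (\<lambda>\<omega>. concat_excursions (\<lambda>i. \<epsilon> i \<omega>))
      in has_law M \<eta> (mu_hat \<alpha>) \<and>
        independent_geometric_array M (\<lambda>k j \<omega>. soliton_decomposition (\<eta> \<omega>) k j) (\<lambda>k. 1 - q_of \<alpha> k)"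
    using excursions_to_array by (auto simp: Let_def)
next
  assume "q \<in> param_Q \<and> independent_geometric_array N \<zeta> (\<lambda>k. 1 - q k)"
  then show "let S = {\<omega> \<in> space N. (\<lambda>k j. \<zeta> k j \<omega>) \<in> soliton_arrays};
        \<eta> = (\<lambda>\<omega>. inverse_decomposition (\<lambda>k j. \<zeta> k j \<omega>))
      in measure N S = 1 \<and>
        iid (restrict_space N S) (\<lambda>i \<omega>. excursion_at (\<eta> \<omega>) i) (nu (alpha_of q)) \<and>
        has_law (restrict_space N S) \<eta> (mu_hat (alpha_of q)) \<and>
        record_translation_invariant (mu_hat (alpha_of q))"
    unfolding Let_def using array_to_excursions by blast
qed

end
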